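(* Let $K\in\mathbb{R}$, let $(X,d,\mathfrak{m})$ be a very strict $CD(K,\infty)$-space, and let $\mu_0,\mu_1\in\mathcal{P}_2(X)$ be absolutely continuous with respect to $\mathfrak{m}$. Then there exists a measure $\pi\in\mathrm{OptGeo}(\mu_0,\mu_1)$ that is induced by a map, i.e. there exists a Borel mapping $T\colon X\to\mathrm{Geo}(X)$ such that $\pi=T_\#\mu_0$.
   Context: Throughout, $(X,d,\mathfrak{m})$ is a complete and separable metric space $(X,d)$ endowed with a locally finite Borel measure $\mathfrak{m}$. A geodesic is a constant speed curve $\gamma\colon[0,1]\to X$ that is length minimizing, i.e. $l(\gamma)=d(\gamma_0,\gamma_1)$, where $l$ denotes length. $\mathrm{Geo}(X)$ is the set of all geodesics of $X$, endowed with the supremum metric. For $t\in[0,1]$, $e_t\colon\mathrm{Geo}(X)\to X$ is the evaluation map $\gamma\mapsto\gamma_t:=\gamma(t)$. For $0\le t_0<t_1\le 1$, the restriction map $\mathrm{restr}_{t_0}^{t_1}\colon\mathrm{Geo}(X)\to\mathrm{Geo}(X)$ is $\mathrm{restr}_{t_0}^{t_1}(\gamma)(t):=\gamma(t(t_1-t_0)+t_0)$. Here $F_\#\mu$ denotes the push-forward of $\mu$ under $F$. $\mathcal{P}(Y)$ is the set of Borel probability measures on $Y$, and $\mathcal{P}_2(X)$ is the set of $\mu\in\mathcal{P}(X)$ with $\int d^2(x,x_0)\,\mathrm{d}\mu(x)<\infty$ for some (equivalently all) $x_0\in X$. The Wasserstein distance is $$W_2(\mu,\nu)=\Big(\inf_{\sigma}\int_{X\times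 X}d^2(x,y)\,\mathrm{d}\sigma(x,y)\Big)^{1/2},$$ the infimum being over all $\sigma\in\mathcal{P}(X\times X)$ with first marginal $\mu$ and second marginal $\nu$; $\mathrm{Opt}(\mu,\nu)$ is the set of such $\sigma$ attaining the infimum. $\mathrm{OptGeo}(\mu_0,\mu_1)$ is the set of all $\pi\in\mathcal{P}(\mathrm{Geo}(X))$ with $(e_0,e_1)_\#\pi\in\mathrm{Opt}(\mu_0,\mu_1)$. The entropy $\mathrm{Ent}_\infty\colon\mathcal{P}(X)\to[-\infty,\infty]$ is $\mathrm{Ent}_\infty(\mu)=\int\rho\log\rho\,\mathrm{d}\mathfrak{m}$ if $\mu=\rho\,\mathfrak{m}\ll\mathfrak{m}$ and $(\rho\log\rho)_+=\max\{\rho\log\rho,0\}\in L^1(\mathfrak{m})$, and $\mathrm{Ent}_\infty(\mu)=\infty$ otherwise. For $K\in\mathbb{R}$ and $\pi\in\mathcal{P}(\mathrm{Geo}(X))$ with $\mu_t:=(e_t)_\#\pi$, the entropy is called $K$-convex along $\pi$ if for all $t\in[0,1]$ $$\mathrm{Ent}_\infty(\mu_t)\le(1-t)\,\mathrm{Ent}_\infty(\mu_0)+t\,\mathrm{Ent}_\infty(\mu_1)-\frac{K}{2}t(1-t)W_2^2(\mu_0,\mu_1).$$ $(X,d,\mathfrak{m})$ is a very strict $CD(K,\infty)$-space if for every $\mu_0,\mu_1\in\mathcal{P}_2(X)$ absolutely continuous with respect to $\mathfrak{m}$ there exists $\pi\in\mathrm{OptGeo}(\mu_0,\mu_1)$ such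 that $\mathrm{Ent}_\infty$ is $K$-convex along $(\mathrm{restr}_{t_0}^{t_1})_\#(f\pi)$ for all $t_0,t_1\in[0,1]$ with $t_0<t_1$ and for all non-negative Borel functions $f\colon\mathrm{Geo}(X)\to\mathbb{R}$ with $\int f\,\mathrm{d}\pi=1$ (where $f\pi$ is the measure with density $f$ with respect to $\pi$). *)

theory Defs
  imports "HOL-Probability.Probability"
begin

section \<open>Geodesics\<close>

definition curve_length :: "real \<Rightarrow> real \<Rightarrow> (real \<Rightarrow> 'a::metric_space) \<Rightarrow> ennreal" where
  "curve_length a b \<gamma> =
     (SUP (n, p) \<in> {(n::nat, p::nat \<Rightarrow> real). mono_on {..n} p \<and> p 0 = a \<and> p n = b}.
        \<Sum>i<n. ennreal (dist (\<gamma> (p i)) (\<gamma> (p (Suc i)))))"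

definition constant_speed :: "(real \<Rightarrow> 'a::metric_space) \<Rightarrow> bool" where
  "constant_speed \<gamma> \<longleftrightarrow>
     (\<exists>v\<ge>0. \<forall>s t. 0 \<le> s \<and> s \<le> t \<and> t \<le> 1 \<longrightarrow> curve_length s t \<gamma> = ennreal (v * (t - s)))"

definition is_geodesic :: "(real \<Rightarrow> 'a::metric_space) \<Rightarrow> bool" where
  "is_geodesic \<gamma> \<longleftrightarrow> continuous_on {0..1} \<gamma> \<and> constant_speed \<gamma> \<and>
     curve_length 0 1 \<gamma> = ennreal (dist (\<gamma> 0) (\<gamma> 1))"

lemma is_geodesic_dist:
  assumes "is_geodesic \<gamma>" "s \<in> {0..1}" "t \<in> {0..1}"
  shows "dist (\<gamma> s) (\<gamma> t) = \<bar>t - s\<bar> * dist (\<gamma> 0) (\<gamma> 1)"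
proof -
  obtain v where v: "v \<ge> 0"
    and len: "\<And>s t. 0 \<le> s \<Longrightarrow> s \<le> t \<Longrightarrow> t \<le> 1 \<Longrightarrow> curve_length s t \<gamma> = ennreal (v * (t - s))"
    using assms(1) unfolding is_geodesic_def constant_speed_def by blast
  have "ennreal v = ennreal (dist (\<gamma> 0) (\<gamma> 1))"
    using len[of 0 1] assms(1) by (simp add: is_geodesic_def)
  then have vd: "v = dist (\<gamma> 0) (\<gamma> 1)"
    using v by simp
  have up: "dist (\<gamma> s) (\<gamma> t) \<le> v * (t - s)" if "0 \<le> s" "s \<le> t" "t \<le> 1" for s t
  proof -
    define p :: "nat \<Rightarrow> real" where "p = (\<lambda>i. if i = 0 then s else t)"
    have "ennreal (dist (\<gamma> s) (\<gamma> t)) = (\<Sum>i<1::nat. ennreal (dist (\<gamma> (p i)) (\<gamma> (p (Suc i)))))"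
      by (simp add: p_def)
    also have "\<dots> \<le> curve_length s t \<gamma>"
      unfolding curve_length_def
      by (rule SUP_upper2[of "(1, p)"]) (use that in \<open>auto simp: p_def mono_on_def\<close>)
    finally show ?thesis
      using len[OF that] that v by (simp add: ennreal_le_iff)
  qed
  have eq: "dist (\<gamma> s) (\<gamma> t) = v * (t - s)" if "0 \<le> s" "s \<le> t" "t \<le> 1" for s t
  proof -
    have "v \<le> dist (\<gamma> 0) (\<gamma> s) + dist (\<gamma> s) (\<gamma> t) + dist (\<gamma> t) (\<gamma> 1)"
      unfolding vd by (meson add_mono dist_triangle order_refl order_trans)
    moreover have "dist (\<gamma> 0) (\<gamma> s) \<le> v * s" "dist (\<gamma> t) (\<gamma> 1) \<le> v * (1 - t)"
      using up[of 0 s] up[of t 1] that by auto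
    ultimately show ?thesis
      using up[OF that] by (simp add: algebra_simps)
  qed
  show ?thesis
    using eq[of s t] eq[of t s] assms(2,3) vd by (cases "s \<le> t") (auto simp: dist_commute)
qed

lemma is_geodesicI:
  assumes D: "\<And>s t. s \<in> {0..1} \<Longrightarrow> t \<in> {0..1} \<Longrightarrow> dist (\<gamma> s) (\<gamma> t) = \<bar>t - s\<bar> * D"
  shows "is_geodesic \<gamma>"
proof -
  have D01: "dist (\<gamma> 0) (\<gamma> 1) = D"
    using D[of 0 1] by simp
  then have D0: "D \<ge> 0"
    by (metis zero_le_dist)
  have len: "curve_length s t \<gamma> = ennreal (D * (t - s))" if "0 \<le> s" "s \<le> t" "t \<le> 1" for s t
  proof -
    have sum: "(\<Sum>i<n. ennreal (dist (\<gamma> (p i)) (\<gamma> (p (Suc i))))) = ennreal (D * (t - s))"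
      if p: "mono_on {..n} p" "p 0 = s" "p n = t" for n :: nat and p :: "nat \<Rightarrow> real"
    proof -
      have rng: "p i \<in> {0..1}" if "i \<le> n" for i
        using p that \<open>0 \<le> s\<close> \<open>t \<le> 1\<close> monotone_onD[OF p(1), of 0 i] monotone_onD[OF p(1), of i n] by auto
      have "(\<Sum>i<n. ennreal (dist (\<gamma> (p i)) (\<gamma> (p (Suc i))))) = (\<Sum>i<n. ennreal (D * (p (Suc i) - p i)))"
      proof (rule sum.cong[OF refl])
        fix i assume "i \<in> {..<n}"
        then have "p i \<le> p (Suc i)"
          using monotone_onD[OF p(1), of i "Suc i"] by auto
        then show "ennreal (dist (\<gamma> (p i)) (\<gamma> (p (Suc i)))) = ennreal (D * (p (Suc i) - p i))"
          using D[OF rng[of i] rng[of "Suc i"]] \<open>i \<in> {..<n}\<close> by (simp add: mult.commute)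
      qed
      also have "\<dots> = ennreal (\<Sum>i<n. D * (p (Suc i) - p i))"
        using D0 monotone_onD[OF p(1)] by (intro sum_ennreal) auto
      also have "(\<Sum>i<n. D * (p (Suc i) - p i)) = D * (t - s)"
        using p by (simp add: sum_distrib_left[symmetric] sum_lessThan_telescope)
      finally show ?thesis .
    qed
    define p :: "nat \<Rightarrow> real" where "p = (\<lambda>i. if i = 0 then s else t)"
    have ne: "(1, p) \<in> {(n::nat, p::nat \<Rightarrow> real). mono_on {..n} p \<and> p 0 = s \<and> p n = t}"
      using that by (auto simp: p_def mono_on_def)
    show ?thesis
      unfolding curve_length_def
    proof (rule antisym)
      show "(SUP (n, p) \<in> {(n::nat, p::nat \<Rightarrow> real). mono_on {..n} p \<and> p 0 = s \<and> p n = t}.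
        \<Sum>i<n. ennreal (dist (\<gamma> (p i)) (\<gamma> (p (Suc i))))) \<le> ennreal (D * (t - s))"
        by (rule SUP_least) (auto simp only: sum case_prod_conv mem_Collect_eq split_paired_all order_refl)
      show "ennreal (D * (t - s)) \<le> (SUP (n, p) \<in> {(n::nat, p::nat \<Rightarrow> real). mono_on {..n} p \<and> p 0 = s \<and> p n = t}.
        \<Sum>i<n. ennreal (dist (\<gamma> (p i)) (\<gamma> (p (Suc i)))))"
        by (rule SUP_upper2[OF ne]) (use ne in \<open>simp only: case_prod_conv mem_Collect_eq sum order_refl\<close>)
    qed
  qed
  have "D-lipschitz_on {0..1} \<gamma>"
    by (rule lipschitz_onI) (auto simp: D D0 dist_real_def mult.commute abs_minus_commute)
  then have "continuous_on {0..1} \<gamma>"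
    by (rule lipschitz_on_continuous_on)
  then show ?thesis
    unfolding is_geodesic_def constant_speed_def using len len[of 0 1] D0 D01 by auto
qed

text \<open>A curve on the unit interval is represented by a function that is \<^const>\<open>undefined\<close>
  outside of the unit interval, so that equality of curves is equality of functions.\<close>

typedef (overloaded) 'a geo =
  "{\<gamma> :: real \<Rightarrow> 'a::metric_space. \<gamma> \<in> extensional {0..1} \<and> is_geodesic \<gamma>}"
proof -
  have "is_geodesic (restrict (\<lambda>_. undefined) {0..1} :: real \<Rightarrow> 'a)"
    by (rule is_geodesicI[where D = 0]) auto
  then show ?thesis
    by (intro exI[of _ "restrict (\<lambda>_. undefined) {0..1}"]) auto
qed

definition eval :: "real \<Rightarrow> 'a::metric_space geo \<Rightarrow> 'a" where
  "eval t \<gamma> = Rep_geo \<gamma> t"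

lemma is_geodesic_Rep_geo: "is_geodesic (Rep_geo \<gamma>)"
  using Rep_geo[of \<gamma>] by simp

lemma geo_eqI: "(\<And>t. t \<in> {0..1} \<Longrightarrow> eval t \<gamma> = eval t \<eta>) \<Longrightarrow> \<gamma> = \<eta>"
  using Rep_geo[of \<gamma>] Rep_geo[of \<eta>]
  by (auto simp: eval_def Rep_geo_inject[symmetric] intro: extensionalityI)

instantiation geo :: (metric_space) metric_space
begin

definition dist_geo :: "'a geo \<Rightarrow> 'a geo \<Rightarrow> real" where
  "dist_geo \<gamma> \<eta> = (SUP t\<in>{0..1}. dist (eval t \<gamma>) (eval t \<eta>))"

definition uniformity_geo :: "('a geo \<times> 'a geo) filter" where
  "uniformity_geo = (INF e\<in>{0 <..}. principal {(x, y). dist x y < e})"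

definition open_geo :: "'a geo set \<Rightarrow> bool" where
  "open_geo S = (\<forall>x\<in>S. \<forall>\<^sub>F (x', y) in uniformity. x' = x \<longrightarrow> y \<in> S)"

lemma dist_eval_le_dist:
  assumes "t \<in> {0..1}"
  shows "dist (eval t \<gamma>) (eval t \<eta>) \<le> dist \<gamma> (\<eta> :: 'a geo)"
proof -
  have "continuous_on {0..1} (\<lambda>t. dist (eval t \<gamma>) (eval t \<eta>))"
    unfolding eval_def using is_geodesic_Rep_geo[of \<gamma>] is_geodesic_Rep_geo[of \<eta>]
    by (intro continuous_on_dist) (auto simp: is_geodesic_def)
  then have "bdd_above ((\<lambda>t. dist (eval t \<gamma>) (eval t \<eta>)) ` {0..1})"
    by (intro bounded_imp_bdd_above compact_imp_bounded compact_continuous_image) auto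
  then show ?thesis
    unfolding dist_geo_def using assms by (rule cSUP_upper[rotated])
qed

lemma dist_geo_le:
  "(\<And>t. t \<in> {0..1} \<Longrightarrow> dist (eval t \<gamma>) (eval t \<eta>) \<le> b) \<Longrightarrow> dist \<gamma> (\<eta> :: 'a geo) \<le> b"
  unfolding dist_geo_def by (rule cSUP_least) auto

instance
proof
  fix \<gamma> \<eta> \<zeta> :: "'a geo"
  show "dist \<gamma> \<eta> = 0 \<longleftrightarrow> \<gamma> = \<eta>"
  proof
    assume "dist \<gamma> \<eta> = 0"
    then have "eval t \<gamma> = eval t \<eta>" if "t \<in> {0..1}" for t
      using dist_eval_le_dist[OF that, of \<gamma> \<eta>] by simp
    then show "\<gamma> = \<eta>"
      by (rule geo_eqI)
  qed (simp add: dist_geo_def)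
  show "dist \<gamma> \<eta> \<le> dist \<gamma> \<zeta> + dist \<eta> \<zeta>"
  proof (rule dist_geo_le)
    fix t :: real assume t: "t \<in> {0..1}"
    show "dist (eval t \<gamma>) (eval t \<eta>) \<le> dist \<gamma> \<zeta> + dist \<eta> \<zeta>"
      using dist_triangle2[of "eval t \<gamma>" "eval t \<eta>" "eval t \<zeta>"]
        dist_eval_le_dist[OF t, of \<gamma> \<zeta>] dist_eval_le_dist[OF t, of \<eta> \<zeta>] by linarith
  qed
qed (simp_all add: uniformity_geo_def open_geo_def)

end

definition restr :: "real \<Rightarrow> real \<Rightarrow> 'a::metric_space geo \<Rightarrow> 'a geo" where
  "restr t0 t1 \<gamma> = Abs_geo (\<lambda>t\<in>{0..1}. eval (t * (t1 - t0) + t0) \<gamma>)"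

lemma affine_unit_interval:
  fixes t :: real
  assumes "0 \<le> t0" "t0 < t1" "t1 \<le> 1" and t: "t \<in> {0..1}"
  shows "t * (t1 - t0) + t0 \<in> {0..1}"
proof -
  have "t * (t1 - t0) \<le> t1 - t0" "0 \<le> t * (t1 - t0)"
    using t assms by (auto intro: mult_left_le_one_le)
  then have "0 \<le> t * (t1 - t0) + t0" "t * (t1 - t0) + t0 \<le> 1"
    using assms(1,3) by linarith+
  then show ?thesis
    by simp
qed

lemma eval_restr:
  assumes "0 \<le> t0" "t0 < t1" "t1 \<le> 1" and t: "t \<in> {0..1}"
  shows "eval t (restr t0 t1 \<gamma>) = eval (t * (t1 - t0) + t0) \<gamma>"
proof -
  note rng = affine_unit_interval[OF assms(1-3)]
  have "is_geodesic (\<lambda>t\<in>{0..1}. eval (t * (t1 - t0) + t0) \<gamma>)"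
  proof (rule is_geodesicI)
    fix s t :: real assume st: "s \<in> {0..1}" "t \<in> {0..1}"
    have "\<bar>(t * (t1 - t0) + t0) - (s * (t1 - t0) + t0)\<bar> = \<bar>t - s\<bar> * (t1 - t0)"
      using assms by (simp add: left_diff_distrib[symmetric] abs_mult)
    then show "dist ((\<lambda>t\<in>{0..1}. eval (t * (t1 - t0) + t0) \<gamma>) s)
        ((\<lambda>t\<in>{0..1}. eval (t * (t1 - t0) + t0) \<gamma>) t) =
        \<bar>t - s\<bar> * ((t1 - t0) * dist (eval 0 \<gamma>) (eval 1 \<gamma>))"
      using is_geodesic_dist[OF is_geodesic_Rep_geo rng[OF st(1)] rng[OF st(2)], of \<gamma>] st
      by (simp add: eval_def)
  qed
  then show ?thesis
    using t by (simp add: restr_def eval_def Abs_geo_inverse)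
qed

text \<open>Measurability of these maps is needed because \<^const>\<open>distr\<close> along a non-measurable map
  is not the push-forward measure.\<close>

lemma eval_measurable [measurable]:
  assumes "t \<in> {0..1}"
  shows "eval t \<in> borel_measurable borel"
proof (rule borel_measurable_continuous_onI)
  have "1-lipschitz_on UNIV (eval t :: 'a geo \<Rightarrow> 'a)"
    by (rule lipschitz_onI) (auto simp: dist_eval_le_dist[OF assms])
  then show "continuous_on UNIV (eval t :: 'a geo \<Rightarrow> 'a)"
    by (rule lipschitz_on_continuous_on)
qed

lemma restr_measurable [measurable]:
  assumes "0 \<le> t0" "t0 < t1" "t1 \<le> 1"
  shows "restr t0 t1 \<in> borel_measurable borel"
proof (rule borel_measurable_continuous_onI)
  have "1-lipschitz_on UNIV (restr t0 t1 :: 'a geo \<Rightarrow> 'a geo)"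
  proof (rule lipschitz_onI)
    fix \<gamma> \<eta> :: "'a geo"
    show "dist (restr t0 t1 \<gamma>) (restr t0 t1 \<eta>) \<le> 1 * dist \<gamma> \<eta>"
    proof (rule dist_geo_le)
      fix t :: real assume t: "t \<in> {0..1}"
      show "dist (eval t (restr t0 t1 \<gamma>)) (eval t (restr t0 t1 \<eta>)) \<le> 1 * dist \<gamma> \<eta>"
        using dist_eval_le_dist[OF affine_unit_interval[OF assms t]] by (simp add: eval_restr[OF assms t])
    qed
  qed simp
  then show "continuous_on UNIV (restr t0 t1 :: 'a geo \<Rightarrow> 'a geo)"
    by (rule lipschitz_on_continuous_on)
qed


section \<open>Optimal transport\<close>

definition locally_finite_borel_measure :: "'a::topological_space measure \<Rightarrow> bool" where
  "locally_finite_borel_measure \<mm> \<longleftrightarrow> sets \<mm> = sets borel \<and>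
     (\<forall>x. \<exists>U. open U \<and> x \<in> U \<and> emeasure \<mm> U < \<infinity>)"

definition borel_prob :: "'a::topological_space measure set" where
  "borel_prob = {\<mu>. prob_space \<mu> \<and> sets \<mu> = sets borel}"

definition borel_prob2 :: "'a::metric_space measure set" where
  "borel_prob2 = {\<mu> \<in> borel_prob. \<exists>x0. (\<integral>\<^sup>+x. ennreal ((dist x x0)\<^sup>2) \<partial>\<mu>) < \<infinity>}"

definition couplings ::
    "'a::topological_space measure \<Rightarrow> 'a measure \<Rightarrow> ('a \<times> 'a) measure set" where
  "couplings \<mu> \<nu> = {\<sigma> \<in> borel_prob. distr \<sigma> borel fst = \<mu> \<and> distr \<sigma> borel snd = \<nu>}"

definition transport_cost :: "('a::metric_space \<times> 'a) measure \<Rightarrow> ennreal" where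
  "transport_cost \<sigma> = (\<integral>\<^sup>+(x, y). ennreal ((dist x y)\<^sup>2) \<partial>\<sigma>)"

definition ennreal_sqrt :: "ennreal \<Rightarrow> ennreal" where
  "ennreal_sqrt x = (if x = \<infinity> then \<infinity> else ennreal (sqrt (enn2real x)))"

definition W2 :: "'a::metric_space measure \<Rightarrow> 'a measure \<Rightarrow> ennreal" where
  "W2 \<mu> \<nu> = ennreal_sqrt (INF \<sigma> \<in> couplings \<mu> \<nu>. transport_cost \<sigma>)"

definition Opt :: "'a::metric_space measure \<Rightarrow> 'a measure \<Rightarrow> ('a \<times> 'a) measure set" where
  "Opt \<mu> \<nu> = {\<sigma> \<in> couplings \<mu> \<nu>. transport_cost \<sigma> = (INF \<tau> \<in> couplings \<mu> \<nu>. transport_cost \<tau>)}"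

definition OptGeo :: "'a::metric_space measure \<Rightarrow> 'a measure \<Rightarrow> 'a geo measure set" where
  "OptGeo \<mu>0 \<mu>1 = {\<pi> \<in> borel_prob. distr \<pi> borel (\<lambda>\<gamma>. (eval 0 \<gamma>, eval 1 \<gamma>)) \<in> Opt \<mu>0 \<mu>1}"


section \<open>Entropy and very strict CD spaces\<close>

text \<open>The positive part of the integrand is integrable in the first case, so the difference of
  the two integrals is well defined; it may be \<open>-\<infinity>\<close>. At points of density zero the integrand
  is zero.\<close>

definition Ent :: "'a measure \<Rightarrow> 'a measure \<Rightarrow> ereal" where
  "Ent \<mm> \<mu> =
     (let \<rho> = (\<lambda>x. enn2real (RN_deriv \<mm> \<mu> x)); h = (\<lambda>x. \<rho> x * ln (\<rho> x)) in
      if absolutely_continuous \<mm> \<mu> \<and> integrable \<mm> (\<lambda>x. max (h x) 0)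
      then enn2ereal (\<integral>\<^sup>+x. ennreal (max (h x) 0) \<partial>\<mm>) - enn2ereal (\<integral>\<^sup>+x. ennreal (max (- h x) 0) \<partial>\<mm>)
      else \<infinity>)"

text \<open>The right-hand side can be of the form \<open>\<infinity> - \<infinity>\<close>, which in \<^typ>\<open>ereal\<close> equals \<open>\<infinity>\<close>:
  the inequality then imposes no condition. Also, \<open>0 * (\<plusminus>\<infinity>) = 0\<close>.\<close>

definition Ent_convex_along ::
    "'a::metric_space measure \<Rightarrow> real \<Rightarrow> 'a geo measure \<Rightarrow> bool" where
  "Ent_convex_along \<mm> K \<pi> \<longleftrightarrow>
     (let \<mu> = (\<lambda>t. distr \<pi> borel (eval t)) in
      \<forall>t\<in>{0..1}. Ent \<mm> (\<mu> t) \<le>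
        ereal (1 - t) * Ent \<mm> (\<mu> 0) + ereal t * Ent \<mm> (\<mu> 1)
        - ereal (K / 2 * t * (1 - t)) * (enn2ereal (W2 (\<mu> 0) (\<mu> 1)))\<^sup>2)"

definition very_strict_CD :: "real \<Rightarrow> 'a::metric_space measure \<Rightarrow> bool" where
  "very_strict_CD K \<mm> \<longleftrightarrow>
     (\<forall>\<mu>0\<in>borel_prob2. \<forall>\<mu>1\<in>borel_prob2.
        absolutely_continuous \<mm> \<mu>0 \<and> absolutely_continuous \<mm> \<mu>1 \<longrightarrow>
        (\<exists>\<pi>\<in>OptGeo \<mu>0 \<mu>1. \<forall>t0 t1 f.
           0 \<le> t0 \<and> t0 < t1 \<and> t1 \<le> 1 \<and>
           f \<in> borel_measurable borel \<and> (\<forall>\<gamma>. 0 \<le> f \<gamma>) \<and> (\<integral>\<^sup>+\<gamma>. ennreal (f \<gamma>) \<partial>\<pi>) = 1 \<longrightarrow>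
           Ent_convex_along \<mm> K (distr (density \<pi> (\<lambda>\<gamma>. ennreal (f \<gamma>))) borel (restr t0 t1))))"

end

theory Submission
  imports Defs
begin

text \<open>Every plan \<open>\<pi>\<close> provided by the very strict CD condition is induced by a map. It suffices that,
  up to null sets, the position of a geodesic at time 0 determines its position at each time
  \<open>t \<in> (0, 1)\<close>, and for this \<open>\<pi>\<close> may be restricted to a compact set of geodesics on which the
  marginals at times 0 and 1 have bounded densities, so that all entropies are finite.

  For \<open>0 < s < t < 1\<close>, suppose that an event at time \<open>s + h\<close> is not determined by the position at
  time \<open>s\<close>. Then there are two subplans of some mass \<open>c\<close> with the same law at time \<open>s\<close> and mutually
  singular laws at time \<open>s + h\<close>. As in the argument of Rajala and Sturm, the loss of \<open>ln 2\<close> in the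
  entropy of the mixture forces \<open>c \<le> C exp (- \<delta> / h)\<close>. Hence events at time \<open>s + h\<close> are determined
  at time \<open>s\<close> up to an error \<open>2 C exp (- \<delta> / h)\<close>. Going from \<open>t\<close> to \<open>s\<close> in \<open>n\<close> steps the errors
  add up to \<open>O(n exp (- \<delta>' n))\<close>, which tends to 0.

  For \<open>s = 0\<close>, two subplans with the same law at time 0 and disjoint supports have, by the above,
  mutually singular laws at all small positive times, and a volume argument of Gigli applies.\<close>

section \<open>The space of geodesics\<close>

text \<open>The estimate exponential in \<open>1 / h\<close> arises as follows. A subplan of mass
  \<open>c\<close>, once normalised, has end-point densities of order \<open>1 / c\<close>, so its
  entropies at times 0 and 1 are at most \<open>ln L - ln c\<close>, and convexity lets only a
  fraction of order \<open>h\<close> of this reach time \<open>s\<close>. The gain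
  \<open>ln 2\<close> is therefore at most of order \<open>h * (1 - ln c)\<close>, which makes
  \<open>c\<close> small but, for fixed \<open>h\<close>, not zero. This is the obstacle: one step
  alone does not exclude branching, and only refining the partition removes the error. The mixture
  estimate also needs a past, since the gain enters with the weight \<open>s / (s + h)\<close>,
  which degenerates at \<open>s = 0\<close>; hence the separate argument there. No density bound is
  available at intermediate times: the entropy is controlled from above by convexity and from below
  by the finite measure of a neighbourhood of all the curves. Time 1 is never treated, because
  closed balls of geodesics are described by the rational times in \<open>(0, 1)\<close>.\<close>

lemma dist_eval_eval:
  assumes "s \<in> {0..1}" "t \<in> {0..1}"
  shows "dist (eval s \<gamma>) (eval t \<gamma>) = \<bar>t - s\<bar> * dist (eval 0 \<gamma>) (eval 1 \<gamma>)"
  using is_geodesic_dist[OF is_geodesic_Rep_geo assms, of \<gamma>] by (simp add: eval_def)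

lemma dist_eval_eval_le:
  assumes "s \<in> {0..1}" "t \<in> {0..1}"
  shows "dist (eval s \<gamma>) (eval t \<gamma>) \<le> dist (eval 0 \<gamma>) (eval 1 \<gamma>)"
proof -
  have "\<bar>t - s\<bar> \<le> 1" using assms by auto
  then show ?thesis
    unfolding dist_eval_eval[OF assms] by (simp add: mult_left_le_one_le)
qed

text \<open>Evaluation is 1-Lipschitz in the geodesic and has constant speed in time, which together
  give joint continuity. It is used to see that the points visited by a compact set of geodesics
  form a compact set.\<close>

lemma continuous_on_eval:
  "continuous_on ({0..1} \<times> UNIV) (\<lambda>(t, \<gamma>). eval t (\<gamma> :: 'a::metric_space geo))"
  unfolding continuous_on_def
proof
  fix z :: "real \<times> 'a geo" assume z: "z \<in> {0..1} \<times> UNIV"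
  obtain t \<gamma> where zt: "z = (t, \<gamma>)" and t: "t \<in> {0..1}" using z by auto
  let ?F = "at z within {0..1} \<times> UNIV"
  have "((\<lambda>x. dist (snd x) \<gamma> + \<bar>t - fst x\<bar> * dist (eval 0 \<gamma>) (eval 1 \<gamma>)) \<longlongrightarrow>
      dist (snd z) \<gamma> + \<bar>t - fst z\<bar> * dist (eval 0 \<gamma>) (eval 1 \<gamma>)) ?F"
    by (intro tendsto_intros)
  then have lim: "((\<lambda>x. dist (snd x) \<gamma> + \<bar>t - fst x\<bar> * dist (eval 0 \<gamma>) (eval 1 \<gamma>)) \<longlongrightarrow> 0) ?F"
    by (simp add: zt)
  have "((\<lambda>x. dist (eval (fst x) (snd x)) (eval t \<gamma>)) \<longlongrightarrow> 0) ?F"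
  proof (rule tendsto_sandwich[OF _ _ tendsto_const lim])
    show "\<forall>\<^sub>F x in ?F. dist (eval (fst x) (snd x)) (eval t \<gamma>)
        \<le> dist (snd x) \<gamma> + \<bar>t - fst x\<bar> * dist (eval 0 \<gamma>) (eval 1 \<gamma>)"
      unfolding eventually_at_filter
    proof (rule always_eventually, intro allI impI)
      fix x :: "real \<times> 'a geo" assume "x \<in> {0..1} \<times> UNIV"
      then have x: "fst x \<in> {0..1}" by auto
      show "dist (eval (fst x) (snd x)) (eval t \<gamma>)
        \<le> dist (snd x) \<gamma> + \<bar>t - fst x\<bar> * dist (eval 0 \<gamma>) (eval 1 \<gamma>)"
        using dist_triangle[of "eval (fst x) (snd x)" "eval t \<gamma>" "eval (fst x) \<gamma>"]
          dist_eval_le_dist[OF x, of "snd x" \<gamma>] dist_eval_eval[OF x t, of \<gamma>] by linarith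
    qed
  qed simp
  then show "((\<lambda>(t, \<gamma>). eval t \<gamma>) \<longlongrightarrow> (case z of (t, \<gamma>) \<Rightarrow> eval t \<gamma>)) ?F"
    by (subst tendsto_dist_iff) (simp add: zt case_prod_unfold)
qed

section \<open>The space of geodesics is Polish\<close>

lemma ex_countable_subbasis_if_dense:
  fixes C :: "'a::metric_space set"
  assumes C: "countable C" and dense: "\<And>x e. e > 0 \<Longrightarrow> \<exists>c\<in>C. dist x c < e"
  shows "\<exists>B :: 'a set set. countable B \<and> open = generate_topology B"
proof -
  define B where "B = (\<lambda>(c, n). ball c (1 / real (Suc n))) ` (C \<times> UNIV)"
  have "topological_basis B"
  proof (rule topological_basisI)
    fix O' and x :: 'a assume "open O'" "x \<in> O'"
    then obtain e where e: "e > 0" "ball x e \<subseteq> O'"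
      by (meson open_contains_ball)
    then obtain n where n: "1 / real (Suc n) < e / 2"
      using nat_approx_posE[of "e / 2"] by auto
    obtain c where c: "c \<in> C" "dist x c < 1 / real (Suc n)"
      using dense[of "1 / real (Suc n)" x] by auto
    have "ball c (1 / real (Suc n)) \<subseteq> ball x e"
    proof
      fix y assume "y \<in> ball c (1 / real (Suc n))"
      then show "y \<in> ball x e"
        using dist_triangle[of x y c] c n by simp
    qed
    then show "\<exists>B'\<in>B. x \<in> B' \<and> B' \<subseteq> O'"
      using c e by (intro bexI[of _ "ball c (1 / real (Suc n))"]) (auto simp: B_def dist_commute)
  qed (auto simp: B_def)
  moreover have "countable B"
    unfolding B_def using C by (intro countable_image countable_SIGMA) auto
  ultimately show ?thesis
    using topological_basis_imp_subbasis by blast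
qed

text \<open>Geodesics are sorted into countably many cells: \<open>N / m\<close> bounds the speed,
  and the list \<open>xs\<close> over a countable dense set records the positions at the times
  \<open>k / N\<close> up to \<open>1 / m\<close>. Members of one cell are within
  \<open>4 / m\<close> of each other, so one geodesic from each cell is enough.\<close>

lemma geo_countable_dense:
  "\<exists>C :: 'a::polish_space geo set. countable C \<and> (\<forall>x e. e > 0 \<longrightarrow> (\<exists>c\<in>C. dist x c < e))"
proof -
  obtain Q :: "'a set" where Q: "countable Q" "\<And>X. open X \<Longrightarrow> X \<noteq> {} \<Longrightarrow> \<exists>d\<in>Q. d \<in> X"
    by (rule countable_dense_setE) blast
  define cell where "cell = (\<lambda>(N::nat, m::nat, xs::'a list). {\<gamma> :: 'a geo.
     dist (eval 0 \<gamma>) (eval 1 \<gamma>) \<le> real N / real m \<and>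
     (\<forall>k\<le>N. dist (eval (real k / real N) \<gamma>) (xs ! k) < 1 / real m)})"
  \<comment> \<open>For an empty cell the choice is an arbitrary geodesic, which is harmless in a
    dense set.\<close>
  define C where "C = (\<lambda>i. SOME \<gamma>. \<gamma> \<in> cell i) ` (UNIV \<times> UNIV \<times> lists Q)"
  have "countable C"
    unfolding C_def using Q by (intro countable_image countable_SIGMA) auto
  moreover have "\<exists>c\<in>C. dist \<gamma> c < e" if e: "e > 0" for \<gamma> e
  proof -
    obtain m where m: "real m > 4 / e" using reals_Archimedean2 by blast
    have m0: "real m > 0" using m e divide_pos_pos[of 4 e] by linarith
    obtain N where N: "real N > max 1 (real m * dist (eval 0 \<gamma>) (eval 1 \<gamma>))"
      using reals_Archimedean2 by blast
    have "\<exists>d\<in>Q. dist (eval (real k / real N) \<gamma>) d < 1 / real m" for k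
      using Q(2)[of "ball (eval (real k / real N) \<gamma>) (1 / real m)"] m0 by auto
    then obtain d where d: "\<And>k. d k \<in> Q" "\<And>k. dist (eval (real k / real N) \<gamma>) (d k) < 1 / real m"
      by metis
    define xs where "xs = map d [0..<Suc N]"
    have xs: "xs \<in> lists Q" and xs_nth: "\<And>k. k \<le> N \<Longrightarrow> xs ! k = d k"
      using d unfolding xs_def by (auto simp: less_Suc_eq_le simp del: upt_Suc)
    have \<gamma>: "\<gamma> \<in> cell (N, m, xs)"
      using N m0 d(2) xs_nth by (auto simp: cell_def pos_le_divide_eq mult.commute)
    define c where "c = (SOME \<gamma>. \<gamma> \<in> cell (N, m, xs))"
    have c: "c \<in> cell (N, m, xs)"
      unfolding c_def using \<gamma> by (rule someI)
    have near: "dist (eval t \<eta>) (eval (real (nat \<lfloor>t * N\<rfloor>) / real N) \<eta>) \<le> 1 / real m"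
      if "\<eta> \<in> cell (N, m, xs)" "t \<in> {0..1}" for \<eta> t
    proof -
      define k where "k = nat \<lfloor>t * N\<rfloor>"
      have k: "real k \<le> t * N" "t * N < real k + 1"
        using that N by (auto simp: k_def)
      have N0: "real N > 0" using N by linarith
      have "t * N \<le> N" using that N0 by (simp add: mult_left_le_one_le)
      then have "real k \<le> real N" using k by linarith
      then have kN: "real k / real N \<in> {0..1}"
        using N0 by simp
      have "real k / real N \<le> t" "t \<le> (real k + 1) / real N"
        using k N0 by (simp_all add: pos_divide_le_eq pos_le_divide_eq)
      then have "\<bar>real k / real N - t\<bar> \<le> 1 / real N"
        by (simp add: abs_le_iff add_divide_distrib)
      have "dist (eval t \<eta>) (eval (real k / real N) \<eta>) = \<bar>real k / real N - t\<bar> * dist (eval 0 \<eta>) (eval 1 \<eta>)"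
        by (rule dist_eval_eval[OF that(2) kN])
      also have "\<dots> \<le> (1 / real N) * (real N / real m)"
        using that(1) \<open>\<bar>real k / real N - t\<bar> \<le> 1 / real N\<close> by (intro mult_mono) (auto simp: cell_def)
      also have "\<dots> = 1 / real m" using N by simp
      finally show ?thesis by (simp add: k_def)
    qed
    \<comment> \<open>Each of the two geodesics is at most \<open>1 / m\<close> away from its
      position at the preceding grid time, and both of these positions are within
      \<open>1 / m\<close> of the recorded point.\<close>
    have "dist \<gamma> c \<le> 4 / real m"
    proof (rule dist_geo_le)
      fix t :: real assume t: "t \<in> {0..1}"
      define k where "k = nat \<lfloor>t * N\<rfloor>"
      have "t * N \<le> N" using t by (simp add: mult_left_le_one_le)
      then have "\<lfloor>t * N\<rfloor> \<le> int N" by linarith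
      then have "k \<le> N" unfolding k_def by linarith
      then have "dist (eval (real k / real N) \<gamma>) (xs ! k) < 1 / real m"
        "dist (eval (real k / real N) c) (xs ! k) < 1 / real m"
        using \<gamma> c by (auto simp: cell_def)
      then show "dist (eval t \<gamma>) (eval t c) \<le> 4 / real m"
        using near[OF \<gamma> t] near[OF c t] unfolding k_def[symmetric]
          dist_commute[of "eval t c"]
        using dist_triangle[of "eval t \<gamma>" "eval t c" "eval (real k / real N) \<gamma>"]
          dist_triangle[of "eval (real k / real N) \<gamma>" "eval t c" "eval (real k / real N) c"]
          dist_triangle2[of "eval (real k / real N) \<gamma>" "eval (real k / real N) c" "xs ! k"]
        by linarith
    qed
    also have "\<dots> < e" using m m0 e by (simp add: field_simps)
    finally have "dist \<gamma> c < e" .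
    moreover have "c \<in> C"
      unfolding C_def c_def using xs by (intro image_eqI[of _ _ "(N, m, xs)"]) auto
    ultimately show ?thesis by blast
  qed
  ultimately show ?thesis by blast
qed

text \<open>Inner regularity of plans by compact sets of geodesics rests on this. For completeness,
  the identity \<open>dist (g s) (g t) = \<bar>t - s\<bar> * dist (g 0) (g 1)\<close> characterises
  geodesics and passes to pointwise limits, whereas length by itself is only lower
  semicontinuous.\<close>

instance geo :: (polish_space) polish_space
proof
  show "\<exists>B :: 'a geo set set. countable B \<and> open = generate_topology B"
    using geo_countable_dense ex_countable_subbasis_if_dense by metis
next
  fix X :: "nat \<Rightarrow> 'a geo" assume X: "Cauchy X"
  have "\<exists>l. (\<lambda>n. eval t (X n)) \<longlonglongrightarrow> l" if t: "t \<in> {0..1}" for t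
  proof -
    have "Cauchy (\<lambda>n. eval t (X n))"
      using X dist_eval_le_dist[OF t] unfolding Cauchy_def by (meson le_less_trans)
    then show ?thesis by (simp add: Cauchy_convergent_iff convergent_def)
  qed
  then obtain g where g: "\<And>t. t \<in> {0..1} \<Longrightarrow> (\<lambda>n. eval t (X n)) \<longlonglongrightarrow> g t" by metis
  have gd: "dist (g s) (g t) = \<bar>t - s\<bar> * dist (g 0) (g 1)" if "s \<in> {0..1}" "t \<in> {0..1}" for s t
  proof (rule LIMSEQ_unique)
    show "(\<lambda>n. dist (eval s (X n)) (eval t (X n))) \<longlonglongrightarrow> dist (g s) (g t)"
      using that by (intro tendsto_dist g)
    show "(\<lambda>n. dist (eval s (X n)) (eval t (X n))) \<longlonglongrightarrow> \<bar>t - s\<bar> * dist (g 0) (g 1)"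
      unfolding dist_eval_eval[OF that] by (intro tendsto_mult tendsto_const tendsto_dist g) auto
  qed
  have "is_geodesic (restrict g {0..1})"
  proof (rule is_geodesicI)
    fix s t :: real assume "s \<in> {0..1}" "t \<in> {0..1}"
    with gd[OF this] show "dist (restrict g {0..1} s) (restrict g {0..1} t) = \<bar>t - s\<bar> * dist (g 0) (g 1)"
      by (simp only: restrict_apply if_True)
  qed
  then have L: "eval t (Abs_geo (restrict g {0..1})) = g t" if "t \<in> {0..1}" for t
    using that by (simp add: eval_def Abs_geo_inverse)
  have "X \<longlonglongrightarrow> Abs_geo (restrict g {0..1})"
  proof (rule metric_LIMSEQ_I)
    fix r :: real assume r: "r > 0"
    obtain M where M: "\<And>m n. m \<ge> M \<Longrightarrow> n \<ge> M \<Longrightarrow> dist (X m) (X n) < r / 2"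
      using X r unfolding Cauchy_def by (meson half_gt_zero)
    have "dist (X n) (Abs_geo (restrict g {0..1})) \<le> r / 2" if n: "n \<ge> M" for n
    proof (rule dist_geo_le)
      fix t :: real assume t: "t \<in> {0..1}"
      have "(\<lambda>m. dist (eval t (X n)) (eval t (X m))) \<longlonglongrightarrow> dist (eval t (X n)) (g t)"
        by (intro tendsto_dist tendsto_const g t)
      moreover have "\<forall>m\<ge>M. dist (eval t (X n)) (eval t (X m)) \<le> r / 2"
        using dist_eval_le_dist[OF t] M[OF n] by (meson le_less_trans less_imp_le)
      ultimately show "dist (eval t (X n)) (eval t (Abs_geo (restrict g {0..1}))) \<le> r / 2"
        unfolding L[OF t] by (meson Lim_bounded)
    qed
    then show "\<exists>M. \<forall>n\<ge>M. dist (X n) (Abs_geo (restrict g {0..1})) < r"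
      using r half_gt_zero[OF r] by (intro exI[of _ M] allI impI) (smt (verit) field_sum_of_halves)
  qed
  then show "convergent X" by (auto simp: convergent_def)
qed

section \<open>Entropy\<close>

lemma locally_finite_borel_measure_sigma_finite:
  fixes \<mm> :: "'a::second_countable_topology measure"
  assumes "locally_finite_borel_measure \<mm>"
  shows "sigma_finite_measure \<mm>"
proof
  have sets: "sets \<mm> = sets borel"
    and fin: "\<And>x. \<exists>U. open U \<and> x \<in> U \<and> emeasure \<mm> U < \<infinity>"
    using assms by (auto simp: locally_finite_borel_measure_def)
  obtain F' where F': "F' \<subseteq> {U. open U \<and> emeasure \<mm> U < \<infinity>}" "countable F'"
      "\<Union>F' = \<Union>{U. open U \<and> emeasure \<mm> U < \<infinity>}"
    by (rule Lindelof[of "{U. open U \<and> emeasure \<mm> U < \<infinity>}"]) auto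
  have "\<Union>F' = UNIV"
    unfolding F' using fin by fastforce
  then show "\<exists>A. countable A \<and> A \<subseteq> sets \<mm> \<and> \<Union>A = space \<mm> \<and> (\<forall>a\<in>A. emeasure \<mm> a \<noteq> \<infinity>)"
    using F' sets sets_eq_imp_space_eq[OF sets] by (intro exI[of _ F']) (auto simp: less_top)
qed

lemma locally_finite_borel_measure_compact_nbhd:
  assumes "locally_finite_borel_measure \<mm>" "compact C"
  obtains U where "open U" "C \<subseteq> U" "emeasure \<mm> U < \<infinity>"
proof -
  have fin: "\<And>x. \<exists>U. open U \<and> x \<in> U \<and> emeasure \<mm> U < \<infinity>" and sets: "sets \<mm> = sets borel"
    using assms(1) by (auto simp: locally_finite_borel_measure_def)
  obtain F where F: "F \<subseteq> {U. open U \<and> emeasure \<mm> U < \<infinity>}" "finite F" "C \<subseteq> \<Union>F"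
    by (rule compactE[OF assms(2), of "{U. open U \<and> emeasure \<mm> U < \<infinity>}"]) (use fin in fastforce)+
  have "emeasure \<mm> (\<Union>F) \<le> (\<Sum>U\<in>F. emeasure \<mm> U)"
  proof -
    have "F \<subseteq> sets \<mm>" using F(1) sets by auto
    then show ?thesis using emeasure_subadditive_finite[OF F(2), of "\<lambda>x. x" \<mm>] by simp
  qed
  also have "\<dots> < \<infinity>" using F by (auto simp: less_top[symmetric] )
  finally show ?thesis using F by (intro that[of "\<Union>F"]) auto
qed

text \<open>The left-hand side is the tangent at \<open>a\<close> of the convex function
  \<open>x * ln x\<close>. Integrating it replaces Jensen's inequality in the lower entropy
  bounds.\<close>

lemma mult_ln_ge_tangent:
  fixes x a :: real
  assumes "x \<ge> 0" "a > 0"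
  shows "x * ln a + x - a \<le> x * ln x"
proof (cases "x = 0")
  case False
  then have x: "x > 0" using assms by simp
  have "ln (a / x) \<le> a / x - 1" using ln_le_minus_one[of "a / x"] x assms by simp
  then have "x * (ln a - ln x) \<le> x * (a / x - 1)"
    using x assms by (intro mult_left_mono) (auto simp: ln_div)
  then show ?thesis using x by (simp add: algebra_simps)
qed (use assms in simp)

section \<open>Entropy as an integral, and its bounds\<close>

context sigma_finite_measure
begin

text \<open>The derivative of a finite measure is finite almost everywhere, so passing to real
  values as in \<open>Ent\<close>, where \<open>\<infinity>\<close> becomes 0, changes it only on a
  null set.\<close>

lemma density_enn2real_RN_deriv:
  assumes "finite_measure N" "absolutely_continuous M N" "sets N = sets M"
  shows "density M (\<lambda>x. ennreal (enn2real (RN_deriv M N x))) = N"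
proof -
  interpret N: finite_measure N by fact
  have "AE x in M. RN_deriv M N x \<noteq> \<infinity>"
    using assms by (intro RN_deriv_finite) (auto intro: N.sigma_finite_measure_axioms)
  then have "density M (\<lambda>x. ennreal (enn2real (RN_deriv M N x))) = density M (RN_deriv M N)"
    by (intro density_cong) (auto elim!: eventually_mono simp: less_top)
  then show ?thesis using density_RN_deriv[of N] assms by simp
qed

lemma Ent_density:
  assumes [measurable]: "\<rho> \<in> borel_measurable M" and nn: "\<And>x. 0 \<le> \<rho> x"
    and int: "integrable M (\<lambda>x. \<rho> x * ln (\<rho> x))"
  shows "Ent M (density M (\<lambda>x. ennreal (\<rho> x))) = ereal (\<integral>x. \<rho> x * ln (\<rho> x) \<partial>M)"
proof -
  let ?\<mu> = "density M (\<lambda>x. ennreal (\<rho> x))"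
  have "AE x in M. ennreal (\<rho> x) = RN_deriv M ?\<mu> x"
    by (rule RN_deriv_unique) auto
  then have ae: "AE x in M. enn2real (RN_deriv M ?\<mu> x) = \<rho> x"
    by eventually_elim (metis enn2real_ennreal nn)
  let ?h = "\<lambda>x. \<rho> x * ln (\<rho> x)"
  let ?h' = "\<lambda>x. enn2real (RN_deriv M ?\<mu> x) * ln (enn2real (RN_deriv M ?\<mu> x))"
  have ac: "absolutely_continuous M ?\<mu>"
    by (rule absolutely_continuousI_density) simp
  have p: "integrable M (\<lambda>x. max (?h x) 0)" and n: "integrable M (\<lambda>x. max (- ?h x) 0)"
    using int by auto
  have p': "integrable M (\<lambda>x. max (?h' x) 0)"
    by (rule integrable_cong_AE_imp[OF p]) (use ae in \<open>auto elim: eventually_mono\<close>)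
  have "(\<integral>\<^sup>+x. ennreal (max (?h' x) 0) \<partial>M) = (\<integral>\<^sup>+x. ennreal (max (?h x) 0) \<partial>M)"
    by (rule nn_integral_cong_AE) (use ae in \<open>auto elim: eventually_mono\<close>)
  also have "\<dots> = ennreal (\<integral>x. max (?h x) 0 \<partial>M)"
    by (rule nn_integral_eq_integral[OF p]) auto
  finally have P: "enn2ereal (\<integral>\<^sup>+x. ennreal (max (?h' x) 0) \<partial>M) = ereal (\<integral>x. max (?h x) 0 \<partial>M)"
    by (simp add: enn2ereal_ennreal)
  have "(\<integral>\<^sup>+x. ennreal (max (- ?h' x) 0) \<partial>M) = (\<integral>\<^sup>+x. ennreal (max (- ?h x) 0) \<partial>M)"
    by (rule nn_integral_cong_AE) (use ae in \<open>auto elim: eventually_mono\<close>)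
  also have "\<dots> = ennreal (\<integral>x. max (- ?h x) 0 \<partial>M)"
    by (rule nn_integral_eq_integral[OF n]) auto
  finally have N: "enn2ereal (\<integral>\<^sup>+x. ennreal (max (- ?h' x) 0) \<partial>M) = ereal (\<integral>x. max (- ?h x) 0 \<partial>M)"
    by (simp add: enn2ereal_ennreal)
  have "(\<integral>x. max (?h x) 0 \<partial>M) - (\<integral>x. max (- ?h x) 0 \<partial>M) = (\<integral>x. max (?h x) 0 - max (- ?h x) 0 \<partial>M)"
    by (rule Bochner_Integration.integral_diff[OF p n, symmetric])
  also have "\<dots> = (\<integral>x. ?h x \<partial>M)" by (rule Bochner_Integration.integral_cong) auto
  finally show ?thesis
    unfolding Ent_def Let_def using ac p' P N by simp
qed

lemma AE_density_support:
  assumes [measurable]: "\<rho> \<in> borel_measurable M" "S \<in> sets M" and nn: "\<And>x. 0 \<le> \<rho> x"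
    and S: "AE x in density M (\<lambda>x. ennreal (\<rho> x)). x \<in> S"
  shows "AE x in M. x \<notin> S \<longrightarrow> \<rho> x = 0"
proof -
  have "AE x in M. 0 < ennreal (\<rho> x) \<longrightarrow> x \<in> S"
    using S by (subst (asm) AE_density) auto
  then show ?thesis
    by eventually_elim (use nn in \<open>force simp: less_le\<close>)
qed

text \<open>On \<open>S\<close> the negative part of \<open>\<rho> * ln \<rho>\<close> is at most 1,
  by the tangent at 1, and outside it vanishes. As \<open>S\<close> has finite measure, the value
  \<open>-\<infinity>\<close> is excluded, and a finite entropy is an ordinary Bochner
  integral.\<close>

lemma Ent_cases:
  assumes \<mu>: "prob_space \<mu>" "sets \<mu> = sets M"
    and S: "S \<in> sets M" "emeasure M S < \<infinity>" "AE x in \<mu>. x \<in> S"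
  obtains "Ent M \<mu> = \<infinity>"
  | \<rho> where "\<rho> \<in> borel_measurable M" "\<And>x. 0 \<le> \<rho> x" "\<mu> = density M (\<lambda>x. ennreal (\<rho> x))"
      "integrable M (\<lambda>x. \<rho> x * ln (\<rho> x))" "Ent M \<mu> = ereal (\<integral>x. \<rho> x * ln (\<rho> x) \<partial>M)"
proof -
  interpret \<mu>: prob_space \<mu> by fact
  define \<rho> where "\<rho> = (\<lambda>x. enn2real (RN_deriv M \<mu> x))"
  have \<rho>[measurable]: "\<rho> \<in> borel_measurable M" and nn: "\<And>x. 0 \<le> \<rho> x"
    by (auto simp: \<rho>_def)
  show thesis
  proof (cases "absolutely_continuous M \<mu> \<and> integrable M (\<lambda>x. max (\<rho> x * ln (\<rho> x)) 0)")
    case False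
    then have "Ent M \<mu> = \<infinity>" unfolding Ent_def \<rho>_def Let_def by auto
    then show thesis by (rule that)
  next
    case True
    have dens: "\<mu> = density M (\<lambda>x. ennreal (\<rho> x))"
      using density_enn2real_RN_deriv[of \<mu>] True \<mu> by (simp add: \<rho>_def \<mu>.finite_measure_axioms)
    have supp: "AE x in M. x \<notin> S \<longrightarrow> \<rho> x = 0"
      by (rule AE_density_support[OF \<rho> S(1) nn S(3)[unfolded dens]])
    have n: "integrable M (\<lambda>x. max (- (\<rho> x * ln (\<rho> x))) 0)"
    proof (rule Bochner_Integration.integrable_bound[of M "indicator S :: _ \<Rightarrow> real"])
      show "AE x in M. norm (max (- (\<rho> x * ln (\<rho> x))) 0) \<le> norm (indicator S x :: real)"
        using supp
      proof eventually_elim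
        case (elim x)
        have "\<rho> x - 1 \<le> \<rho> x * ln (\<rho> x)"
          using mult_ln_ge_tangent[OF nn, of 1 x] by simp
        then have "- (\<rho> x * ln (\<rho> x)) \<le> 1"
          using nn[of x] by linarith
        then show ?case using elim by (auto split: split_indicator)
      qed
    qed (use S in auto)
    have "integrable M (\<lambda>x. max (\<rho> x * ln (\<rho> x)) 0 - max (- (\<rho> x * ln (\<rho> x))) 0)"
      using True n by (intro Bochner_Integration.integrable_diff) auto
    also have "(\<lambda>x. max (\<rho> x * ln (\<rho> x)) 0 - max (- (\<rho> x * ln (\<rho> x))) 0) = (\<lambda>x. \<rho> x * ln (\<rho> x))"
      by (auto simp: max_def)
    finally have int: "integrable M (\<lambda>x. \<rho> x * ln (\<rho> x))" .
    show thesis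
      by (rule that(2)[OF \<rho> nn dens int]) (subst dens, rule Ent_density[OF \<rho> nn int])
  qed
qed

lemma prob_density_integral:
  assumes "prob_space (density M (\<lambda>x. ennreal (\<rho> x)))" "\<rho> \<in> borel_measurable M" "\<And>x. 0 \<le> \<rho> x"
  shows "integrable M \<rho>" "(\<integral>x. \<rho> x \<partial>M) = 1"
proof -
  have "(\<integral>\<^sup>+x. ennreal (\<rho> x) \<partial>M) = 1"
    using prob_space.emeasure_space_1[OF assms(1)] assms(2)
    by (simp add: emeasure_density cong: nn_integral_cong)
  then show "integrable M \<rho>" "(\<integral>x. \<rho> x \<partial>M) = 1"
    using assms by (auto intro: integrableI_nonneg simp: integral_eq_nn_integral)
qed

text \<open>This is the tangent at \<open>a\<close> integrated over \<open>S\<close>. The point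
  \<open>a\<close> stays free: \<open>a = 1\<close> gives a bound depending only on the measure of
  \<open>S\<close>, while \<open>a = 1 / \<alpha>\<close> compares with the entropy of a uniform law
  on a set of measure \<open>\<alpha>\<close>.\<close>

lemma Ent_ge:
  assumes \<mu>: "prob_space \<mu>" "sets \<mu> = sets M"
    and S: "S \<in> sets M" "emeasure M S < \<infinity>" "AE x in \<mu>. x \<in> S" and a: "a > 0"
  shows "ereal (ln a + 1 - a * measure M S) \<le> Ent M \<mu>"
proof (rule Ent_cases[OF \<mu> S])
  fix \<rho> assume \<rho>[measurable]: "\<rho> \<in> borel_measurable M" and nn: "\<And>x. 0 \<le> \<rho> x"
    and dens: "\<mu> = density M (\<lambda>x. ennreal (\<rho> x))"
    and int: "integrable M (\<lambda>x. \<rho> x * ln (\<rho> x))" and E: "Ent M \<mu> = ereal (\<integral>x. \<rho> x * ln (\<rho> x) \<partial>M)"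
  note \<rho>1 = prob_density_integral[OF \<mu>(1)[unfolded dens] \<rho> nn]
  have supp: "AE x in M. x \<notin> S \<longrightarrow> \<rho> x = 0"
    by (rule AE_density_support[OF \<rho> S(1) nn S(3)[unfolded dens]])
  have "ln a + 1 - a * measure M S = (\<integral>x. \<rho> x * ln a + \<rho> x - a * indicator S x \<partial>M)"
    using \<rho>1 S by (subst Bochner_Integration.integral_diff Bochner_Integration.integral_add; auto)+
  also have "\<dots> \<le> (\<integral>x. \<rho> x * ln (\<rho> x) \<partial>M)"
  proof (rule integral_mono_AE[OF _ int])
    show "integrable M (\<lambda>x. \<rho> x * ln a + \<rho> x - a * indicator S x)"
      using \<rho>1 S by auto
    show "AE x in M. \<rho> x * ln a + \<rho> x - a * indicator S x \<le> \<rho> x * ln (\<rho> x)"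
      using supp by eventually_elim (use mult_ln_ge_tangent[OF nn a] in \<open>auto split: split_indicator\<close>)
  qed
  finally show ?thesis by (simp add: E)
qed simp

text \<open>The mass of the set where \<open>\<rho> > R\<close> exceeds \<open>R\<close> times its
  measure by the integral of \<open>\<rho> - R\<close>. Finite total mass permits the common term to
  be cancelled, so this excess is zero.\<close>

lemma AE_density_le:
  assumes [measurable]: "\<rho> \<in> borel_measurable M" and R: "0 < R"
    and fin: "emeasure (density M (\<lambda>x. ennreal (\<rho> x))) (space M) < \<infinity>"
    and le: "\<And>B. B \<in> sets M \<Longrightarrow> emeasure (density M (\<lambda>x. ennreal (\<rho> x))) B \<le> ennreal R * emeasure M B"
  shows "AE x in M. \<rho> x \<le> R"
proof -
  let ?\<mu> = "density M (\<lambda>x. ennreal (\<rho> x))"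
  define B where "B = {x \<in> space M. R < \<rho> x}"
  have B[measurable]: "B \<in> sets M" unfolding B_def by measurable
  have eq: "emeasure ?\<mu> B = (\<integral>\<^sup>+x. ennreal (\<rho> x - R) * indicator B x \<partial>M) + ennreal R * emeasure M B"
  proof -
    have "emeasure ?\<mu> B = (\<integral>\<^sup>+x. ennreal (\<rho> x - R) * indicator B x + ennreal R * indicator B x \<partial>M)"
      unfolding emeasure_density[OF measurable_compose[OF assms(1) measurable_ennreal] B]
      by (rule nn_integral_cong) (use R in \<open>auto simp: B_def ennreal_plus[symmetric] simp del: ennreal_plus split: split_indicator\<close>)
    also have "\<dots> = (\<integral>\<^sup>+x. ennreal (\<rho> x - R) * indicator B x \<partial>M) + ennreal R * emeasure M B"
      by (subst nn_integral_add) (auto simp: nn_integral_cmult_indicator)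
    finally show ?thesis .
  qed
  have "emeasure ?\<mu> B < \<infinity>"
    using fin emeasure_mono[of B "space M" ?\<mu>] sets.sets_into_space[OF B] by (auto simp: le_less_trans)
  then have "ennreal R * emeasure M B < \<infinity>"
    unfolding eq by (auto simp: less_top[symmetric])
  then have "(\<integral>\<^sup>+x. ennreal (\<rho> x - R) * indicator B x \<partial>M) = 0"
    using le[OF B] ennreal_add_left_cancel_le[of "ennreal R * emeasure M B" _ 0] unfolding eq
    by (auto simp: add.commute)
  then have "AE x in M. ennreal (\<rho> x - R) * indicator B x = 0"
    by (subst (asm) nn_integral_0_iff_AE) auto
  with AE_space show ?thesis
    by eventually_elim (auto simp: B_def ennreal_eq_0_iff split: split_indicator_asm)
qed

text \<open>The density is at most \<open>R\<close>, so
  \<open>\<rho> * ln \<rho> \<le> \<rho> * ln R\<close>. This both makes the positive part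
  integrable, which excludes infinite entropy, and integrates to \<open>ln R\<close>.\<close>

lemma Ent_le:
  assumes \<mu>: "prob_space \<mu>" "sets \<mu> = sets M"
    and S: "S \<in> sets M" "emeasure M S < \<infinity>" "AE x in \<mu>. x \<in> S" and R: "R > 0"
    and le: "\<And>B. B \<in> sets M \<Longrightarrow> emeasure \<mu> B \<le> ennreal R * emeasure M B"
  shows "Ent M \<mu> \<le> ereal (ln R)"
proof -
  interpret \<mu>: prob_space \<mu> by fact
  have ac: "absolutely_continuous M \<mu>"
    unfolding absolutely_continuous_def using le \<mu>(2) by (force simp: null_sets_def)
  define \<rho> where "\<rho> = (\<lambda>x. enn2real (RN_deriv M \<mu> x))"
  have \<rho>[measurable]: "\<rho> \<in> borel_measurable M" and nn: "\<And>x. 0 \<le> \<rho> x"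
    by (auto simp: \<rho>_def)
  have dens: "\<mu> = density M (\<lambda>x. ennreal (\<rho> x))"
    using density_enn2real_RN_deriv[of \<mu>] ac \<mu> by (simp add: \<rho>_def \<mu>.finite_measure_axioms)
  have \<rho>R: "AE x in M. \<rho> x \<le> R"
  proof (rule AE_density_le[OF \<rho> R])
    show "emeasure (density M (\<lambda>x. ennreal (\<rho> x))) (space M) < \<infinity>"
      using \<mu>.emeasure_space_1 unfolding dens[symmetric] sets_eq_imp_space_eq[OF \<mu>(2)] by simp
  qed (rule le[unfolded dens])
  note \<rho>1 = prob_density_integral[OF \<mu>(1)[unfolded dens] \<rho> nn]
  have ub: "AE x in M. \<rho> x * ln (\<rho> x) \<le> \<rho> x * ln R"
    using \<rho>R
  proof eventually_elim
    case (elim x)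
    then show ?case using nn[of x] R by (cases "\<rho> x = 0") (auto intro!: mult_left_mono)
  qed
  have p: "integrable M (\<lambda>x. max (\<rho> x * ln (\<rho> x)) 0)"
  proof (rule Bochner_Integration.integrable_bound[of M "\<lambda>x. \<rho> x * ln R"])
    show "AE x in M. norm (max (\<rho> x * ln (\<rho> x)) 0) \<le> norm (\<rho> x * ln R)"
      using ub by eventually_elim auto
  qed (use \<rho>1 in auto)
  then have ne: "Ent M \<mu> \<noteq> \<infinity>"
  proof -
    have "(\<integral>\<^sup>+x. ennreal (max (\<rho> x * ln (\<rho> x)) 0) \<partial>M) = ennreal (\<integral>x. max (\<rho> x * ln (\<rho> x)) 0 \<partial>M)"
      by (rule nn_integral_eq_integral[OF p]) auto
    then show ?thesis
      unfolding Ent_def Let_def \<rho>_def[symmetric] using ac p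
      by (auto simp: \<rho>_def enn2ereal_ennreal ereal_minus_eq_PInfty_iff)
  qed
  show ?thesis
  proof (rule Ent_cases[OF \<mu> S])
    fix \<rho>' assume \<rho>'[measurable]: "\<rho>' \<in> borel_measurable M" and nn': "\<And>x. 0 \<le> \<rho>' x"
      and dens': "\<mu> = density M (\<lambda>x. ennreal (\<rho>' x))"
      and int: "integrable M (\<lambda>x. \<rho>' x * ln (\<rho>' x))"
      and E: "Ent M \<mu> = ereal (\<integral>x. \<rho>' x * ln (\<rho>' x) \<partial>M)"
    have "AE x in M. ennreal (\<rho> x) = ennreal (\<rho>' x)"
      using dens dens' by (subst density_unique_iff[symmetric]) auto
    then have "AE x in M. \<rho>' x = \<rho> x" using nn nn' by auto
    with ub have "AE x in M. \<rho>' x * ln (\<rho>' x) \<le> \<rho> x * ln R" by eventually_elim auto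
    then have "(\<integral>x. \<rho>' x * ln (\<rho>' x) \<partial>M) \<le> (\<integral>x. \<rho> x * ln R \<partial>M)"
      by (intro integral_mono_AE int) (use \<rho>1 in auto)
    also have "\<dots> = ln R" using \<rho>1 by simp
    finally show ?thesis by (simp add: E)
  qed (use ne in simp)
qed

text \<open>Where only one density is nonzero, halving it turns \<open>y * ln y\<close> into half of
  \<open>y * ln y - ln 2 * y\<close>. The last terms integrate to exactly \<open>ln 2\<close>, the
  gain over mere convexity that drives the whole argument.\<close>

lemma Ent_mix_singular:
  assumes \<mu>: "prob_space \<mu>1" "sets \<mu>1 = sets M" "prob_space \<mu>2" "sets \<mu>2 = sets M" "sets \<mu> = sets M"
    and S: "S \<in> sets M" "emeasure M S < \<infinity>" "AE x in \<mu>1. x \<in> S" "AE x in \<mu>2. x \<in> S"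
    and mix: "\<And>B. B \<in> sets M \<Longrightarrow> 2 * emeasure \<mu> B = emeasure \<mu>1 B + emeasure \<mu>2 B"
    and A: "A \<in> sets M" "AE x in \<mu>1. x \<in> A" "AE x in \<mu>2. x \<notin> A"
    and E: "Ent M \<mu>1 = ereal e1" "Ent M \<mu>2 = ereal e2"
  shows "Ent M \<mu> = ereal ((e1 + e2) / 2 - ln 2)"
proof -
  obtain \<rho>1 where \<rho>1[measurable]: "\<rho>1 \<in> borel_measurable M" and nn1: "\<And>x. 0 \<le> \<rho>1 x"
      and dens1: "\<mu>1 = density M (\<lambda>x. ennreal (\<rho>1 x))"
      and int1: "integrable M (\<lambda>x. \<rho>1 x * ln (\<rho>1 x))" and e1: "e1 = (\<integral>x. \<rho>1 x * ln (\<rho>1 x) \<partial>M)"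
    by (rule Ent_cases[OF \<mu>(1,2) S(1,2,3)]) (use E in auto)
  obtain \<rho>2 where \<rho>2[measurable]: "\<rho>2 \<in> borel_measurable M" and nn2: "\<And>x. 0 \<le> \<rho>2 x"
      and dens2: "\<mu>2 = density M (\<lambda>x. ennreal (\<rho>2 x))"
      and int2: "integrable M (\<lambda>x. \<rho>2 x * ln (\<rho>2 x))" and e2: "e2 = (\<integral>x. \<rho>2 x * ln (\<rho>2 x) \<partial>M)"
    by (rule Ent_cases[OF \<mu>(3,4) S(1,2,4)]) (use E in auto)
  note i1 = prob_density_integral[OF \<mu>(1)[unfolded dens1] \<rho>1 nn1]
  note i2 = prob_density_integral[OF \<mu>(3)[unfolded dens2] \<rho>2 nn2]
  have a1: "AE x in M. x \<notin> A \<longrightarrow> \<rho>1 x = 0"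
    by (rule AE_density_support[OF \<rho>1 A(1) nn1 A(2)[unfolded dens1]])
  have "AE x in \<mu>2. x \<in> space M - A"
    using A(3) AE_space[of \<mu>2] unfolding sets_eq_imp_space_eq[OF \<mu>(4)] by eventually_elim auto
  then have a2: "AE x in M. x \<notin> space M - A \<longrightarrow> \<rho>2 x = 0"
    unfolding dens2 by (intro AE_density_support \<rho>2 nn2) (use A(1) in auto)
  define \<rho> where "\<rho> = (\<lambda>x. (\<rho>1 x + \<rho>2 x) / 2)"
  have \<rho>[measurable]: "\<rho> \<in> borel_measurable M" and nn: "\<And>x. 0 \<le> \<rho> x"
    using nn1 nn2 by (auto simp: \<rho>_def)
  have dens: "\<mu> = density M (\<lambda>x. ennreal (\<rho> x))"
  proof (rule measure_eqI)
    fix B assume "B \<in> sets \<mu>"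
    then have B[measurable]: "B \<in> sets M" using \<mu> by simp
    have "2 * emeasure (density M (\<lambda>x. ennreal (\<rho> x))) B = (\<integral>\<^sup>+x. 2 * (ennreal (\<rho> x) * indicator B x) \<partial>M)"
      by (subst nn_integral_cmult) (auto simp: emeasure_density)
    also have "\<dots> = (\<integral>\<^sup>+x. ennreal (\<rho>1 x) * indicator B x + ennreal (\<rho>2 x) * indicator B x \<partial>M)"
    proof (rule nn_integral_cong)
      fix x
      have "2 * ennreal (\<rho> x) = ennreal (2 * \<rho> x)"
        using nn by (subst ennreal_mult) auto
      also have "\<dots> = ennreal (\<rho>1 x) + ennreal (\<rho>2 x)"
        using nn1[of x] nn2[of x] by (simp add: \<rho>_def flip: ennreal_plus)
      finally show "2 * (ennreal (\<rho> x) * indicator B x) = ennreal (\<rho>1 x) * indicator B x + ennreal (\<rho>2 x) * indicator B x"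
        by (simp add: mult.assoc[symmetric] distrib_right)
    qed
    also have "\<dots> = 2 * emeasure \<mu> B"
      unfolding mix[OF B] dens1 dens2 by (subst nn_integral_add) (auto simp: emeasure_density)
    finally show "emeasure \<mu> B = emeasure (density M (\<lambda>x. ennreal (\<rho> x))) B"
      by (auto simp: ennreal_mult_cancel_left)
  qed (use \<mu> in simp)
  have eq: "AE x in M. \<rho> x * ln (\<rho> x)
      = (\<rho>1 x * ln (\<rho>1 x) + \<rho>2 x * ln (\<rho>2 x) - ln 2 * (\<rho>1 x + \<rho>2 x)) / 2"
    using a1 a2 AE_space
  proof eventually_elim
    case (elim x)
    have *: "y / 2 * ln (y / 2) = (y * ln y - ln 2 * y) / 2" if "y \<ge> 0" for y :: real
      using that by (cases "y = 0") (auto simp: ln_div field_simps)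
    have "\<rho>1 x = 0 \<or> \<rho>2 x = 0" using elim by auto
    then show ?case
      using *[OF nn1[of x]] *[OF nn2[of x]] by (auto simp: \<rho>_def)
  qed
  have I: "integrable M (\<lambda>x. (\<rho>1 x * ln (\<rho>1 x) + \<rho>2 x * ln (\<rho>2 x) - ln 2 * (\<rho>1 x + \<rho>2 x)) / 2)"
    using int1 int2 i1 i2 by auto
  have int: "integrable M (\<lambda>x. \<rho> x * ln (\<rho> x))"
    by (rule integrable_cong_AE_imp[OF I]) (use eq in \<open>auto elim: eventually_mono\<close>)
  have "(\<integral>x. \<rho> x * ln (\<rho> x) \<partial>M) = (\<integral>x. (\<rho>1 x * ln (\<rho>1 x) + \<rho>2 x * ln (\<rho>2 x) - ln 2 * (\<rho>1 x + \<rho>2 x)) / 2 \<partial>M)"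
    by (rule integral_cong_AE) (use eq in auto)
  also have "\<dots> = (e1 + e2) / 2 - ln 2"
    using int1 int2 i1 i2 by (simp add: e1 e2)
  finally show ?thesis
    unfolding dens Ent_density[OF \<rho> nn int] by simp
qed

end

section \<open>Conditional probabilities given a map\<close>

lemma distr_density_comp:
  assumes [measurable]: "e \<in> measurable M N" "g \<in> borel_measurable N"
  shows "distr (density M (\<lambda>x. g (e x))) N e = density (distr M N e) g"
proof (rule measure_eqI)
  fix B assume "B \<in> sets (distr (density M (\<lambda>x. g (e x))) N e)"
  then have [measurable]: "B \<in> sets N" by simp
  have "emeasure (density (distr M N e) g) B = (\<integral>\<^sup>+x. g (e x) * indicator B (e x) \<partial>M)"
    by (simp add: emeasure_density nn_integral_distr)
  also have "\<dots> = (\<integral>\<^sup>+x. g (e x) * indicator (e -` B \<inter> space M) x \<partial>M)"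
    by (intro nn_integral_cong) (auto split: split_indicator)
  finally show "emeasure (distr (density M (\<lambda>x. g (e x))) N e) B = emeasure (density (distr M N e) g) B"
    by (simp add: emeasure_distr emeasure_density)
qed simp

text \<open>The conditional probability is realised as the density of the image of the restriction
  to \<open>D\<close> with respect to the full image, so no disintegration is required. The images
  of \<open>D\<close> and of its complement add up to the full image, whence the density
  \<open>1 - p\<close>.\<close>

lemma (in prob_space) conditional_probability_given_map:
  assumes e[measurable]: "e \<in> measurable M N" and D[measurable]: "D \<in> sets M"
  obtains p where "p \<in> borel_measurable N" "\<And>x. 0 \<le> p x" "\<And>x. p x \<le> 1"
    "distr (density M (indicator D)) N e = density (distr M N e) (\<lambda>x. ennreal (p x))"
    "distr (density M (indicator (space M - D))) N e = density (distr M N e) (\<lambda>x. ennreal (1 - p x))"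
proof -
  let ?\<mu> = "distr M N e"
  interpret \<mu>: prob_space ?\<mu> by (rule prob_space_distr) simp
  let ?\<nu> = "\<lambda>D. distr (density M (indicator D)) N e"
  have \<nu>: "emeasure (?\<nu> D) B = emeasure M (D \<inter> (e -` B \<inter> space M))" if [measurable]: "B \<in> sets N" "D \<in> sets M" for B D
    by (simp add: emeasure_distr emeasure_density flip: indicator_inter_arith)
  have le: "emeasure (?\<nu> D) B \<le> emeasure ?\<mu> B" if [measurable]: "B \<in> sets N" for B
    unfolding \<nu>[OF that D] by (auto simp: emeasure_distr intro!: emeasure_mono)
  have ac: "absolutely_continuous ?\<mu> (?\<nu> D)"
    unfolding absolutely_continuous_def using le by (force simp: null_sets_def)
  define h where "h = RN_deriv ?\<mu> (?\<nu> D)"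
  have h[measurable]: "h \<in> borel_measurable ?\<mu>" by (simp add: h_def)
  have fin: "emeasure (?\<nu> D) (space N) < \<infinity>"
    by (subst \<nu>) (auto simp: emeasure_eq_measure)
  then have "finite_measure (?\<nu> D)" by (intro finite_measureI) auto
  then have d: "?\<nu> D = density ?\<mu> (\<lambda>x. ennreal (enn2real (h x)))"
    unfolding h_def using \<mu>.density_enn2real_RN_deriv[OF _ ac] by simp
  have "AE x in ?\<mu>. enn2real (h x) \<le> 1"
  proof (rule \<mu>.AE_density_le)
    show "emeasure (density ?\<mu> (\<lambda>x. ennreal (enn2real (h x)))) (space ?\<mu>) < \<infinity>"
      using fin unfolding d[symmetric] by simp
    show "emeasure (density ?\<mu> (\<lambda>x. ennreal (enn2real (h x)))) B \<le> ennreal 1 * emeasure ?\<mu> B" if "B \<in> sets ?\<mu>" for B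
      using le[of B] that unfolding d[symmetric] by simp
  qed auto
  \<comment> \<open>The derivative is at most 1 only almost everywhere; truncation makes the bounds
    hold at every point.\<close>
  define p where "p = (\<lambda>x. min 1 (enn2real (h x)))"
  have p[measurable]: "p \<in> borel_measurable N" using h unfolding p_def by measurable
  have p01: "0 \<le> p x" "p x \<le> 1" for x by (auto simp: p_def)
  have dp: "?\<nu> D = density ?\<mu> (\<lambda>x. ennreal (p x))"
    unfolding d using \<open>AE x in ?\<mu>. enn2real (h x) \<le> 1\<close>
    by (intro density_cong) (auto elim!: eventually_mono simp: p_def)
  have "?\<nu> (space M - D) = density ?\<mu> (\<lambda>x. ennreal (1 - p x))"
  proof (rule measure_eqI)
    fix B assume "B \<in> sets (?\<nu> (space M - D))"
    then have [measurable]: "B \<in> sets N" by simp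
    have "emeasure (?\<nu> D) B + emeasure (?\<nu> (space M - D)) B = emeasure ?\<mu> B"
      by (subst (1 2) \<nu>, auto simp: emeasure_distr intro!: plus_emeasure[THEN trans] arg_cong2[where f = emeasure])
    also have "\<dots> = (\<integral>\<^sup>+x. ennreal (p x) * indicator B x + ennreal (1 - p x) * indicator B x \<partial>?\<mu>)"
      using p01 by (subst nn_integral_indicator[symmetric], simp, intro nn_integral_cong)
        (auto simp flip: ennreal_plus split: split_indicator)
    also have "\<dots> = emeasure (?\<nu> D) B + emeasure (density ?\<mu> (\<lambda>x. ennreal (1 - p x))) B"
      unfolding dp by (subst nn_integral_add) (auto simp: emeasure_density)
    finally show "emeasure (?\<nu> (space M - D)) B = emeasure (density ?\<mu> (\<lambda>x. ennreal (1 - p x))) B"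
      by (subst (asm) ennreal_add_left_cancel) (auto simp: \<nu> emeasure_eq_measure)
  qed simp
  with that[OF p p01 dp] show thesis by blast
qed

text \<open>The number \<open>c\<close> is the mean of \<open>p (1 - p)\<close>, where \<open>p\<close> is the conditional probability of \<open>D\<close>
  given \<open>e\<close>. It vanishes iff \<open>D\<close> is determined by \<open>e\<close>, and otherwise \<open>D\<close> and its complement
  carry nonzero densities with a common image of mass \<open>c\<close>.\<close>

lemma (in prob_space) split_along_map:
  assumes e[measurable]: "e \<in> measurable M N" and D[measurable]: "D \<in> sets M"
  obtains c f1 f2 C where "0 \<le> c" "f1 \<in> borel_measurable M" "f2 \<in> borel_measurable M"
    "\<And>x. 0 \<le> f1 x" "\<And>x. f1 x \<le> 1" "\<And>x. 0 \<le> f2 x" "\<And>x. f2 x \<le> (1::real)"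
    "\<And>x. x \<notin> D \<Longrightarrow> f1 x = 0" "\<And>x. x \<in> D \<Longrightarrow> f2 x = 0"
    "(\<integral>\<^sup>+x. ennreal (f1 x) \<partial>M) = ennreal c" "(\<integral>\<^sup>+x. ennreal (f2 x) \<partial>M) = ennreal c"
    "distr (density M (\<lambda>x. ennreal (f1 x))) N e = distr (density M (\<lambda>x. ennreal (f2 x))) N e"
    "C \<in> sets N" "measure M {x \<in> space M. (x \<in> D) \<noteq> (e x \<in> C)} \<le> 2 * c"
    "\<And>C. C \<in> sets N \<Longrightarrow> c \<le> measure M {x \<in> space M. (x \<in> D) \<noteq> (e x \<in> C)}"
proof -
  let ?\<mu> = "distr M N e"
  interpret \<mu>: prob_space ?\<mu> by (rule prob_space_distr) simp
  obtain p where p[measurable]: "p \<in> borel_measurable N" and p01: "\<And>x. 0 \<le> p x" "\<And>x. p x \<le> 1"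
    and d1: "distr (density M (indicator D)) N e = density ?\<mu> (\<lambda>x. ennreal (p x))"
    and d2: "distr (density M (indicator (space M - D))) N e = density ?\<mu> (\<lambda>x. ennreal (1 - p x))"
    using conditional_probability_given_map[OF e D] by blast
  \<comment> \<open>Weighting \<open>D\<close> by the conditional probability of its complement, and
    the complement by that of \<open>D\<close>, gives both images the same density
    \<open>p * (1 - p)\<close>.\<close>
  define f1 where "f1 = (\<lambda>x. indicator D x * (1 - p (e x)))"
  define f2 where "f2 = (\<lambda>x. indicator (space M - D) x * p (e x))"
  have f[measurable]: "f1 \<in> borel_measurable M" "f2 \<in> borel_measurable M"
    by (auto simp: f1_def f2_def)
  define \<nu> where "\<nu> = density ?\<mu> (\<lambda>x. ennreal (p x * (1 - p x)))"
  have "distr (density M (\<lambda>x. ennreal (f1 x))) N e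
      = distr (density (density M (indicator D)) (\<lambda>x. ennreal (1 - p (e x)))) N e"
    by (subst density_density_eq) (auto simp: f1_def p01 ennreal_mult ennreal_indicator)
  also have "\<dots> = density (distr (density M (indicator D)) N e) (\<lambda>x. ennreal (1 - p x))"
    by (rule distr_density_comp) auto
  also have "\<dots> = \<nu>"
    unfolding d1 \<nu>_def by (subst density_density_eq) (auto simp: p01 ennreal_mult)
  finally have \<nu>1: "distr (density M (\<lambda>x. ennreal (f1 x))) N e = \<nu>" .
  have "distr (density M (\<lambda>x. ennreal (f2 x))) N e
      = distr (density (density M (indicator (space M - D))) (\<lambda>x. ennreal (p (e x)))) N e"
    by (subst density_density_eq) (auto simp: f2_def p01 ennreal_mult ennreal_indicator)
  also have "\<dots> = density (distr (density M (indicator (space M - D))) N e) (\<lambda>x. ennreal (p x))"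
    by (rule distr_density_comp) auto
  also have "\<dots> = \<nu>"
    unfolding d2 \<nu>_def by (subst density_density_eq) (auto simp: p01 ennreal_mult mult.commute)
  finally have \<nu>2: "distr (density M (\<lambda>x. ennreal (f2 x))) N e = \<nu>" .
  define c where "c = (\<integral>x. p x * (1 - p x) \<partial>?\<mu>)"
  have c0: "0 \<le> c" unfolding c_def by (intro integral_nonneg_AE) (auto simp: p01)
  have ip: "integrable ?\<mu> (\<lambda>x. p x * (1 - p x))"
    by (rule \<mu>.integrable_const_bound[of _ 1]) (auto simp: p01 abs_mult mult_le_one)
  have c: "ennreal c = (\<integral>\<^sup>+x. ennreal (p x * (1 - p x)) \<partial>?\<mu>)"
    unfolding c_def by (rule nn_integral_eq_integral[symmetric, OF ip]) (auto simp: p01)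
  have mass: "(\<integral>\<^sup>+x. ennreal (f x) \<partial>M) = ennreal c"
    if [measurable]: "f \<in> borel_measurable M" and "distr (density M (\<lambda>x. ennreal (f x))) N e = \<nu>" for f
  proof -
    have "(\<integral>\<^sup>+x. ennreal (f x) \<partial>M) = emeasure (density M (\<lambda>x. ennreal (f x))) (space M)"
      by (simp add: emeasure_density cong: nn_integral_cong)
    also have "\<dots> = emeasure (distr (density M (\<lambda>x. ennreal (f x))) N e) (space N)"
      using measurable_space[OF e] by (subst emeasure_distr) (auto intro!: arg_cong2[where f = emeasure])
    also have "\<dots> = ennreal c"
      unfolding that(2) \<nu>_def c by (auto simp: emeasure_density intro!: nn_integral_cong)
    finally show ?thesis .
  qed
  have err: "measure M {x \<in> space M. (x \<in> D) \<noteq> (e x \<in> C)} = (\<integral>x. (if x \<in> C then 1 - p x else p x) \<partial>?\<mu>)"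
    and ierr: "integrable ?\<mu> (\<lambda>x. if x \<in> C then 1 - p x else p x)"
    if [measurable]: "C \<in> sets N" for C
  proof -
    show i: "integrable ?\<mu> (\<lambda>x. if x \<in> C then 1 - p x else p x)"
      by (rule \<mu>.integrable_const_bound[of _ 1]) (auto simp: p01)
    have "emeasure M {x \<in> space M. (x \<in> D) \<noteq> (e x \<in> C)}
        = emeasure M (D \<inter> (e -` (space N - C) \<inter> space M)) + emeasure M ((space M - D) \<inter> (e -` C \<inter> space M))"
      using measurable_space[OF e] sets.sets_into_space[OF D] by (subst plus_emeasure) (auto intro!: arg_cong2[where f = emeasure])
    also have "\<dots> = emeasure (distr (density M (indicator D)) N e) (space N - C)
        + emeasure (distr (density M (indicator (space M - D))) N e) C"
      by (simp add: emeasure_distr emeasure_density flip: indicator_inter_arith)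
    also have "\<dots> = (\<integral>\<^sup>+x. ennreal (p x) * indicator (space N - C) x + ennreal (1 - p x) * indicator C x \<partial>?\<mu>)"
      unfolding d1 d2 by (subst nn_integral_add) (auto simp: emeasure_density)
    also have "\<dots> = (\<integral>\<^sup>+x. ennreal (if x \<in> C then 1 - p x else p x) \<partial>?\<mu>)"
      by (intro nn_integral_cong) (auto split: split_indicator)
    also have "\<dots> = ennreal (\<integral>x. (if x \<in> C then 1 - p x else p x) \<partial>?\<mu>)"
      by (rule nn_integral_eq_integral[OF i]) (auto simp: p01)
    finally show "measure M {x \<in> space M. (x \<in> D) \<noteq> (e x \<in> C)} = (\<integral>x. (if x \<in> C then 1 - p x else p x) \<partial>?\<mu>)"
      by (subst (asm) emeasure_eq_measure) (auto simp: p01 integral_nonneg_AE)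
  qed
  \<comment> \<open>The majority decision: its error is the mean of \<open>min p (1 - p)\<close>,
    which is at most \<open>2 * (p * (1 - p))\<close> because the larger factor is at least
    \<open>1 / 2\<close>.\<close>
  define C where "C = {x \<in> space N. p x > 1 / 2}"
  have C: "C \<in> sets N" unfolding C_def by measurable
  show thesis
  proof (rule that[of c f1 f2 C, OF c0 f _ _ _ _ _ _ mass[OF f(1) \<nu>1] mass[OF f(2) \<nu>2] _ C])
    have "(\<integral>x. (if x \<in> C then 1 - p x else p x) \<partial>?\<mu>) \<le> (\<integral>x. 2 * (p x * (1 - p x)) \<partial>?\<mu>)"
    proof (rule integral_mono[OF ierr[OF C]])
      fix x assume "x \<in> space ?\<mu>"
      show "(if x \<in> C then 1 - p x else p x) \<le> 2 * (p x * (1 - p x))"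
      proof (cases "p x > 1 / 2")
        case True
        then show ?thesis using mult_right_mono[of 1 "2 * p x" "1 - p x"] p01(2)[of x] \<open>x \<in> space ?\<mu>\<close>
          by (auto simp: C_def)
      next
        case False
        then show ?thesis using mult_left_mono[of 1 "2 * (1 - p x)" "p x"] p01(1)[of x]
          by (auto simp: C_def algebra_simps)
      qed
    qed (use ip in auto)
    then show "measure M {x \<in> space M. (x \<in> D) \<noteq> (e x \<in> C)} \<le> 2 * c"
      using err[OF C] by (simp add: c_def)
  next
    \<comment> \<open>No decision rule errs less than \<open>min p (1 - p)\<close> at a point, and
      this is at least \<open>p * (1 - p)\<close>.\<close>
    fix C' assume C': "C' \<in> sets N"
    have "c \<le> (\<integral>x. (if x \<in> C' then 1 - p x else p x) \<partial>?\<mu>)"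
      unfolding c_def
    proof (rule integral_mono[OF ip ierr[OF C']])
      fix x
      show "p x * (1 - p x) \<le> (if x \<in> C' then 1 - p x else p x)"
        using p01[of x] by (auto simp: mult_left_le mult_left_le_one_le)
    qed
    then show "c \<le> measure M {x \<in> space M. (x \<in> D) \<noteq> (e x \<in> C')}"
      using err[OF C'] by simp
  qed (use p01 in \<open>auto simp: f1_def f2_def \<nu>1[unfolded f1_def] \<nu>2[unfolded f2_def] split: split_indicator\<close>)
qed

text \<open>The number \<open>c\<close> of the splitting is a lower bound for every error, so
  arbitrarily small errors force \<open>c = 0\<close>; the majority set, whose error is at most
  \<open>2 * c\<close>, is then exact. No limit of the approximating sets is taken.\<close>

lemma (in prob_space) agreement_if_approximable:
  assumes e[measurable]: "e \<in> measurable M N" and D[measurable]: "D \<in> sets M"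
    and approx: "\<And>\<epsilon>. 0 < \<epsilon> \<Longrightarrow> \<exists>C\<in>sets N. measure M {x \<in> space M. (x \<in> D) \<noteq> (e x \<in> C)} \<le> \<epsilon>"
  shows "\<exists>C\<in>sets N. AE x in M. x \<in> D \<longleftrightarrow> e x \<in> C"
proof -
  obtain c C' where C'[measurable]: "C' \<in> sets N" and le2: "measure M {x \<in> space M. (x \<in> D) \<noteq> (e x \<in> C')} \<le> 2 * c"
    and le: "\<And>C. C \<in> sets N \<Longrightarrow> c \<le> measure M {x \<in> space M. (x \<in> D) \<noteq> (e x \<in> C)}"
    by (rule split_along_map[OF e D], rule that, assumption+)
  have "c \<le> 0"
  proof (rule field_le_epsilon)
    fix \<epsilon> :: real assume "\<epsilon> > 0"
    then show "c \<le> 0 + \<epsilon>" using approx le by fastforce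
  qed
  then have "measure M {x \<in> space M. (x \<in> D) \<noteq> (e x \<in> C')} = 0"
    using le2 measure_nonneg[of M "{x \<in> space M. (x \<in> D) \<noteq> (e x \<in> C')}"] by linarith
  then have "AE x in M. (x \<in> D) = (e x \<in> C')"
    by (subst AE_iff_measurable[OF _ refl]) (auto simp: emeasure_eq_measure)
  then show ?thesis using C' by blast
qed

section \<open>Entropy along restricted plans\<close>

text \<open>The quantitative data are: a set \<open>U\<close> of finite measure containing all
  curves, which bounds entropies from below; a bound \<open>L\<close> on the end-point densities,
  which bounds the entropies there from above; and a bound \<open>d\<close> on the lengths, which
  controls the Wasserstein term.\<close>

locale bounded_CD_plan =
  fixes \<mm> :: "'a::polish_space measure" and K :: real and \<pi> :: "'a geo measure"
    and U :: "'a set" and L d :: real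
  assumes locally_finite: "locally_finite_borel_measure \<mm>"
    and prob_space_plan: "prob_space \<pi>" and sets_plan [measurable_cong]: "sets \<pi> = sets borel"
    and open_U: "open U" and U_finite: "emeasure \<mm> U < \<infinity>"
    and L_ge_1: "1 \<le> L"
    and AE_eval_U: "AE \<gamma> in \<pi>. \<forall>t\<in>{0..1}. eval t \<gamma> \<in> U"
    and AE_dist_le: "AE \<gamma> in \<pi>. dist (eval 0 \<gamma>) (eval 1 \<gamma>) \<le> d"
    and initial_le: "\<And>B. B \<in> sets borel \<Longrightarrow> emeasure \<pi> {\<gamma>. eval 0 \<gamma> \<in> B} \<le> ennreal L * emeasure \<mm> B"
    and final_le: "\<And>B. B \<in> sets borel \<Longrightarrow> emeasure \<pi> {\<gamma>. eval 1 \<gamma> \<in> B} \<le> ennreal L * emeasure \<mm> B"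
    and convex: "\<And>t0 t1 f. 0 \<le> t0 \<Longrightarrow> t0 < t1 \<Longrightarrow> t1 \<le> 1 \<Longrightarrow> f \<in> borel_measurable borel \<Longrightarrow>
       (\<And>\<gamma>. 0 \<le> f \<gamma>) \<Longrightarrow> (\<integral>\<^sup>+\<gamma>. ennreal (f \<gamma>) \<partial>\<pi>) = 1 \<Longrightarrow>
       Ent_convex_along \<mm> K (distr (density \<pi> (\<lambda>\<gamma>. ennreal (f \<gamma>))) borel (restr t0 t1))"
begin

sublocale \<mm>: sigma_finite_measure \<mm>
  by (rule locally_finite_borel_measure_sigma_finite[OF locally_finite])

sublocale \<pi>: prob_space \<pi>
  by (rule prob_space_plan)

lemma sets_mm [simp, measurable_cong]: "sets \<mm> = sets borel"
  using locally_finite by (simp add: locally_finite_borel_measure_def)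

lemma space_mm [simp]: "space \<mm> = UNIV"
  using sets_eq_imp_space_eq[OF sets_mm] by simp

lemma space_plan [simp]: "space \<pi> = UNIV"
  using sets_eq_imp_space_eq[OF sets_plan] by simp

lemma d_nonneg: "0 \<le> d"
proof (rule ccontr)
  assume "\<not> 0 \<le> d"
  then have "AE \<gamma> in \<pi>. False"
    by (intro eventually_mono[OF AE_dist_le]) (smt (verit) zero_le_dist)
  then show False using \<pi>.AE_False by simp
qed

section \<open>Marginals and entropies of reweighted plans\<close>

definition law :: "('a geo \<Rightarrow> real) \<Rightarrow> real \<Rightarrow> 'a measure" where
  "law f t = distr (density \<pi> (\<lambda>\<gamma>. ennreal (f \<gamma>))) borel (eval t)"

text \<open>These are the normalised subplans of mass \<open>c\<close>: dividing a weight between 0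
  and 1 of integral \<open>c\<close> by \<open>c\<close> gives a density bounded by
  \<open>1 / c\<close>.\<close>

definition admissible :: "real \<Rightarrow> ('a geo \<Rightarrow> real) \<Rightarrow> bool" where
  "admissible c f \<longleftrightarrow> 0 < c \<and> f \<in> borel_measurable borel \<and> (\<forall>\<gamma>. 0 \<le> f \<gamma> \<and> f \<gamma> \<le> 1 / c) \<and>
     (\<integral>\<^sup>+\<gamma>. ennreal (f \<gamma>) \<partial>\<pi>) = 1"

text \<open>The worst case of the curvature term, for either sign of \<open>K\<close>.\<close>

definition k :: real where
  "k = \<bar>K\<bar> / 2 * d\<^sup>2"

lemma k_nonneg: "0 \<le> k"
  by (simp add: k_def)

lemma sets_law [simp, measurable_cong]: "sets (law f t) = sets borel"
  by (simp add: law_def)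

lemma admissible_measurable:
  "admissible c f \<Longrightarrow> f \<in> borel_measurable borel" "admissible c f \<Longrightarrow> f \<in> borel_measurable \<pi>"
  by (auto simp: admissible_def measurable_cong_sets[OF sets_plan refl])

lemma eval_measurable_plan: "t \<in> {0..1} \<Longrightarrow> eval t \<in> measurable \<pi> borel"
  using eval_measurable measurable_cong_sets[OF sets_plan refl] by auto

lemma prob_space_density:
  assumes "admissible c f"
  shows "prob_space (density \<pi> (\<lambda>\<gamma>. ennreal (f \<gamma>)))"
proof
  show "emeasure (density \<pi> (\<lambda>\<gamma>. ennreal (f \<gamma>))) (space (density \<pi> (\<lambda>\<gamma>. ennreal (f \<gamma>)))) = 1"
    using assms admissible_measurable[OF assms] by (simp add: emeasure_density admissible_def)
qed

lemma prob_space_law: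
  assumes "admissible c f" "t \<in> {0..1}"
  shows "prob_space (law f t)"
  unfolding law_def using eval_measurable_plan[OF assms(2)]
  by (intro prob_space.prob_space_distr[OF prob_space_density[OF assms(1)]]) simp

lemma AE_density_plan:
  assumes "f \<in> borel_measurable \<pi>" "AE \<gamma> in \<pi>. P \<gamma>"
  shows "AE \<gamma> in density \<pi> (\<lambda>\<gamma>. ennreal (f \<gamma>)). P \<gamma>"
  using assms by (subst AE_density) auto

lemma AE_law:
  assumes "f \<in> borel_measurable \<pi>" "t \<in> {0..1}" "S \<in> sets borel"
    and "AE \<gamma> in \<pi>. 0 < f \<gamma> \<longrightarrow> eval t \<gamma> \<in> S"
  shows "AE x in law f t. x \<in> S"
  unfolding law_def using assms eval_measurable_plan[OF assms(2)]
  by (subst AE_distr_iff) (auto simp: AE_density)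

lemma AE_law_U:
  assumes "f \<in> borel_measurable \<pi>" "t \<in> {0..1}"
  shows "AE x in law f t. x \<in> U"
proof (rule AE_law[OF assms])
  show "AE \<gamma> in \<pi>. 0 < f \<gamma> \<longrightarrow> eval t \<gamma> \<in> U"
    using AE_eval_U by eventually_elim (use assms in auto)
qed (use open_U in auto)

lemma emeasure_law:
  assumes "f \<in> borel_measurable \<pi>" "t \<in> {0..1}" "B \<in> sets borel"
  shows "emeasure (law f t) B = (\<integral>\<^sup>+\<gamma>. ennreal (f \<gamma>) * indicator B (eval t \<gamma>) \<partial>\<pi>)"
proof -
  note [measurable] = eval_measurable_plan[OF assms(2)] assms(1,3)
  have [measurable]: "eval t -` B \<in> sets \<pi>"
    using measurable_sets[OF eval_measurable_plan[OF assms(2)] assms(3)] by simp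
  have "emeasure (law f t) B = (\<integral>\<^sup>+\<gamma>. ennreal (f \<gamma>) * indicator (eval t -` B \<inter> space \<pi>) \<gamma> \<partial>\<pi>)"
    unfolding law_def by (subst emeasure_distr) (auto simp: emeasure_density)
  also have "\<dots> = (\<integral>\<^sup>+\<gamma>. ennreal (f \<gamma>) * indicator B (eval t \<gamma>) \<partial>\<pi>)"
    by (intro nn_integral_cong) (auto split: split_indicator)
  finally show ?thesis .
qed

lemma Ent_law_endpoint_le:
  assumes f: "admissible c f" and t: "t \<in> {0, 1}"
  shows "Ent \<mm> (law f t) \<le> ereal (ln (L / c))"
proof -
  have t01: "t \<in> {0..1}" using t by auto
  note [measurable] = eval_measurable_plan[OF t01] admissible_measurable(2)[OF f]
  have c: "c > 0" and fc: "\<And>\<gamma>. f \<gamma> \<le> 1 / c" using f by (auto simp: admissible_def)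
  show ?thesis
  proof (rule \<mm>.Ent_le[OF prob_space_law[OF f t01]])
    fix B assume "B \<in> sets \<mm>"
    then have [measurable]: "B \<in> sets borel" by simp
    have "emeasure (law f t) B \<le> (\<integral>\<^sup>+\<gamma>. ennreal (1 / c) * indicator {\<gamma>. eval t \<gamma> \<in> B} \<gamma> \<partial>\<pi>)"
      unfolding emeasure_law[OF admissible_measurable(2)[OF f] t01 \<open>B \<in> sets borel\<close>]
      by (intro nn_integral_mono mult_mono) (use fc in \<open>auto simp: ennreal_leI split: split_indicator\<close>)
    also have "\<dots> = ennreal (1 / c) * emeasure \<pi> {\<gamma>. eval t \<gamma> \<in> B}"
      using measurable_sets[OF eval_measurable_plan[OF t01] \<open>B \<in> sets borel\<close>]
      by (intro nn_integral_cmult_indicator) (simp add: vimage_def)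
    also have "\<dots> \<le> ennreal (1 / c) * (ennreal L * emeasure \<mm> B)"
      by (intro mult_left_mono) (use t initial_le final_le \<open>B \<in> sets borel\<close> in auto)
    also have "\<dots> = ennreal (L / c) * emeasure \<mm> B"
      using c L_ge_1 by (simp add: mult.assoc[symmetric] ennreal_mult[symmetric])
    finally show "emeasure (law f t) B \<le> ennreal (L / c) * emeasure \<mm> B" .
  qed (use open_U U_finite AE_law_U[OF admissible_measurable(2)[OF f] t01] c L_ge_1 in auto)
qed

lemma Ent_law_ge:
  assumes f: "admissible c f" and t: "t \<in> {0..1}"
  shows "ereal (1 - measure \<mm> U) \<le> Ent \<mm> (law f t)"
  using \<mm>.Ent_ge[OF prob_space_law[OF f t] _ _ U_finite AE_law_U[OF admissible_measurable(2)[OF f] t], of 1]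
    open_U by simp

text \<open>The joint law of the positions at times \<open>s\<close> and \<open>t\<close> is a
  coupling of cost at most \<open>d\<^sup>2\<close>. A real value \<open>w\<close> is extracted so
  that the curvature term in the convexity inequality is finite.\<close>

lemma W2_law_le:
  assumes f: "admissible c f" and s: "s \<in> {0..1}" and t: "t \<in> {0..1}"
  obtains w where "0 \<le> w" "w\<^sup>2 \<le> d\<^sup>2" "W2 (law f s) (law f t) = ennreal w"
proof -
  note [measurable] = eval_measurable_plan[OF s] eval_measurable_plan[OF t] admissible_measurable(2)[OF f]
  let ?M = "density \<pi> (\<lambda>\<gamma>. ennreal (f \<gamma>))"
  interpret M: prob_space ?M by (rule prob_space_density[OF f])
  define \<sigma> where "\<sigma> = distr ?M borel (\<lambda>\<gamma>. (eval s \<gamma>, eval t \<gamma>))"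
  have meas: "(\<lambda>\<gamma>. (eval s \<gamma>, eval t \<gamma>)) \<in> measurable ?M borel"
    by (rule borel_measurable_Pair) auto
  have [measurable]: "fst \<in> borel_measurable (borel :: ('a \<times> 'a) measure)" "snd \<in> borel_measurable (borel :: ('a \<times> 'a) measure)"
    by (auto intro!: borel_measurable_continuous_onI continuous_intros)
  have "\<sigma> \<in> couplings (law f s) (law f t)"
    unfolding couplings_def borel_prob_def \<sigma>_def law_def using M.prob_space_distr[OF meas] meas
    by (auto simp: distr_distr comp_def)
  then have le: "(INF \<tau> \<in> couplings (law f s) (law f t). transport_cost \<tau>) \<le> transport_cost \<sigma>"
    by (rule INF_lower)
  have "transport_cost \<sigma> = (\<integral>\<^sup>+\<gamma>. ennreal ((dist (eval s \<gamma>) (eval t \<gamma>))\<^sup>2) \<partial>?M)"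
    unfolding transport_cost_def \<sigma>_def
    by (subst nn_integral_distr[OF meas]) (auto simp: case_prod_unfold intro!: borel_measurable_continuous_onI continuous_intros measurable_compose[OF _ measurable_ennreal])
  also have "\<dots> \<le> (\<integral>\<^sup>+\<gamma>. ennreal (d\<^sup>2) \<partial>?M)"
  proof (rule nn_integral_mono_AE, rule AE_density_plan)
    show "AE \<gamma> in \<pi>. ennreal ((dist (eval s \<gamma>) (eval t \<gamma>))\<^sup>2) \<le> ennreal (d\<^sup>2)"
      using AE_dist_le
    proof eventually_elim
      case (elim \<gamma>)
      then show ?case using dist_eval_eval_le[OF s t, of \<gamma>]
        by (intro ennreal_leI power_mono) auto
    qed
  qed simp
  also have "\<dots> = ennreal (d\<^sup>2)" using M.emeasure_space_1 by simp
  finally have le: "(INF \<tau> \<in> couplings (law f s) (law f t). transport_cost \<tau>) \<le> ennreal (d\<^sup>2)"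
    using le by (rule order_trans[rotated])
  define x where "x = (INF \<tau> \<in> couplings (law f s) (law f t). transport_cost \<tau>)"
  have x: "x \<le> ennreal (d\<^sup>2)" unfolding x_def by (rule le)
  then have "x \<noteq> \<infinity>" by (auto simp: top_unique)
  have "enn2real x \<le> d\<^sup>2" using x by (simp add: enn2real_leI)
  then show thesis
    using \<open>x \<noteq> \<infinity>\<close> by (intro that[of "sqrt (enn2real x)"]) (auto simp: W2_def ennreal_sqrt_def x_def[symmetric])
qed

text \<open>Restriction to \<open>[s, t]\<close> turns convexity over the unit interval into
  convexity over any subinterval. The curvature term is replaced by its worst case
  \<open>k * (u * (1 - u))\<close>.\<close>

lemma Ent_law_convex:
  assumes f: "admissible c f" and st: "0 \<le> s" "s < t" "t \<le> 1" and u: "u \<in> {0..1}"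
  shows "Ent \<mm> (law f (s + u * (t - s))) \<le>
     ereal (1 - u) * Ent \<mm> (law f s) + ereal u * Ent \<mm> (law f t) + ereal (k * (u * (1 - u)))"
proof -
  let ?M = "density \<pi> (\<lambda>\<gamma>. ennreal (f \<gamma>))"
  have r: "restr s t \<in> measurable ?M borel"
    using restr_measurable[OF st] by (simp add: measurable_cong_sets[OF sets_plan refl])
  have law: "distr (distr ?M borel (restr s t)) borel (eval v) = law f (s + v * (t - s))" if v: "v \<in> {0..1}" for v
  proof -
    have "distr (distr ?M borel (restr s t)) borel (eval v) = distr ?M borel (eval v \<circ> restr s t)"
      using v r by (intro distr_distr) auto
    also have "eval v \<circ> restr s t = eval (s + v * (t - s))"
      using eval_restr[OF st v] by (intro ext) (simp add: add.commute)
    finally show ?thesis by (simp add: law_def)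
  qed
  have "Ent_convex_along \<mm> K (distr ?M borel (restr s t))"
    using f st by (intro convex) (auto simp: admissible_def)
  then have "Ent \<mm> (distr (distr ?M borel (restr s t)) borel (eval u))
      \<le> ereal (1 - u) * Ent \<mm> (distr (distr ?M borel (restr s t)) borel (eval 0))
        + ereal u * Ent \<mm> (distr (distr ?M borel (restr s t)) borel (eval 1))
        - ereal (K / 2 * u * (1 - u)) * (enn2ereal (W2 (distr (distr ?M borel (restr s t)) borel (eval 0))
            (distr (distr ?M borel (restr s t)) borel (eval 1))))\<^sup>2"
    unfolding Ent_convex_along_def Let_def using u by (rule bspec)
  then have le: "Ent \<mm> (law f (s + u * (t - s))) \<le> ereal (1 - u) * Ent \<mm> (law f s) + ereal u * Ent \<mm> (law f t)
      - ereal (K / 2 * u * (1 - u)) * (enn2ereal (W2 (law f s) (law f t)))\<^sup>2"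
    using law[OF u] law[of 0] law[of 1] by simp
  obtain w where w: "0 \<le> w" "w\<^sup>2 \<le> d\<^sup>2" "W2 (law f s) (law f t) = ennreal w"
    using W2_law_le[OF f, of s t] st by auto
  have "- (K / 2 * u * (1 - u) * w\<^sup>2) \<le> \<bar>K\<bar> / 2 * (u * (1 - u)) * w\<^sup>2"
  proof -
    have "- K * (u * (1 - u) * w\<^sup>2) \<le> \<bar>K\<bar> * (u * (1 - u) * w\<^sup>2)"
      using u by (intro mult_right_mono) auto
    then show ?thesis by (simp add: mult.assoc)
  qed
  also have "\<dots> \<le> \<bar>K\<bar> / 2 * (u * (1 - u)) * d\<^sup>2"
    using w u by (intro mult_left_mono) auto
  finally have "- (K / 2 * u * (1 - u) * w\<^sup>2) \<le> k * (u * (1 - u))"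
    by (simp add: k_def mult_ac)
  then have "- (ereal (K / 2 * u * (1 - u)) * (enn2ereal (W2 (law f s) (law f t)))\<^sup>2) \<le> ereal (k * (u * (1 - u)))"
    using w by (simp add: enn2ereal_ennreal)
  then show ?thesis
    using le unfolding minus_ereal_def by (meson add_left_mono order_trans)
qed

text \<open>The end-point entropies are finite by the density bounds, and convexity over
  \<open>[0, 1]\<close> then excludes the value \<open>\<infinity>\<close> in between. From here on
  the entropy is a real function of time.\<close>

lemma Ent_law_real:
  assumes f: "admissible c f"
  obtains e where "\<And>t. t \<in> {0..1} \<Longrightarrow> Ent \<mm> (law f t) = ereal (e t)"
    "\<And>t. t \<in> {0..1} \<Longrightarrow> 1 - measure \<mm> U \<le> e t" "e 0 \<le> ln (L / c)" "e 1 \<le> ln (L / c)"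
    "\<And>s t u. 0 \<le> s \<Longrightarrow> s < t \<Longrightarrow> t \<le> 1 \<Longrightarrow> u \<in> {0..1} \<Longrightarrow>
       e (s + u * (t - s)) \<le> (1 - u) * e s + u * e t + k * (u * (1 - u))"
proof -
  define e where "e t = real_of_ereal (Ent \<mm> (law f t))" for t
  have e0: "Ent \<mm> (law f 0) = ereal (e 0)" and e1: "Ent \<mm> (law f 1) = ereal (e 1)"
    using Ent_law_ge[OF f, of 0] Ent_law_endpoint_le[OF f, of 0]
      Ent_law_ge[OF f, of 1] Ent_law_endpoint_le[OF f, of 1]
    unfolding e_def by (cases "Ent \<mm> (law f 0)"; cases "Ent \<mm> (law f 1)"; simp)+
  have e: "Ent \<mm> (law f t) = ereal (e t)" if t: "t \<in> {0..1}" for t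
    using Ent_law_convex[OF f, of 0 1 t] Ent_law_ge[OF f t] t unfolding e0 e1
    unfolding e_def by (cases "Ent \<mm> (law f t)") auto
  show thesis
  proof (rule that[OF e])
    show "1 - measure \<mm> U \<le> e t" if "t \<in> {0..1}" for t
      using Ent_law_ge[OF f that] e[OF that] by simp
    show "e 0 \<le> ln (L / c)" "e 1 \<le> ln (L / c)"
      using Ent_law_endpoint_le[OF f, of 0] Ent_law_endpoint_le[OF f, of 1] e0 e1 by auto
    show "e (s + u * (t - s)) \<le> (1 - u) * e s + u * e t + k * (u * (1 - u))"
      if "0 \<le> s" "s < t" "t \<le> 1" "u \<in> {0..1}" for s t u
    proof -
      have "s + u * (t - s) \<in> {0..1}"
        using affine_unit_interval[OF that] by (simp add: add.commute)
      then show ?thesis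
        using Ent_law_convex[OF f that] that e[of s] e[of t] e[of "s + u * (t - s)"] by simp
    qed
  qed
qed

end

section \<open>Positive times\<close>

text \<open>Here \<open>x\<close> is the common entropy at time \<open>s\<close>, \<open>y1\<close>
  and \<open>y2\<close> are the two entropies at \<open>s + h\<close>, \<open>a0\<close>,
  \<open>b1\<close>, \<open>b2\<close> are end-point entropies, and \<open>e\<close> is the gain
  \<open>ln 2\<close>. The weights \<open>1 - l\<close> and \<open>m\<close> are of order
  \<open>h\<close>.\<close>

lemma separation_arith:
  fixes x y H k l m M e :: real
  assumes "0 \<le> H" "0 \<le> k" "1 / 2 \<le> l" "l \<le> 1" "0 \<le> m" "m \<le> 1"
    and x: "- M \<le> x" "0 \<le> M"
    and xl: "x \<le> (1 - l) * a0 + l * ((y1 + y2) / 2 - e) + k * (l * (1 - l))" "a0 \<le> H"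
    and y1: "y1 \<le> (1 - m) * x + m * b1 + k * (m * (1 - m))" "b1 \<le> H"
    and y2: "y2 \<le> (1 - m) * x + m * b2 + k * (m * (1 - m))" "b2 \<le> H"
    and w: "(1 - l) + m \<le> w" and e: "0 \<le> e"
  shows "e / 2 \<le> w * (k + M + H)"
proof -
  have "k * (m * (1 - m)) \<le> k * m" "k * (l * (1 - l)) \<le> k * (1 - l)"
    using assms by (auto intro!: mult_left_mono simp: mult_left_le mult_left_le_one_le)
  moreover have "m * b1 \<le> m * H" "m * b2 \<le> m * H" "(1 - l) * a0 \<le> (1 - l) * H"
    using assms by (auto intro!: mult_left_mono)
  ultimately have y1': "y1 \<le> (1 - m) * x + m * H + k * m" and y2': "y2 \<le> (1 - m) * x + m * H + k * m"
    and x1: "x \<le> (1 - l) * H + l * ((y1 + y2) / 2 - e) + k * (1 - l)"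
    using y1(1) y2(1) xl(1) by - linarith+
  have "(p + q) / 2 - e \<le> r - e" if "p \<le> r" "q \<le> r" for p q r
    using that by simp
  then have y: "(y1 + y2) / 2 - e \<le> (1 - m) * x + m * H + k * m - e"
    using y1' y2' by blast
  have "l * ((y1 + y2) / 2 - e) \<le> l * ((1 - m) * x + m * H + k * m - e)"
    using y assms by (intro mult_left_mono) auto
  \<comment> \<open>Inserting the bounds for \<open>y1\<close> and \<open>y2\<close> into the one
    for \<open>x\<close> cancels \<open>x\<close> up to the small coefficient
    \<open>(1 - l) + l * m\<close>, so a crude lower bound on \<open>x\<close> suffices.\<close>
  then have "l * e \<le> ((1 - l) + l * m) * (H - x) + k * (1 - l) + l * (k * m)"
    using x1 by (simp add: algebra_simps)
  also have "\<dots> \<le> ((1 - l) + m) * (H + M) + k * (1 - l) + k * m"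
  proof -
    have lm: "l * m \<le> m" "l * (k * m) \<le> k * m" "0 \<le> l * m" using assms by (auto simp: mult_left_le_one_le)
    have "((1 - l) + l * m) * (H - x) \<le> ((1 - l) + l * m) * (H + M)"
      using assms lm by (intro mult_left_mono) auto
    also have "\<dots> \<le> ((1 - l) + m) * (H + M)"
      using assms lm by (intro mult_right_mono) auto
    finally show ?thesis using lm by linarith
  qed
  also have "\<dots> = ((1 - l) + m) * (k + M + H)" by (simp add: algebra_simps)
  also have "\<dots> \<le> w * (k + M + H)"
    using assms by (intro mult_right_mono) auto
  finally have "l * e \<le> w * (k + M + H)" .
  moreover have "1 / 2 * e \<le> l * e" using assms by (intro mult_right_mono) auto
  ultimately show ?thesis by simp
qed

context bounded_CD_plan
begin

text \<open>With \<open>r = 1 / c\<close> this carries the equality of laws from the two parts of a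
  splitting to their normalisations.\<close>

lemma law_cong_scaled:
  assumes f: "f \<in> borel_measurable \<pi>" and g: "g \<in> borel_measurable \<pi>" and t: "t \<in> {0..1}"
    and eq: "distr (density \<pi> (\<lambda>\<gamma>. ennreal (f \<gamma>))) borel (eval t) = distr (density \<pi> (\<lambda>\<gamma>. ennreal (g \<gamma>))) borel (eval t)"
    and nn: "\<And>\<gamma>. 0 \<le> f \<gamma>" "\<And>\<gamma>. 0 \<le> g \<gamma>" and r: "0 \<le> r"
  shows "law (\<lambda>\<gamma>. r * f \<gamma>) t = law (\<lambda>\<gamma>. r * g \<gamma>) t"
proof (rule measure_eqI)
  fix B assume "B \<in> sets (law (\<lambda>\<gamma>. r * f \<gamma>) t)"
  then have B[measurable]: "B \<in> sets borel" by simp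
  note [measurable] = f g eval_measurable_plan[OF t]
  have scale: "emeasure (law (\<lambda>\<gamma>. r * h \<gamma>) t) B = ennreal r * emeasure (law h t) B"
    if [measurable]: "h \<in> borel_measurable \<pi>" and "\<And>\<gamma>. 0 \<le> h \<gamma>" for h
  proof -
    have m: "(\<lambda>\<gamma>. r * h \<gamma>) \<in> borel_measurable \<pi>" by measurable
    show ?thesis
      unfolding emeasure_law[OF that(1) t B] emeasure_law[OF m t B]
      using r that(2) by (simp add: nn_integral_cmult ennreal_mult mult.assoc)
  qed
  have "law f t = law g t" using eq by (simp add: law_def)
  then show "emeasure (law (\<lambda>\<gamma>. r * f \<gamma>) t) B = emeasure (law (\<lambda>\<gamma>. r * g \<gamma>) t) B"
    using scale[OF f nn(1)] scale[OF g nn(2)] by simp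
qed simp

text \<open>Convexity of the entropy of \<open>f1\<close> and \<open>f2\<close> on \<open>[s, 1]\<close> lets their entropies grow by \<open>O(h)\<close>
  up to time \<open>s + h\<close>; there the entropy of the mean plan is smaller by \<open>ln 2\<close>, and its convexity
  on \<open>[0, s + h]\<close> bounds the common entropy at time \<open>s\<close>. Hence \<open>h\<close> cannot be small unless
  \<open>ln (1 / c)\<close>, which controls the entropies at the end points, is of order \<open>1 / h\<close>.\<close>

lemma separation_bound:
  assumes f1: "admissible c f1" and f2: "admissible c f2" and c: "c \<le> 1"
    and s: "0 < a" "a \<le> s" and h: "0 < h" "h \<le> a" and b: "s + h \<le> b" "b < 1"
    and same: "law f1 s = law f2 s"
    and A: "A \<in> sets borel" "AE x in law f1 (s + h). x \<in> A" "AE x in law f2 (s + h). x \<notin> A"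
  shows "ln 2 / 2 \<le> h * (1 / a + 1 / (1 - b)) * (k + measure \<mm> U + ln L - ln c)"
proof -
  have s01: "s \<in> {0..1}" and sh: "s + h \<in> {0..1}" using s h b by auto
  have c0: "c > 0" using f1 by (simp add: admissible_def)
  note [measurable] = admissible_measurable(2)[OF f1] admissible_measurable(2)[OF f2]
    admissible_measurable(1)[OF f1] admissible_measurable(1)[OF f2]
  \<comment> \<open>The mean plan is again a reweighting of \<open>\<pi>\<close> with density at
    most \<open>1 / c\<close>, so convexity and the same end-point bounds apply to it.\<close>
  define f where "f = (\<lambda>\<gamma>. (f1 \<gamma> + f2 \<gamma>) / 2)"
  have [measurable]: "f \<in> borel_measurable \<pi>" "f \<in> borel_measurable borel" by (auto simp: f_def)
  have f2x: "2 * ennreal (f \<gamma>) = ennreal (f1 \<gamma>) + ennreal (f2 \<gamma>)" for \<gamma>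
  proof -
    have "0 \<le> f1 \<gamma>" "0 \<le> f2 \<gamma>" using f1 f2 by (auto simp: admissible_def)
    then have "2 * ennreal (f \<gamma>) = ennreal (2 * f \<gamma>)" by (subst ennreal_mult) (auto simp: f_def)
    also have "\<dots> = ennreal (f1 \<gamma>) + ennreal (f2 \<gamma>)"
      using \<open>0 \<le> f1 \<gamma>\<close> \<open>0 \<le> f2 \<gamma>\<close> by (simp add: f_def flip: ennreal_plus)
    finally show ?thesis .
  qed
  have mix: "2 * emeasure (law f t) B = emeasure (law f1 t) B + emeasure (law f2 t) B"
    if t: "t \<in> {0..1}" and [measurable]: "B \<in> sets borel" for t B
  proof -
    note [measurable] = eval_measurable_plan[OF t]
    show ?thesis using t
      by (simp add: emeasure_law flip: nn_integral_cmult nn_integral_add)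
        (simp add: mult.assoc[symmetric] f2x distrib_right)
  qed
  have f: "admissible c f"
  proof -
    have "2 * (\<integral>\<^sup>+\<gamma>. ennreal (f \<gamma>) \<partial>\<pi>) = (\<integral>\<^sup>+\<gamma>. ennreal (f1 \<gamma>) \<partial>\<pi>) + (\<integral>\<^sup>+\<gamma>. ennreal (f2 \<gamma>) \<partial>\<pi>)"
      by (simp add: f2x flip: nn_integral_cmult nn_integral_add)
    also have "\<dots> = 2 * 1" using f1 f2 by (simp add: admissible_def)
    finally have "(\<integral>\<^sup>+\<gamma>. ennreal (f \<gamma>) \<partial>\<pi>) = 1" by (simp only: ennreal_mult_cancel_left) auto
    moreover have "0 \<le> f \<gamma>" "f \<gamma> \<le> 1 / c" for \<gamma>
    proof -
      have "0 \<le> f1 \<gamma>" "0 \<le> f2 \<gamma>" "f1 \<gamma> \<le> 1 / c" "f2 \<gamma> \<le> 1 / c" using f1 f2 by (auto simp: admissible_def)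
      then show "0 \<le> f \<gamma>" "f \<gamma> \<le> 1 / c" by (auto simp: f_def)
    qed
    ultimately show ?thesis using c0 by (simp add: admissible_def)
  qed
  have same_f: "law f s = law f1 s"
  proof (rule measure_eqI)
    fix B assume "B \<in> sets (law f s)"
    then have "2 * emeasure (law f s) B = 2 * emeasure (law f1 s) B"
      using mix[OF s01, of B] by (simp add: same[symmetric] mult_2)
    then show "emeasure (law f s) B = emeasure (law f1 s) B"
      by (auto simp: ennreal_mult_cancel_left)
  qed simp
  obtain e where e: "\<And>t. t \<in> {0..1} \<Longrightarrow> Ent \<mm> (law f t) = ereal (e t)"
    "\<And>t. t \<in> {0..1} \<Longrightarrow> 1 - measure \<mm> U \<le> e t" "e 0 \<le> ln (L / c)"
    "\<And>s t u. 0 \<le> s \<Longrightarrow> s < t \<Longrightarrow> t \<le> 1 \<Longrightarrow> u \<in> {0..1} \<Longrightarrow>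
       e (s + u * (t - s)) \<le> (1 - u) * e s + u * e t + k * (u * (1 - u))"
    using Ent_law_real[OF f] by metis
  obtain e1 where e1: "\<And>t. t \<in> {0..1} \<Longrightarrow> Ent \<mm> (law f1 t) = ereal (e1 t)" "e1 1 \<le> ln (L / c)"
    "\<And>s t u. 0 \<le> s \<Longrightarrow> s < t \<Longrightarrow> t \<le> 1 \<Longrightarrow> u \<in> {0..1} \<Longrightarrow>
       e1 (s + u * (t - s)) \<le> (1 - u) * e1 s + u * e1 t + k * (u * (1 - u))"
    using Ent_law_real[OF f1] by metis
  obtain e2 where e2: "\<And>t. t \<in> {0..1} \<Longrightarrow> Ent \<mm> (law f2 t) = ereal (e2 t)" "e2 1 \<le> ln (L / c)"
    "\<And>s t u. 0 \<le> s \<Longrightarrow> s < t \<Longrightarrow> t \<le> 1 \<Longrightarrow> u \<in> {0..1} \<Longrightarrow>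
       e2 (s + u * (t - s)) \<le> (1 - u) * e2 s + u * e2 t + k * (u * (1 - u))"
    using Ent_law_real[OF f2] by metis
  have eqs: "e1 s = e s" "e2 s = e s"
    using e(1)[OF s01] e1(1)[OF s01] e2(1)[OF s01] same same_f by auto
  have "Ent \<mm> (law f (s + h)) = ereal ((e1 (s + h) + e2 (s + h)) / 2 - ln 2)"
  proof (rule \<mm>.Ent_mix_singular[where S = U and A = A])
    show "prob_space (law f1 (s + h))" "prob_space (law f2 (s + h))"
      using prob_space_law f1 f2 sh by blast+
    show "AE x in law f1 (s + h). x \<in> U" "AE x in law f2 (s + h). x \<in> U"
      using AE_law_U sh by auto
  qed (use A mix[OF sh] e1(1)[OF sh] e2(1)[OF sh] open_U U_finite in auto)
  then have esh: "e (s + h) = (e1 (s + h) + e2 (s + h)) / 2 - ln 2"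
    using e(1)[OF sh] by simp
  \<comment> \<open>These are the positions of \<open>s\<close> in \<open>[0, s + h]\<close> and of
    \<open>s + h\<close> in \<open>[s, 1]\<close>. The condition \<open>h \<le> a \<le> s\<close>
    gives \<open>l \<ge> 1 / 2\<close>, and \<open>a\<close> and \<open>b\<close> make the estimates
    uniform in \<open>s\<close>, as iteration requires.\<close>
  define l where "l = s / (s + h)"
  define m where "m = h / (1 - s)"
  have l: "1 / 2 \<le> l" "l \<le> 1" "1 - l = h / (s + h)" and m: "0 \<le> m" "m \<le> 1"
    using s h b by (auto simp: l_def m_def field_simps)
  have w: "(1 - l) + m \<le> h * (1 / a + 1 / (1 - b))"
  proof -
    have "h / (s + h) \<le> h / a" "h / (1 - s) \<le> h / (1 - b)"
      using s h b by (auto intro!: divide_left_mono mult_pos_pos)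
    then show ?thesis by (simp add: l m_def distrib_left)
  qed
  have "ln 2 / 2 \<le> h * (1 / a + 1 / (1 - b)) * (k + measure \<mm> U + ln (L / c))"
  proof (rule separation_arith[where x = "e s" and ?a0.0 = "e 0" and ?y1.0 = "e1 (s + h)" and ?y2.0 = "e2 (s + h)"
        and ?b1.0 = "e1 1" and ?b2.0 = "e2 1" and l = l and m = m])
    show "0 \<le> ln (L / c)" using c c0 L_ge_1 by (simp add: field_simps)
    show "- measure \<mm> U \<le> e s" using e(2)[OF s01] by simp
    show "e s \<le> (1 - l) * e 0 + l * ((e1 (s + h) + e2 (s + h)) / 2 - ln 2) + k * (l * (1 - l))"
      using e(4)[of 0 "s + h" l] l s h sh esh by (simp add: l_def)
    show "e1 (s + h) \<le> (1 - m) * e s + m * e1 1 + k * (m * (1 - m))"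
      using e1(3)[of s 1 m] s h b m eqs by (simp add: m_def)
    show "e2 (s + h) \<le> (1 - m) * e s + m * e2 1 + k * (m * (1 - m))"
      using e2(3)[of s 1 m] s h b m eqs by (simp add: m_def)
  qed (use l m w k_nonneg e e1 e2 in auto)
  moreover have "ln (L / c) = ln L - ln c" using c0 L_ge_1 by (simp add: ln_div)
  ultimately show ?thesis by (simp only: add_diff_eq)
qed

text \<open>The bound is \<open>separation_bound\<close> solved for \<open>c\<close>, applied to the
  splitting of the event at time \<open>s + h\<close> along the position at time \<open>s\<close>.
  The leading factor 2 comes from the error of the majority decision.\<close>

lemma one_step_approximation:
  assumes s: "0 < a" "a \<le> s" and h: "0 < h" "h \<le> a" and b: "s + h \<le> b" "b < 1" and C: "C \<in> sets borel"
  shows "\<exists>C'\<in>sets borel. measure \<pi> {\<gamma>. (eval (s + h) \<gamma> \<in> C) \<noteq> (eval s \<gamma> \<in> C')}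
     \<le> 2 * exp (k + measure \<mm> U + ln L - ln 2 / (2 * (1 / a + 1 / (1 - b))) / h)"
proof -
  have s01: "s \<in> {0..1}" and sh: "s + h \<in> {0..1}" using s h b by auto
  note [measurable] = eval_measurable_plan[OF s01] eval_measurable_plan[OF sh] C
  define D where "D = {\<gamma>. eval (s + h) \<gamma> \<in> C}"
  have D: "D \<in> sets \<pi>"
    using measurable_sets[OF eval_measurable_plan[OF sh] C] by (simp add: D_def vimage_def)
  obtain c f1 f2 C' where c: "0 \<le> c" and f[measurable]: "f1 \<in> borel_measurable \<pi>" "f2 \<in> borel_measurable \<pi>"
    and f01: "\<And>x. 0 \<le> f1 x" "\<And>x. f1 x \<le> 1" "\<And>x. 0 \<le> f2 x" "\<And>x. f2 x \<le> (1::real)"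
    and fD: "\<And>x. x \<notin> D \<Longrightarrow> f1 x = 0" "\<And>x. x \<in> D \<Longrightarrow> f2 x = 0"
    and fc: "(\<integral>\<^sup>+x. ennreal (f1 x) \<partial>\<pi>) = ennreal c" "(\<integral>\<^sup>+x. ennreal (f2 x) \<partial>\<pi>) = ennreal c"
    and eq: "distr (density \<pi> (\<lambda>x. ennreal (f1 x))) borel (eval s) = distr (density \<pi> (\<lambda>x. ennreal (f2 x))) borel (eval s)"
    and C': "C' \<in> sets borel" "measure \<pi> {x \<in> space \<pi>. (x \<in> D) \<noteq> (eval s x \<in> C')} \<le> 2 * c"
    and le: "\<And>C. C \<in> sets borel \<Longrightarrow> c \<le> measure \<pi> {x \<in> space \<pi>. (x \<in> D) \<noteq> (eval s x \<in> C)}"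
    by (rule \<pi>.split_along_map[OF eval_measurable_plan[OF s01] D], rule that, assumption+)
  \<comment> \<open>As a lower bound for every error, \<open>c\<close> is at most a probability;
    this keeps \<open>ln (L / c)\<close> nonnegative.\<close>
  have c1: "c \<le> 1" using le[of "{}"] \<pi>.prob_le_1 order_trans by blast
  have "c \<le> exp (k + measure \<mm> U + ln L - ln 2 / (2 * (1 / a + 1 / (1 - b))) / h)"
  proof (cases "c = 0")
    case False
    then have c0: "c > 0" using c by simp
    have adm: "admissible c (\<lambda>\<gamma>. 1 / c * f \<gamma>)"
      if [measurable]: "f \<in> borel_measurable \<pi>" and "\<And>x. 0 \<le> f x" "\<And>x. f x \<le> 1" "(\<integral>\<^sup>+x. ennreal (f x) \<partial>\<pi>) = ennreal c" for f
    proof -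
      have "(\<integral>\<^sup>+x. ennreal (1 / c * f x) \<partial>\<pi>) = ennreal (1 / c) * ennreal c"
        using c0 that(2) by (subst ennreal_mult) (auto simp: nn_integral_cmult that(4) simp del: ennreal_mult'')
      also have "\<dots> = 1" using c0 by (simp flip: ennreal_mult)
      finally have "(\<integral>\<^sup>+x. ennreal (1 / c * f x) \<partial>\<pi>) = 1" .
      moreover have "(\<lambda>\<gamma>. 1 / c * f \<gamma>) \<in> borel_measurable borel"
        using that(1) by (simp add: measurable_cong_sets[OF sets_plan refl])
      ultimately show ?thesis
        using c0 that(2,3) by (auto simp: admissible_def divide_right_mono)
    qed
    have "ln 2 / 2 \<le> h * (1 / a + 1 / (1 - b)) * (k + measure \<mm> U + ln L - ln c)"
    proof (rule separation_bound[OF adm[OF f(1) f01(1,2) fc(1)] adm[OF f(2) f01(3,4) fc(2)] c1 s h b _ C])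
      show "law (\<lambda>\<gamma>. 1 / c * f1 \<gamma>) s = law (\<lambda>\<gamma>. 1 / c * f2 \<gamma>) s"
        using c0 f01 by (intro law_cong_scaled[OF f s01 eq]) auto
      show "AE x in law (\<lambda>\<gamma>. 1 / c * f1 \<gamma>) (s + h). x \<in> C"
        using c0 fD by (intro AE_law sh C AE_I2) (auto simp: D_def intro: ccontr)
      have "AE x in law (\<lambda>\<gamma>. 1 / c * f2 \<gamma>) (s + h). x \<in> - C"
        using c0 fD C by (intro AE_law sh AE_I2) (auto simp: D_def)
      then show "AE x in law (\<lambda>\<gamma>. 1 / c * f2 \<gamma>) (s + h). x \<notin> C" by simp
    qed
    moreover define R where "R = 1 / a + 1 / (1 - b)"
    moreover have "R > 0" unfolding R_def using s b by (intro add_pos_pos) auto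
    moreover have "ln 2 / (2 * R) / h = (ln 2 / 2) / (h * R)" by simp
    ultimately have "ln 2 / (2 * R) / h \<le> k + measure \<mm> U + ln L - ln c"
      using h by (simp add: pos_divide_le_eq mult_ac del: divide_divide_eq_left)
    then have "ln c \<le> k + measure \<mm> U + ln L - ln 2 / (2 * (1 / a + 1 / (1 - b))) / h"
      unfolding R_def by simp
    then show ?thesis using c0 by (metis exp_le_cancel_iff exp_ln)
  qed simp
  then show ?thesis
    using C' by (intro bexI[OF _ C'(1)]) (simp add: D_def)
qed

lemma disagreement_measurable:
  assumes "s \<in> {0..1}" "t \<in> {0..1}" "C \<in> sets borel" "C' \<in> sets borel"
  shows "{\<gamma>. (eval t \<gamma> \<in> C) \<noteq> (eval s \<gamma> \<in> C')} \<in> sets \<pi>"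
proof -
  note [measurable] = eval_measurable_plan[OF assms(1)] eval_measurable_plan[OF assms(2)] assms(3,4)
  have "{\<gamma> \<in> space \<pi>. (eval t \<gamma> \<in> C) \<noteq> (eval s \<gamma> \<in> C')} \<in> sets \<pi>" by measurable
  then show ?thesis by simp
qed

text \<open>The last step replaces \<open>C\<close> by a set \<open>C1\<close> one time step
  earlier, to which the induction hypothesis applies; hence \<open>C\<close> is arbitrary in the
  induction. Disagreements compose by the union bound.\<close>

lemma many_steps_approximation:
  assumes s: "0 < a" "a \<le> s" and h: "0 < h" "h \<le> a" and b: "s + real n * h \<le> b" "b < 1" and C: "C \<in> sets borel"
  shows "\<exists>C'\<in>sets borel. measure \<pi> {\<gamma>. (eval (s + real n * h) \<gamma> \<in> C) \<noteq> (eval s \<gamma> \<in> C')}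
     \<le> real n * (2 * exp (k + measure \<mm> U + ln L - ln 2 / (2 * (1 / a + 1 / (1 - b))) / h))"
  using b C
proof (induction n arbitrary: C)
  case 0
  then show ?case by (intro bexI[of _ C]) auto
next
  case (Suc n)
  let ?E = "2 * exp (k + measure \<mm> U + ln L - ln 2 / (2 * (1 / a + 1 / (1 - b))) / h)"
  have nh: "0 \<le> real n * h" using h by simp
  have Sn: "s + real (Suc n) * h = (s + real n * h) + h" by (simp add: algebra_simps)
  have b': "s + real n * h + h \<le> b" using Suc.prems(1) unfolding Sn .
  obtain C1 where C1: "C1 \<in> sets borel"
    "measure \<pi> {\<gamma>. (eval (s + real n * h + h) \<gamma> \<in> C) \<noteq> (eval (s + real n * h) \<gamma> \<in> C1)} \<le> ?E"
    using one_step_approximation[OF s(1) _ h b' \<open>b < 1\<close> Suc.prems(3)] s nh by auto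
  obtain C2 where C2: "C2 \<in> sets borel"
    "measure \<pi> {\<gamma>. (eval (s + real n * h) \<gamma> \<in> C1) \<noteq> (eval s \<gamma> \<in> C2)} \<le> real n * ?E"
    using Suc.IH[OF _ \<open>b < 1\<close> C1(1)] b' h by auto
  have r: "s \<in> {0..1}" "s + real n * h \<in> {0..1}" "s + real n * h + h \<in> {0..1}"
    unfolding atLeastAtMost_iff using s nh h b' Suc.prems(2) by linarith+
  let ?D1 = "{\<gamma>. (eval (s + real n * h + h) \<gamma> \<in> C) \<noteq> (eval (s + real n * h) \<gamma> \<in> C1)}"
  let ?D2 = "{\<gamma>. (eval (s + real n * h) \<gamma> \<in> C1) \<noteq> (eval s \<gamma> \<in> C2)}"
  have D: "?D1 \<in> sets \<pi>" "?D2 \<in> sets \<pi>"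
    using disagreement_measurable r C1(1) C2(1) Suc.prems(3) by blast+
  have "measure \<pi> {\<gamma>. (eval (s + real n * h + h) \<gamma> \<in> C) \<noteq> (eval s \<gamma> \<in> C2)} \<le> measure \<pi> (?D1 \<union> ?D2)"
    using D by (intro \<pi>.finite_measure_mono) auto
  also have "\<dots> \<le> measure \<pi> ?D1 + measure \<pi> ?D2"
    using D by (rule measure_Un_le)
  also have "\<dots> \<le> real (Suc n) * ?E"
    using C1(2) C2(2) by (simp add: distrib_right)
  finally show ?case unfolding Sn using C2(1) by blast
qed

text \<open>The bounds \<open>a = s\<close> and \<open>b = t\<close> stay fixed under refinement, so
  the rate \<open>\<delta>\<close> does not depend on the number of steps.\<close>

lemma interior_times_agreement:
  assumes s: "0 < s" "s < t" and t: "t < 1" and C: "C \<in> sets borel"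
  shows "\<exists>C'\<in>sets borel. AE \<gamma> in \<pi>. eval t \<gamma> \<in> C \<longleftrightarrow> eval s \<gamma> \<in> C'"
proof -
  have s01: "s \<in> {0..1}" and t01: "t \<in> {0..1}" using s t by auto
  have D: "{\<gamma>. eval t \<gamma> \<in> C} \<in> sets \<pi>"
    using measurable_sets[OF eval_measurable_plan[OF t01] C] by (simp add: vimage_def)
  have "\<exists>C'\<in>sets borel. AE \<gamma> in \<pi>. \<gamma> \<in> {\<gamma>. eval t \<gamma> \<in> C} \<longleftrightarrow> eval s \<gamma> \<in> C'"
  proof (rule \<pi>.agreement_if_approximable[OF eval_measurable_plan[OF s01] D])
    fix \<epsilon> :: real assume \<epsilon>: "\<epsilon> > 0"
    define Q where "Q = k + measure \<mm> U + ln L"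
    define \<delta> where "\<delta> = ln 2 / (2 * (1 / s + 1 / (1 - t))) / (t - s)"
    have \<delta>: "\<delta> > 0" using s t by (auto simp: \<delta>_def intro!: divide_pos_pos add_pos_pos mult_pos_pos)
    have "(\<lambda>n. 2 * exp Q * (real n * exp (- \<delta>) ^ n)) \<longlonglongrightarrow> 2 * exp Q * 0"
      using \<delta> by (intro tendsto_mult tendsto_const powser_times_n_limit_0) auto
    then have "\<forall>\<^sub>F n in sequentially. 2 * exp Q * (real n * exp (- \<delta>) ^ n) < \<epsilon>"
      using \<epsilon> by (intro order_tendstoD(2)) auto
    \<comment> \<open>This makes the step \<open>(t - s) / n\<close> at most \<open>s\<close>, as
      the one-step estimate demands.\<close>
    moreover have "\<forall>\<^sub>F n in sequentially. real n > max 1 ((t - s) / s)"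
      using filterlim_real_sequentially by (rule filterlim_at_top_dense[THEN iffD1, rule_format])
    ultimately have "\<forall>\<^sub>F n in sequentially. 2 * exp Q * (real n * exp (- \<delta>) ^ n) < \<epsilon> \<and> real n > max 1 ((t - s) / s)"
      by (rule eventually_conj)
    then obtain n where n: "2 * exp Q * (real n * exp (- \<delta>) ^ n) < \<epsilon>" "real n > 1" "real n > (t - s) / s"
      using eventually_happens'[OF sequentially_bot] by fastforce
    define h where "h = (t - s) / real n"
    have h: "0 < h" "h \<le> s" "s + real n * h = t"
      using n s by (auto simp: h_def field_simps)
    have "\<exists>C'\<in>sets borel. measure \<pi> {\<gamma>. (eval (s + real n * h) \<gamma> \<in> C) \<noteq> (eval s \<gamma> \<in> C')}
     \<le> real n * (2 * exp (k + measure \<mm> U + ln L - ln 2 / (2 * (1 / s + 1 / (1 - t))) / h))"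
      by (rule many_steps_approximation) (use s t h C in auto)
    moreover have "exp (k + measure \<mm> U + ln L - ln 2 / (2 * (1 / s + 1 / (1 - t))) / h) = exp Q * exp (- \<delta>) ^ n"
    proof -
      have "ln 2 / (2 * (1 / s + 1 / (1 - t))) / h = real n * \<delta>"
        by (simp add: h_def \<delta>_def)
      moreover have "exp (- \<delta>) ^ n = exp (- (real n * \<delta>))"
        by (simp flip: exp_of_nat_mult)
      ultimately show ?thesis by (simp only: Q_def diff_conv_add_uminus exp_add)
    qed
    ultimately obtain C' where C': "C' \<in> sets borel"
      "measure \<pi> {\<gamma>. (eval t \<gamma> \<in> C) \<noteq> (eval s \<gamma> \<in> C')} \<le> real n * (2 * (exp Q * exp (- \<delta>) ^ n))"
      unfolding h(3) by auto
    note C'(2)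
    also have "real n * (2 * (exp Q * exp (- \<delta>) ^ n)) \<le> \<epsilon>"
      using n(1) by (simp add: mult_ac)
    finally show "\<exists>C'\<in>sets borel. measure \<pi> {\<gamma> \<in> space \<pi>. (\<gamma> \<in> {\<gamma>. eval t \<gamma> \<in> C}) \<noteq> (eval s \<gamma> \<in> C')} \<le> \<epsilon>"
      by (intro bexI[OF _ C'(1)]) simp
  qed
  then show ?thesis by simp
qed

end

section \<open>The initial time\<close>

lemma (in sigma_finite_measure) Ent_uniform:
  assumes A: "A \<in> sets M" "emeasure M A < \<infinity>" "0 < measure M A"
  shows "Ent M (density M (\<lambda>x. ennreal (indicator A x / measure M A))) = ereal (- ln (measure M A))"
proof -
  have eq: "(\<lambda>x. indicator A x / measure M A * ln (indicator A x / measure M A))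
      = (\<lambda>x. indicator A x * (ln (1 / measure M A) / measure M A))"
    by (auto split: split_indicator)
  have "Ent M (density M (\<lambda>x. ennreal (indicator A x / measure M A)))
      = ereal (\<integral>x. indicator A x / measure M A * ln (indicator A x / measure M A) \<partial>M)"
  proof (rule Ent_density)
    show "integrable M (\<lambda>x. indicator A x / measure M A * ln (indicator A x / measure M A))"
      unfolding eq using A by auto
  qed (use A in auto)
  also have "\<dots> = ereal (ln (1 / measure M A))"
    unfolding eq using A sets.Int_space_eq2[OF A(1)] by simp
  finally show ?thesis using A by (simp add: ln_div)
qed

text \<open>The neighbourhoods decrease to \<open>A\<close> because \<open>A\<close> is closed, and
  inside \<open>U\<close> their measures are finite, so continuity from above applies.\<close>

lemma infdist_nbhd_measure_tendsto:
  fixes A :: "'a::metric_space set" and r :: "nat \<Rightarrow> real"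
  assumes M: "sets M = sets borel" and A: "closed A" "A \<noteq> {}" "A \<subseteq> U"
    and U: "open U" "emeasure M U < \<infinity>"
    and r: "decseq r" "r \<longlonglongrightarrow> 0" "\<And>n. 0 \<le> r n"
  shows "(\<lambda>n. measure M {x \<in> U. infdist x A \<le> r n}) \<longlonglongrightarrow> measure M A"
proof -
  let ?N = "\<lambda>n. {x \<in> U. infdist x A \<le> r n}"
  have meas: "?N n \<in> sets M" for n
  proof -
    have "closed {x. infdist x A \<le> r n}"
      by (intro closed_Collect_le continuous_intros)
    then have "U \<inter> {x. infdist x A \<le> r n} \<in> sets M"
      using U(1) unfolding M by auto
    then show ?thesis by (simp add: Collect_conj_eq)
  qed
  have "(\<Inter>n. ?N n) = A"
  proof
    show "A \<subseteq> (\<Inter>n. ?N n)" using A r(3) by auto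
    show "(\<Inter>n. ?N n) \<subseteq> A"
    proof
      fix x assume x: "x \<in> (\<Inter>n. ?N n)"
      then have "infdist x A \<le> 0" by (intro LIMSEQ_le_const[OF r(2)]) auto
      then show "x \<in> A"
        using A infdist_nonneg[of x A] by (simp add: in_closed_iff_infdist_zero)
    qed
  qed
  moreover have "(\<lambda>n. measure M (?N n)) \<longlonglongrightarrow> measure M (\<Inter>n. ?N n)"
  proof (rule Lim_measure_decseq)
    show "decseq ?N" using r(1) by (force simp: decseq_def intro: order_trans)
    show "emeasure M (?N n) \<noteq> \<infinity>" for n
      using emeasure_mono[of "?N n" U M] U M by (auto simp: top_unique)
  qed (use meas in auto)
  ultimately show ?thesis by simp
qed

context bounded_CD_plan
begin

text \<open>Some superlevel set of \<open>\<sigma>\<close> has positive measure, and a compact part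
  of it keeps positive measure. The bound \<open>\<eta>\<close> makes division by
  \<open>\<sigma>\<close> harmless; compactness lets neighbourhoods shrink to the set.\<close>

lemma compact_subset_of_support:
  assumes \<sigma>: "\<sigma> \<in> borel_measurable borel" "\<And>x. 0 \<le> (\<sigma> x :: real)"
    and pos: "0 < emeasure (density \<mm> (\<lambda>x. ennreal (\<sigma> x))) U"
  obtains A \<eta> where "compact A" "A \<subseteq> U" "0 < \<eta>" "\<And>x. x \<in> A \<Longrightarrow> \<eta> \<le> \<sigma> x"
    "emeasure \<mm> A < \<infinity>" "0 < measure \<mm> A"
proof -
  note [measurable] = \<sigma>(1) borel_open[OF open_U]
  define A where "A n = {x \<in> U. 1 / real (Suc n) \<le> \<sigma> x}" for n
  have A[measurable]: "A n \<in> sets borel" for n unfolding A_def by measurable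
  have "\<exists>n. 0 < emeasure \<mm> (A n)"
  proof (rule ccontr)
    assume "\<not> ?thesis"
    then have null: "A n \<in> null_sets \<mm>" for n using A by (auto simp: null_sets_def)
    have "(\<Union>n. A n) = {x \<in> U. 0 < \<sigma> x}"
    proof (intro equalityI subsetI)
      fix x assume x: "x \<in> {x \<in> U. 0 < \<sigma> x}"
      then obtain n where "1 / real (Suc n) < \<sigma> x" using nat_approx_posE[of "\<sigma> x"] by auto
      then show "x \<in> (\<Union>n. A n)" using x by (auto simp: A_def intro!: exI[of _ n])
    next
      fix x assume "x \<in> (\<Union>n. A n)"
      then obtain n where "x \<in> U" "1 / real (Suc n) \<le> \<sigma> x" by (auto simp: A_def)
      moreover have "0 < 1 / real (Suc n)" by simp
      ultimately have "0 < \<sigma> x" by linarith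
      then show "x \<in> {x \<in> U. 0 < \<sigma> x}" using \<open>x \<in> U\<close> by simp
    qed
    then have "{x \<in> U. 0 < \<sigma> x} \<in> null_sets \<mm>" using null_sets_UN[of A \<mm>] null by simp
    then have "AE x in \<mm>. ennreal (\<sigma> x) * indicator U x = 0"
      by (rule AE_I'[OF _]) (use \<sigma>(2) in \<open>auto simp: less_le split: split_indicator\<close>)
    then have "emeasure (density \<mm> (\<lambda>x. ennreal (\<sigma> x))) U = 0"
      by (simp add: emeasure_density nn_integral_0_iff_AE)
    then show False using pos by simp
  qed
  then obtain n where n: "0 < emeasure \<mm> (A n)" by blast
  \<comment> \<open>Inner regularity is applied to a finite measure, hence to the part of
    \<open>\<mm>\<close> inside \<open>U\<close>.\<close>
  define M where "M = density \<mm> (indicator U)"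
  have M: "emeasure M B = emeasure \<mm> (U \<inter> B)" if [measurable]: "B \<in> sets borel" for B
    by (simp add: M_def emeasure_density flip: indicator_inter_arith)
  have "A n \<subseteq> U" by (auto simp: A_def)
  then have An: "emeasure M (A n) = emeasure \<mm> (A n)" by (subst M) (auto simp: Int_absorb1)
  have "emeasure M (A n) = (SUP K \<in> {K. K \<subseteq> A n \<and> compact K}. emeasure M K)"
    by (rule inner_regular) (use U_finite M[of UNIV] in \<open>auto simp: M_def\<close>)
  then obtain C where C: "C \<subseteq> A n" "compact C" "0 < emeasure M C"
    using n unfolding An by (auto simp: less_SUP_iff)
  have CU: "C \<subseteq> U" using C(1) \<open>A n \<subseteq> U\<close> by auto
  have Cb: "C \<in> sets borel" using C by (simp add: borel_closed compact_imp_closed)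
  have "0 < emeasure \<mm> C" using C(3) M[OF Cb] CU by (simp add: Int_absorb1)
  moreover have fin: "emeasure \<mm> C < \<infinity>"
    using emeasure_mono[OF CU, of \<mm>] U_finite by (simp add: order_le_less_trans)
  ultimately have "0 < measure \<mm> C" by (simp add: measure_def enn2real_positive_iff)
  then show thesis
    using C(1) by (intro that[of C "1 / real (Suc n)"] C(2) CU fin) (auto simp: A_def)
qed

text \<open>A geodesic of length at most \<open>d\<close> has moved at most \<open>d * s\<close> by
  time \<open>s\<close>.\<close>

lemma AE_near_start:
  assumes s: "s \<in> {0..1}"
  shows "AE \<gamma> in \<pi>. eval 0 \<gamma> \<in> A \<longrightarrow> eval s \<gamma> \<in> {x \<in> U. infdist x A \<le> d * s}"
  using AE_eval_U AE_dist_le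
proof eventually_elim
  case (elim \<gamma>)
  have "dist (eval s \<gamma>) (eval 0 \<gamma>) = s * dist (eval 0 \<gamma>) (eval 1 \<gamma>)"
    using dist_eval_eval[OF s, of 0 \<gamma>] s by simp
  also have "\<dots> \<le> d * s" using mult_left_mono[OF elim(2), of s] s by (simp add: mult.commute)
  finally have le: "dist (eval s \<gamma>) (eval 0 \<gamma>) \<le> d * s" .
  show ?case using elim(1) s le infdist_le2 by auto
qed

text \<open>Otherwise there are two plans with the same initial law which are mutually singular at every
  small time. Reweighting makes the initial law uniform on a compact set \<open>A\<close>. By convexity of the
  entropy each of the laws at time \<open>s\<close> spreads over a set of measure almost \<open>\<mm> A\<close>, but both sets
  are disjoint and contained in the \<open>d s\<close>-neighbourhood of \<open>A\<close>.\<close>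

lemma initial_time_agreement:
  assumes D: "D \<in> sets \<pi>" and s0: "0 < s0" "s0 < 1"
    and agree: "\<And>s. 0 < s \<Longrightarrow> s < s0 \<Longrightarrow> \<exists>C\<in>sets borel. AE \<gamma> in \<pi>. \<gamma> \<in> D \<longleftrightarrow> eval s \<gamma> \<in> C"
  shows "\<exists>C\<in>sets borel. AE \<gamma> in \<pi>. \<gamma> \<in> D \<longleftrightarrow> eval 0 \<gamma> \<in> C"
proof -
  have z01: "(0::real) \<in> {0..1}" by simp
  note [measurable] = eval_measurable_plan[OF z01]
  obtain c f1 f2 C' where c: "0 \<le> c" and f[measurable]: "f1 \<in> borel_measurable \<pi>" "f2 \<in> borel_measurable \<pi>"
    and f01: "\<And>x. 0 \<le> f1 x" "\<And>x. f1 x \<le> 1" "\<And>x. 0 \<le> f2 x" "\<And>x. f2 x \<le> (1::real)"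
    and fD: "\<And>x. x \<notin> D \<Longrightarrow> f1 x = 0" "\<And>x. x \<in> D \<Longrightarrow> f2 x = 0"
    and fc: "(\<integral>\<^sup>+x. ennreal (f1 x) \<partial>\<pi>) = ennreal c" "(\<integral>\<^sup>+x. ennreal (f2 x) \<partial>\<pi>) = ennreal c"
    and eq: "distr (density \<pi> (\<lambda>x. ennreal (f1 x))) borel (eval 0) = distr (density \<pi> (\<lambda>x. ennreal (f2 x))) borel (eval 0)"
    and C': "C' \<in> sets borel" "measure \<pi> {x \<in> space \<pi>. (x \<in> D) \<noteq> (eval 0 x \<in> C')} \<le> 2 * c"
    and le: "\<And>C. C \<in> sets borel \<Longrightarrow> c \<le> measure \<pi> {x \<in> space \<pi>. (x \<in> D) \<noteq> (eval 0 x \<in> C)}"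
    by (rule \<pi>.split_along_map[OF eval_measurable_plan[OF z01] D], rule that, assumption+)
  have "c = 0"
  proof (rule ccontr)
    assume "c \<noteq> 0"
    then have c0: "c > 0" using c by simp
    define \<nu> where "\<nu> = law f1 0"
    have \<nu>2: "\<nu> = law f2 0" using eq by (simp add: \<nu>_def law_def)
    have [simp]: "sets \<nu> = sets borel" by (simp add: \<nu>_def)
    have \<nu>_le: "emeasure \<nu> B \<le> ennreal L * emeasure \<mm> B" if B: "B \<in> sets borel" for B
    proof -
      have "emeasure \<nu> B \<le> (\<integral>\<^sup>+\<gamma>. indicator {\<gamma>. eval 0 \<gamma> \<in> B} \<gamma> \<partial>\<pi>)"
        unfolding \<nu>_def emeasure_law[OF f(1) z01 B]
        by (intro nn_integral_mono) (use f01 in \<open>auto split: split_indicator\<close>)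
      also have "\<dots> = emeasure \<pi> {\<gamma>. eval 0 \<gamma> \<in> B}"
        using measurable_sets[OF eval_measurable_plan[OF z01] B]
        by (intro nn_integral_indicator) (simp add: vimage_def)
      also note initial_le[OF B]
      finally show ?thesis .
    qed
    then have ac: "absolutely_continuous \<mm> \<nu>"
      unfolding absolutely_continuous_def by (force simp: null_sets_def)
    have \<nu>c: "emeasure \<nu> UNIV = ennreal c"
      unfolding \<nu>_def by (subst emeasure_law[OF f(1) z01]) (auto simp: fc)
    have "finite_measure \<nu>"
      using \<nu>c sets_eq_imp_space_eq[of \<nu> borel] by (intro finite_measureI) auto
    then have "density \<mm> (\<lambda>x. ennreal (enn2real (RN_deriv \<mm> \<nu> x))) = \<nu>"
      by (rule \<mm>.density_enn2real_RN_deriv) (use ac in auto)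
    moreover define \<sigma> where "\<sigma> = (\<lambda>x. enn2real (RN_deriv \<mm> \<nu> x))"
    ultimately have \<nu>: "\<nu> = density \<mm> (\<lambda>x. ennreal (\<sigma> x))" by simp
    have \<sigma>0: "\<And>x. 0 \<le> \<sigma> x" by (simp add: \<sigma>_def)
    have "\<sigma> \<in> borel_measurable \<mm>" unfolding \<sigma>_def by measurable
    then have \<sigma>[measurable]: "\<sigma> \<in> borel_measurable borel" by simp
    have "emeasure \<nu> U = emeasure \<nu> UNIV"
      using AE_law_U[OF f(1) z01] open_U unfolding \<nu>_def by (intro emeasure_eq_AE) auto
    then have pos: "0 < emeasure (density \<mm> (\<lambda>x. ennreal (\<sigma> x))) U"
      using \<nu>c c0 \<nu> by simp
    obtain A \<eta> where A: "compact A" "A \<subseteq> U" "0 < \<eta>" "\<And>x. x \<in> A \<Longrightarrow> \<eta> \<le> \<sigma> x"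
      "emeasure \<mm> A < \<infinity>" "0 < measure \<mm> A"
      by (rule compact_subset_of_support[OF \<sigma> \<sigma>0 pos], rule that, assumption+)
    have [measurable]: "A \<in> sets borel" using A by (simp add: borel_closed compact_imp_closed)
    define \<alpha> where "\<alpha> = measure \<mm> A"
    have \<alpha>: "\<alpha> > 0" using A by (simp add: \<alpha>_def)
    \<comment> \<open>Since \<open>r\<close> depends on the initial position only, the same factor
      makes both initial laws uniform on \<open>A\<close>. It is bounded by
      \<open>1 / (\<eta> * \<alpha>)\<close>, so the reweighted plans remain admissible.\<close>
    define r where "r = (\<lambda>x. indicator A x / (\<sigma> x * \<alpha>))"
    have r[measurable]: "r \<in> borel_measurable borel" by (simp add: r_def)
    have r0: "0 \<le> r x" for x using \<sigma>0 \<alpha> by (auto simp: r_def)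
    have r1: "r x \<le> 1 / (\<eta> * \<alpha>)" for x
      using A(3,4) \<alpha> \<sigma>0[of x] by (auto simp: r_def intro!: divide_left_mono mult_right_mono mult_pos_pos split: split_indicator)
        (smt (verit))
    have unif: "law (\<lambda>\<gamma>. f \<gamma> * r (eval 0 \<gamma>)) 0 = density \<mm> (\<lambda>x. ennreal (indicator A x / \<alpha>))"
      if [measurable]: "f \<in> borel_measurable \<pi>" and nn: "\<And>x. 0 \<le> f x" and "law f 0 = \<nu>" for f
    proof -
      have "law (\<lambda>\<gamma>. f \<gamma> * r (eval 0 \<gamma>)) 0
          = distr (density (density \<pi> (\<lambda>\<gamma>. ennreal (f \<gamma>))) (\<lambda>\<gamma>. ennreal (r (eval 0 \<gamma>)))) borel (eval 0)"
        unfolding law_def by (subst density_density_eq) (auto simp: ennreal_mult nn r0)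
      also have "\<dots> = density (law f 0) (\<lambda>x. ennreal (r x))"
        unfolding law_def by (rule distr_density_comp) auto
      also have "\<dots> = density \<mm> (\<lambda>x. ennreal (\<sigma> x) * ennreal (r x))"
        unfolding that(3) \<nu> by (rule density_density_eq) auto
      also have "(\<lambda>x. ennreal (\<sigma> x) * ennreal (r x)) = (\<lambda>x. ennreal (indicator A x / \<alpha>))"
      proof
        fix x
        have "ennreal (\<sigma> x) * ennreal (r x) = ennreal (\<sigma> x * r x)" using \<sigma>0 r0 by (simp add: ennreal_mult)
        also have "\<sigma> x * r x = indicator A x / \<alpha>"
          using A(3) A(4)[of x] by (auto simp: r_def split: split_indicator)
        finally show "ennreal (\<sigma> x) * ennreal (r x) = ennreal (indicator A x / \<alpha>)" .
      qed
      finally show ?thesis .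
    qed
    define F1 where "F1 = (\<lambda>\<gamma>. f1 \<gamma> * r (eval 0 \<gamma>))"
    define F2 where "F2 = (\<lambda>\<gamma>. f2 \<gamma> * r (eval 0 \<gamma>))"
    have [measurable]: "F1 \<in> borel_measurable \<pi>" "F2 \<in> borel_measurable \<pi>" by (auto simp: F1_def F2_def)
    have unif1: "law F1 0 = density \<mm> (\<lambda>x. ennreal (indicator A x / \<alpha>))"
      unfolding F1_def by (rule unif[OF f(1) f01(1)]) (simp add: \<nu>_def)
    have unif2: "law F2 0 = density \<mm> (\<lambda>x. ennreal (indicator A x / \<alpha>))"
      unfolding F2_def by (rule unif[OF f(2) f01(3)]) (simp add: \<nu>2)
    have adm: "admissible (\<eta> * \<alpha>) (\<lambda>\<gamma>. f \<gamma> * r (eval 0 \<gamma>))"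
      if [measurable]: "f \<in> borel_measurable \<pi>" and nn: "\<And>x. 0 \<le> f x" "\<And>x. f x \<le> 1"
        and law: "law (\<lambda>\<gamma>. f \<gamma> * r (eval 0 \<gamma>)) 0 = density \<mm> (\<lambda>x. ennreal (indicator A x / \<alpha>))" for f
    proof -
      have m: "(\<lambda>\<gamma>. f \<gamma> * r (eval 0 \<gamma>)) \<in> borel_measurable \<pi>" by measurable
      have "(\<integral>\<^sup>+\<gamma>. ennreal (f \<gamma> * r (eval 0 \<gamma>)) \<partial>\<pi>) = emeasure (law (\<lambda>\<gamma>. f \<gamma> * r (eval 0 \<gamma>)) 0) UNIV"
        by (subst emeasure_law[OF m z01]) auto
      also have "\<dots> = (\<integral>\<^sup>+x. ennreal (1 / \<alpha>) * indicator A x \<partial>\<mm>)"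
        unfolding law by (subst emeasure_density) (auto intro!: nn_integral_cong split: split_indicator)
      also have "\<dots> = ennreal (1 / \<alpha>) * ennreal \<alpha>"
        using A(5) by (subst nn_integral_cmult_indicator) (auto simp: \<alpha>_def emeasure_eq_ennreal_measure)
      also have "\<dots> = 1" using \<alpha> by (simp flip: ennreal_mult)
      finally have 1: "(\<integral>\<^sup>+\<gamma>. ennreal (f \<gamma> * r (eval 0 \<gamma>)) \<partial>\<pi>) = 1" .
      have "f \<gamma> * r (eval 0 \<gamma>) \<le> 1 / (\<eta> * \<alpha>)" for \<gamma>
        using mult_mono[OF nn(2)[of \<gamma>] r1[of "eval 0 \<gamma>"]] r0 by simp
      then show ?thesis
        using m 1 A(3) \<alpha> nn r0 by (auto simp: admissible_def measurable_cong_sets[OF sets_plan refl])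
    qed
    have adm1: "admissible (\<eta> * \<alpha>) F1" and adm2: "admissible (\<eta> * \<alpha>) F2"
      unfolding F1_def F2_def using adm f f01 unif1 unif2 by (auto simp: F1_def F2_def)
    \<comment> \<open>Convexity over \<open>[0, 1]\<close> from the value
      \<open>- ln \<alpha>\<close> at time 0 to at most \<open>ln (L / (\<eta> * \<alpha>))\<close>
      at time 1: \<open>W\<close> is the slope, with \<open>k\<close> for the curvature
      term.\<close>
    define W where "W = ln \<alpha> + ln (L / (\<eta> * \<alpha>)) + k"
    have upper: "Ent \<mm> (law F s) \<le> ereal (- ln \<alpha> + s * W)"
      if F: "admissible (\<eta> * \<alpha>) F" "law F 0 = density \<mm> (\<lambda>x. ennreal (indicator A x / \<alpha>))"
        and s: "s \<in> {0..1}" for F s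
    proof -
      obtain e where e: "\<And>t. t \<in> {0..1} \<Longrightarrow> Ent \<mm> (law F t) = ereal (e t)" "e 1 \<le> ln (L / (\<eta> * \<alpha>))"
        "\<And>s t u. 0 \<le> s \<Longrightarrow> s < t \<Longrightarrow> t \<le> 1 \<Longrightarrow> u \<in> {0..1} \<Longrightarrow>
          e (s + u * (t - s)) \<le> (1 - u) * e s + u * e t + k * (u * (1 - u))"
        using Ent_law_real[OF F(1)] by metis
      have "Ent \<mm> (law F 0) = ereal (- ln \<alpha>)"
        unfolding F(2) \<alpha>_def using A by (intro \<mm>.Ent_uniform) auto
      then have "e 0 = - ln \<alpha>" using e(1)[OF z01] by simp
      moreover have "e s \<le> (1 - s) * e 0 + s * e 1 + k * (s * (1 - s))" using e(3)[of 0 1 s] s by simp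
      moreover have "s * e 1 \<le> s * ln (L / (\<eta> * \<alpha>))" "k * (s * (1 - s)) \<le> k * s"
        using s e(2) k_nonneg by (auto intro!: mult_left_mono simp: mult_left_le)
      ultimately have "e s \<le> - ln \<alpha> + s * W" by (simp add: W_def algebra_simps)
      then show ?thesis using e(1)[OF s] by simp
    qed
    \<comment> \<open>With the tangent at \<open>1 / \<alpha>\<close>, each upper entropy bound
      becomes a lower bound on the measure of a set carrying the law. The carriers
      \<open>?N \<inter> C\<close> and \<open>?N - C\<close> are disjoint, so the two bounds add up
      within \<open>?N\<close>.\<close>
    have key: "2 - measure \<mm> {x \<in> U. infdist x A \<le> d * s} / \<alpha> \<le> 2 * s * W" if s: "0 < s" "s < s0" for s
    proof -
      have s01: "s \<in> {0..1}" using s s0 by auto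
      obtain C where C[measurable]: "C \<in> sets borel" and DC: "AE \<gamma> in \<pi>. \<gamma> \<in> D \<longleftrightarrow> eval s \<gamma> \<in> C"
        using agree[OF s] by blast
      let ?N = "{x \<in> U. infdist x A \<le> d * s}"
      have N[measurable]: "?N \<in> sets borel"
      proof -
        have "closed {x. infdist x A \<le> d * s}"
          by (intro closed_Collect_le continuous_intros)
        then have "U \<inter> {x. infdist x A \<le> d * s} \<in> sets borel"
          using open_U by auto
        then show ?thesis by (simp add: Collect_conj_eq)
      qed
      have N_fin: "emeasure \<mm> ?N < \<infinity>"
        using emeasure_mono[of ?N U \<mm>] U_finite open_U by (auto simp: order_le_less_trans)
      have fin: "emeasure \<mm> (?N \<inter> C) < \<infinity>" "emeasure \<mm> (?N - C) < \<infinity>"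
        using N_fin emeasure_mono[of "?N \<inter> C" ?N \<mm>] emeasure_mono[of "?N - C" ?N \<mm>]
        by (auto intro: order_le_less_trans)
      have rA: "0 < f \<gamma> * r (eval 0 \<gamma>) \<Longrightarrow> eval 0 \<gamma> \<in> A" for f :: "'a geo \<Rightarrow> real" and \<gamma>
        by (auto simp: r_def split: split_indicator_asm)
      have "AE x in law F1 s. x \<in> ?N \<inter> C"
      proof (rule AE_law[OF _ s01])
        show "AE \<gamma> in \<pi>. 0 < F1 \<gamma> \<longrightarrow> eval s \<gamma> \<in> ?N \<inter> C"
          using AE_near_start[OF s01, of A] DC
        proof eventually_elim
          case (elim \<gamma>)
          show ?case
          proof
            assume F: "0 < F1 \<gamma>"
            then have "\<gamma> \<in> D" using fD(1)[of \<gamma>] by (cases "\<gamma> \<in> D") (auto simp: F1_def)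
            then show "eval s \<gamma> \<in> ?N \<inter> C" using elim rA F unfolding F1_def by blast
          qed
        qed
      qed auto
      then have "ereal (ln (1 / \<alpha>) + 1 - 1 / \<alpha> * measure \<mm> (?N \<inter> C)) \<le> Ent \<mm> (law F1 s)"
        using \<alpha> fin by (intro \<mm>.Ent_ge prob_space_law[OF adm1 s01]) auto
      also have "\<dots> \<le> ereal (- ln \<alpha> + s * W)" by (rule upper[OF adm1 unif1 s01])
      finally have 1: "1 - measure \<mm> (?N \<inter> C) / \<alpha> \<le> s * W" using \<alpha> by (simp add: ln_div)
      have "AE x in law F2 s. x \<in> ?N - C"
      proof (rule AE_law[OF _ s01])
        show "AE \<gamma> in \<pi>. 0 < F2 \<gamma> \<longrightarrow> eval s \<gamma> \<in> ?N - C"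
          using AE_near_start[OF s01, of A] DC
        proof eventually_elim
          case (elim \<gamma>)
          show ?case
          proof
            assume F: "0 < F2 \<gamma>"
            then have "\<gamma> \<notin> D" using fD(2)[of \<gamma>] by (cases "\<gamma> \<in> D") (auto simp: F2_def)
            then show "eval s \<gamma> \<in> ?N - C" using elim rA F unfolding F2_def by blast
          qed
        qed
      qed auto
      then have "ereal (ln (1 / \<alpha>) + 1 - 1 / \<alpha> * measure \<mm> (?N - C)) \<le> Ent \<mm> (law F2 s)"
        using \<alpha> fin by (intro \<mm>.Ent_ge prob_space_law[OF adm2 s01]) auto
      also have "\<dots> \<le> ereal (- ln \<alpha> + s * W)" by (rule upper[OF adm2 unif2 s01])
      finally have 2: "1 - measure \<mm> (?N - C) / \<alpha> \<le> s * W" using \<alpha> by (simp add: ln_div)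
      have "measure \<mm> ?N = measure \<mm> (?N \<inter> C) + measure \<mm> (?N - C)"
        using fin by (subst measure_Union[symmetric]) (auto intro!: arg_cong2[where f = measure])
      then show ?thesis using 1 2 by (simp add: add_divide_distrib)
    qed
    \<comment> \<open>The shift by 2 keeps \<open>q n\<close> strictly below \<open>s0\<close> also
      for \<open>n = 0\<close>.\<close>
    define q where "q n = s0 / real (n + 2)" for n :: nat
    have q: "0 < q n" "q n < s0" for n using s0 by (auto simp: q_def field_simps intro!: add_pos_nonneg)
    have q_lim: "q \<longlonglongrightarrow> 0"
      unfolding q_def by (rule LIMSEQ_ignore_initial_segment[OF lim_const_over_n])
    have "(\<lambda>n. measure \<mm> {x \<in> U. infdist x A \<le> d * q n}) \<longlonglongrightarrow> measure \<mm> A"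
    proof (rule infdist_nbhd_measure_tendsto)
      show "decseq (\<lambda>n. d * q n)"
        unfolding decseq_def q_def using d_nonneg s0 by (auto intro!: mult_left_mono divide_left_mono)
      show "(\<lambda>n. d * q n) \<longlonglongrightarrow> 0" using tendsto_mult_left[OF q_lim, of d] by simp
      show "A \<noteq> {}" using A(6) by auto
    qed (use A open_U U_finite d_nonneg q in \<open>auto simp: compact_imp_closed less_imp_le\<close>)
    then have "(\<lambda>n. 2 - measure \<mm> {x \<in> U. infdist x A \<le> d * q n} / \<alpha>) \<longlonglongrightarrow> 2 - measure \<mm> A / \<alpha>"
      using \<alpha> by (intro tendsto_intros) auto
    moreover have "(\<lambda>n. 2 * q n * W) \<longlonglongrightarrow> 2 * 0 * W"
      by (intro tendsto_intros q_lim)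
    \<comment> \<open>As \<open>measure \<mm> A = \<alpha>\<close>, this reads
      \<open>1 \<le> 0\<close>.\<close>
    ultimately have "2 - measure \<mm> A / \<alpha> \<le> 2 * 0 * W"
      by (rule LIMSEQ_le) (use key q in auto)
    then show False using \<alpha> by (simp add: \<alpha>_def)
  qed
  then show ?thesis
    using C' by (intro \<pi>.agreement_if_approximable[OF eval_measurable_plan[OF z01] D] bexI[of _ C']) auto
qed

end

section \<open>Optimal maps\<close>

text \<open>Membership of \<open>x\<close> in countably many small balls around a dense sequence can
  be read off from \<open>e x\<close>. The first centre whose ball of radius
  \<open>(1 / 2) ^ n\<close> is reported to contain \<open>x\<close> approximates \<open>x\<close>
  to that accuracy, and the limit recovers \<open>x\<close>.\<close>

lemma left_inverse_if_agreement:
  fixes M :: "'a::polish_space measure" and e :: "'a \<Rightarrow> 'b"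
  assumes e: "e \<in> measurable M N"
    and agree: "\<And>y r. \<exists>C\<in>sets N. AE x in M. x \<in> cball y r \<longleftrightarrow> e x \<in> C"
  obtains T where "T \<in> measurable N borel" "AE x in M. T (e x) = x"
proof -
  obtain Q :: "'a set" where Q: "countable Q" "\<And>X. open X \<Longrightarrow> X \<noteq> {} \<Longrightarrow> \<exists>d\<in>Q. d \<in> X"
    by (rule countable_dense_setE) blast
  have Qne: "Q \<noteq> {}" using Q(2)[of UNIV] by auto
  define y where "y = from_nat_into Q"
  have y_dense: "\<exists>i. x \<in> cball (y i) r" if r: "r > 0" for x and r :: real
  proof -
    obtain q where "q \<in> Q" "q \<in> ball x r" using Q(2)[of "ball x r"] r by auto
    moreover from this obtain i where "y i = q"
      unfolding y_def using Q(1) by (metis from_nat_into_surj)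
    ultimately show ?thesis by (intro exI[of _ i]) (auto simp: dist_commute)
  qed
  obtain C where C[measurable]: "\<And>n i. C n i \<in> sets N"
    and AE_C: "\<And>n i. AE x in M. x \<in> cball (y i) ((1 / 2) ^ n) \<longleftrightarrow> e x \<in> C n i"
  proof -
    have "\<forall>n i. \<exists>C. C \<in> sets N \<and> (AE x in M. x \<in> cball (y i) ((1 / 2) ^ n) \<longleftrightarrow> e x \<in> C)"
      using agree by blast
    then show thesis using that unfolding choice_iff by blast
  qed
  \<comment> \<open>If no index is reported, \<open>LEAST\<close> returns an arbitrary number;
    outside a null set of \<open>x\<close> this does not happen at \<open>z = e x\<close>.\<close>
  define Tn where "Tn n z = y (LEAST i. z \<in> C n i)" for n z
  have [measurable]: "Tn n \<in> measurable N borel" for n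
  proof -
    have "(\<lambda>z. LEAST i. z \<in> C n i) \<in> measurable N (count_space UNIV)" by measurable
    then show ?thesis
      unfolding Tn_def by (rule measurable_compose) simp
  qed
  \<comment> \<open>Where the approximations fail to be Cauchy they are replaced by a constant, so
    that the sequence converges everywhere and its limit is measurable.\<close>
  define T' where "T' n z = (if Cauchy (\<lambda>n. Tn n z) then Tn n z else y 0)" for n z
  have [measurable]: "T' n \<in> measurable N borel" for n
    unfolding T'_def by measurable
  define T where "T z = lim (\<lambda>n. T' n z)" for z
  have T: "(\<lambda>n. T' n z) \<longlonglongrightarrow> T z" for z
  proof -
    have "convergent (\<lambda>n. T' n z)"
      unfolding T'_def by (cases "Cauchy (\<lambda>n. Tn n z)") (auto simp: Cauchy_convergent_iff convergent_const)
    then show ?thesis by (simp add: T_def convergent_LIMSEQ_iff)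
  qed
  have "T \<in> measurable N borel"
    by (rule borel_measurable_LIMSEQ_metric[of T']) (auto intro: T)
  moreover have "AE x in M. \<forall>n i. x \<in> cball (y i) ((1 / 2) ^ n) \<longleftrightarrow> e x \<in> C n i"
    by (intro AE_all_countable[THEN iffD2] allI AE_C)
  then have "AE x in M. T (e x) = x"
  proof eventually_elim
    case (elim x)
    have bound: "dist (Tn n (e x)) x \<le> (1 / 2) ^ n" for n
    proof -
      obtain i where "x \<in> cball (y i) ((1 / 2) ^ n)" using y_dense[of "(1 / 2) ^ n"] by auto
      then have "e x \<in> C n i" using elim by blast
      then have "e x \<in> C n (LEAST i. e x \<in> C n i)" by (rule LeastI)
      then have "x \<in> cball (Tn n (e x)) ((1 / 2) ^ n)" unfolding Tn_def using elim by blast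
      then show ?thesis by simp
    qed
    have lim0: "(\<lambda>n. (1 / 2 :: real) ^ n) \<longlonglongrightarrow> 0" by (rule LIMSEQ_power_zero) simp
    have "(\<lambda>n. dist (Tn n (e x)) x) \<longlonglongrightarrow> 0"
      by (rule tendsto_sandwich[OF _ _ tendsto_const lim0]) (simp_all add: bound)
    then have lim: "(\<lambda>n. Tn n (e x)) \<longlonglongrightarrow> x" by (subst tendsto_dist_iff)
    then have "(\<lambda>n. T' n (e x)) \<longlonglongrightarrow> x"
      using LIMSEQ_imp_Cauchy[OF lim] by (simp add: T'_def)
    then show ?case using T LIMSEQ_unique by blast
  qed
  ultimately show thesis by (rule that)
qed

section \<open>Restriction to compact sets of geodesics with bounded end-point densities\<close>

lemma emeasure_density_sublevel_le:
  assumes [measurable]: "\<rho> \<in> borel_measurable M" "B \<in> sets M"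
  shows "emeasure (density M (\<lambda>x. ennreal (\<rho> x))) (B \<inter> {x \<in> space M. \<rho> x \<le> r}) \<le> ennreal r * emeasure M B"
proof -
  have "emeasure (density M (\<lambda>x. ennreal (\<rho> x))) (B \<inter> {x \<in> space M. \<rho> x \<le> r})
      = (\<integral>\<^sup>+x. ennreal (\<rho> x) * indicator (B \<inter> {x \<in> space M. \<rho> x \<le> r}) x \<partial>M)"
    by (simp add: emeasure_density)
  also have "\<dots> \<le> (\<integral>\<^sup>+x. ennreal r * indicator B x \<partial>M)"
    by (intro nn_integral_mono) (auto simp: ennreal_leI split: split_indicator)
  also have "\<dots> = ennreal r * emeasure M B" by (simp add: nn_integral_cmult_indicator)
  finally show ?thesis .
qed

text \<open>The geodesics with both end-point densities at most \<open>n\<close> exhaust the space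
  as \<open>n\<close> grows, and inner regularity gives a compact set \<open>\<Gamma>\<close> of
  nearly full mass among them. The plan is then conditioned on \<open>\<Gamma>\<close>.\<close>

lemma exists_bounded_CD_plan:
  fixes \<mm> :: "'a::polish_space measure" and \<pi> :: "'a geo measure"
  assumes lf: "locally_finite_borel_measure \<mm>" and \<pi>: "prob_space \<pi>" "sets \<pi> = sets borel"
    and ac0: "absolutely_continuous \<mm> (distr \<pi> borel (eval 0))"
    and ac1: "absolutely_continuous \<mm> (distr \<pi> borel (eval 1))"
    and convex: "\<And>t0 t1 f. 0 \<le> t0 \<Longrightarrow> t0 < t1 \<Longrightarrow> t1 \<le> 1 \<Longrightarrow> f \<in> borel_measurable borel \<Longrightarrow>
       (\<And>\<gamma>. 0 \<le> f \<gamma>) \<Longrightarrow> (\<integral>\<^sup>+\<gamma>. ennreal (f \<gamma>) \<partial>\<pi>) = 1 \<Longrightarrow>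
       Ent_convex_along \<mm> K (distr (density \<pi> (\<lambda>\<gamma>. ennreal (f \<gamma>))) borel (restr t0 t1))"
    and \<epsilon>: "0 < \<epsilon>"
  obtains \<Gamma> U L d where "\<Gamma> \<in> sets \<pi>" "1 - \<epsilon> < measure \<pi> \<Gamma>" "0 < measure \<pi> \<Gamma>"
    "bounded_CD_plan \<mm> K (density \<pi> (\<lambda>\<gamma>. ennreal (indicator \<Gamma> \<gamma> / measure \<pi> \<Gamma>))) U L d"
proof -
  interpret \<pi>: prob_space \<pi> by fact
  interpret \<mm>: sigma_finite_measure \<mm>
    by (rule locally_finite_borel_measure_sigma_finite[OF lf])
  have [simp, measurable_cong]: "sets \<mm> = sets borel"
    using lf by (simp add: locally_finite_borel_measure_def)
  note sets_plan[simp, measurable_cong] = \<pi>(2)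
  have [simp]: "space \<pi> = UNIV" "space \<mm> = UNIV"
    using sets_eq_imp_space_eq[of \<pi> borel] sets_eq_imp_space_eq[of \<mm> borel] by simp_all
  have ev: "eval t \<in> measurable \<pi> borel" if "t \<in> {0..1}" for t
    using eval_measurable[OF that] by (simp add: measurable_cong_sets[OF \<pi>(2) refl])
  note [measurable] = ev[of 0, simplified] ev[of 1, simplified]
  define \<rho> where "\<rho> t x = enn2real (RN_deriv \<mm> (distr \<pi> borel (eval t)) x)" for t x
  have "\<rho> t \<in> borel_measurable \<mm>" for t unfolding \<rho>_def by measurable
  then have \<rho>[measurable]: "\<rho> t \<in> borel_measurable borel" for t by simp
  have dens: "density \<mm> (\<lambda>x. ennreal (\<rho> t x)) = distr \<pi> borel (eval t)" if "t \<in> {0, 1}" for t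
    unfolding \<rho>_def
  proof (rule \<mm>.density_enn2real_RN_deriv)
    show "finite_measure (distr \<pi> borel (eval t))"
      using that by (intro prob_space.finite_measure \<pi>.prob_space_distr ev) auto
  qed (use ac0 ac1 that in auto)
  define B where "B n = {\<gamma>. \<rho> 0 (eval 0 \<gamma>) \<le> real n \<and> \<rho> 1 (eval 1 \<gamma>) \<le> real n}" for n
  have B: "B n \<in> sets \<pi>" for n
  proof -
    have "{\<gamma> \<in> space \<pi>. \<rho> 0 (eval 0 \<gamma>) \<le> real n \<and> \<rho> 1 (eval 1 \<gamma>) \<le> real n} \<in> sets \<pi>" by measurable
    then show ?thesis by (simp add: B_def)
  qed
  have "(\<lambda>n. measure \<pi> (B n)) \<longlonglongrightarrow> measure \<pi> (\<Union>n. B n)"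
    using B by (intro \<pi>.finite_Lim_measure_incseq) (auto simp: incseq_def B_def)
  moreover have "(\<Union>n. B n) = UNIV"
  proof (intro equalityI subsetI)
    fix \<gamma>
    obtain n where "max (\<rho> 0 (eval 0 \<gamma>)) (\<rho> 1 (eval 1 \<gamma>)) \<le> real n" using real_arch_simple by blast
    then show "\<gamma> \<in> (\<Union>n. B n)" by (auto simp: B_def)
  qed simp
  ultimately have "(\<lambda>n. measure \<pi> (B n)) \<longlonglongrightarrow> 1" using \<pi>.prob_space by simp
  then have "\<forall>\<^sub>F n in sequentially. max 0 (1 - \<epsilon>) < measure \<pi> (B n)"
    using \<epsilon> by (intro order_tendstoD(1)) auto
  then obtain n where n: "max 0 (1 - \<epsilon>) < measure \<pi> (B n)"
    using eventually_happens'[OF sequentially_bot] by blast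
  define m where "m = max 0 (1 - \<epsilon>)"
  have m: "0 \<le> m" "1 - \<epsilon> \<le> m" by (auto simp: m_def)
  have "ennreal m < emeasure \<pi> (B n)"
    using n m by (simp add: \<pi>.emeasure_eq_measure ennreal_less_iff flip: m_def)
  also have "emeasure \<pi> (B n) = (SUP K \<in> {K. K \<subseteq> B n \<and> compact K}. emeasure \<pi> K)"
    by (rule inner_regular) (use B[of n] \<pi>.emeasure_finite in auto)
  finally obtain \<Gamma> where \<Gamma>: "\<Gamma> \<subseteq> B n" "compact \<Gamma>" and "ennreal m < emeasure \<pi> \<Gamma>"
    unfolding less_SUP_iff by blast
  then have \<Gamma>m: "0 < measure \<pi> \<Gamma>" "1 - \<epsilon> < measure \<pi> \<Gamma>"
    using m by (auto simp add: \<pi>.emeasure_eq_measure ennreal_less_iff)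
  have \<Gamma>s[measurable]: "\<Gamma> \<in> sets borel" using \<Gamma> by (simp add: borel_closed compact_imp_closed)
  \<comment> \<open>The points visited by \<open>\<Gamma>\<close>: compactness yields both the
    length bound \<open>d\<close> and a neighbourhood \<open>U\<close> of finite measure.\<close>
  define S where "S = (\<lambda>(t, \<gamma>). eval t \<gamma>) ` ({0..1} \<times> \<Gamma>)"
  have S: "compact S" unfolding S_def
    by (intro compact_continuous_image continuous_on_subset[OF continuous_on_eval] compact_Times \<Gamma>) auto
  obtain U where U: "open U" "S \<subseteq> U" "emeasure \<mm> U < \<infinity>"
    by (rule locally_finite_borel_measure_compact_nbhd[OF lf S])
  obtain d where d: "\<And>x y. x \<in> S \<Longrightarrow> y \<in> S \<Longrightarrow> dist x y \<le> d"
    using compact_imp_bounded[OF S] unfolding bounded_two_points by blast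
  have evS: "eval t \<gamma> \<in> S" if "t \<in> {0..1}" "\<gamma> \<in> \<Gamma>" for t \<gamma>
    unfolding S_def using that by (intro image_eqI[of _ _ "(t, \<gamma>)"]) auto
  define p where "p = measure \<pi> \<Gamma>"
  have p: "p > 0" using \<Gamma>m by (simp add: p_def)
  define \<pi>' where "\<pi>' = density \<pi> (\<lambda>\<gamma>. ennreal (indicator \<Gamma> \<gamma> / p))"
  have em: "emeasure \<pi>' D = ennreal (1 / p) * emeasure \<pi> (\<Gamma> \<inter> D)" if [measurable]: "D \<in> sets borel" for D
  proof -
    have "emeasure \<pi>' D = (\<integral>\<^sup>+\<gamma>. ennreal (1 / p) * indicator (\<Gamma> \<inter> D) \<gamma> \<partial>\<pi>)"
      unfolding \<pi>'_def by (subst emeasure_density) (auto intro!: nn_integral_cong split: split_indicator)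
    then show ?thesis by (simp add: nn_integral_cmult_indicator)
  qed
  have AE': "AE \<gamma> in \<pi>'. \<gamma> \<in> \<Gamma>"
    unfolding \<pi>'_def by (subst AE_density) (auto split: split_indicator_asm)
  \<comment> \<open>Conditioning raises the density bound from \<open>n\<close> to
    \<open>n / p\<close>; the maximum with 1 ensures \<open>1 \<le> L\<close>.\<close>
  have marginal_le: "emeasure \<pi>' {\<gamma>. eval t \<gamma> \<in> A} \<le> ennreal (max 1 (real n / p)) * emeasure \<mm> A"
    if t: "t \<in> {0, 1}" and A[measurable]: "A \<in> sets borel" for t A
  proof -
    have t01: "t \<in> {0..1}" using t by auto
    note [measurable] = ev[OF t01] eval_measurable[OF t01]
    have A': "{\<gamma>. eval t \<gamma> \<in> A} \<in> sets borel" "{\<gamma>. eval t \<gamma> \<in> A \<inter> {x. \<rho> t x \<le> real n}} \<in> sets borel"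
      by measurable
    have "emeasure \<pi> (\<Gamma> \<inter> {\<gamma>. eval t \<gamma> \<in> A}) \<le> emeasure \<pi> {\<gamma>. eval t \<gamma> \<in> A \<inter> {x. \<rho> t x \<le> real n}}"
      using \<Gamma>(1) A'(2) t by (intro emeasure_mono) (auto simp: B_def)
    also have "\<dots> = emeasure (distr \<pi> borel (eval t)) (A \<inter> {x. \<rho> t x \<le> real n})"
      by (subst emeasure_distr) (auto simp: vimage_def)
    also have "\<dots> \<le> ennreal (real n) * emeasure \<mm> A"
      unfolding dens[OF t, symmetric] using emeasure_density_sublevel_le[of "\<rho> t" \<mm> A "real n"] by simp
    finally have "emeasure \<pi>' {\<gamma>. eval t \<gamma> \<in> A} \<le> ennreal (1 / p) * (ennreal (real n) * emeasure \<mm> A)"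
      unfolding em[OF A'(1)] by (rule mult_left_mono) simp
    also have "\<dots> = ennreal (real n / p) * emeasure \<mm> A"
      using p by (simp add: mult.assoc[symmetric] ennreal_mult[symmetric])
    also have "\<dots> \<le> ennreal (max 1 (real n / p)) * emeasure \<mm> A"
      by (intro mult_right_mono ennreal_leI) auto
    finally show ?thesis .
  qed
  have "bounded_CD_plan \<mm> K \<pi>' U (max 1 (real n / p)) d"
  proof (rule bounded_CD_plan.intro)
    show "locally_finite_borel_measure \<mm>" "open U" "emeasure \<mm> U < \<infinity>" "1 \<le> max 1 (real n / p)"
      by (rule lf, rule U, rule U) simp
    show "prob_space \<pi>'"
    proof (rule prob_spaceI)
      have "emeasure \<pi>' (space \<pi>') = ennreal (1 / p) * ennreal p"
        using em[of UNIV] by (simp add: \<pi>'_def[symmetric] p_def \<pi>.emeasure_eq_measure) (simp add: \<pi>'_def)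
      then show "emeasure \<pi>' (space \<pi>') = 1" using p by (simp flip: ennreal_mult)
    qed
    show "sets \<pi>' = sets borel" by (simp add: \<pi>'_def)
    show "AE \<gamma> in \<pi>'. \<forall>t\<in>{0..1}. eval t \<gamma> \<in> U"
      using AE' by eventually_elim (use evS U(2) in blast)
    show "AE \<gamma> in \<pi>'. dist (eval 0 \<gamma>) (eval 1 \<gamma>) \<le> d"
      using AE' by eventually_elim (use evS in \<open>auto intro!: d\<close>)
    show "emeasure \<pi>' {\<gamma>. eval 0 \<gamma> \<in> A} \<le> ennreal (max 1 (real n / p)) * emeasure \<mm> A" if "A \<in> sets borel" for A
      using that by (intro marginal_le) auto
    show "emeasure \<pi>' {\<gamma>. eval 1 \<gamma> \<in> A} \<le> ennreal (max 1 (real n / p)) * emeasure \<mm> A" if "A \<in> sets borel" for A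
      using that by (intro marginal_le) auto
    fix t0 t1 :: real and f :: "'a geo \<Rightarrow> real"
    assume t: "0 \<le> t0" "t0 < t1" "t1 \<le> 1" and f[measurable]: "f \<in> borel_measurable borel"
      and nn: "\<And>\<gamma>. 0 \<le> f \<gamma>" and 1: "(\<integral>\<^sup>+\<gamma>. ennreal (f \<gamma>) \<partial>\<pi>') = 1"
    \<comment> \<open>A density with respect to the conditioned plan is one with respect to
      \<open>\<pi>\<close> after multiplication by the indicator of \<open>\<Gamma>\<close> over
      \<open>p\<close>; convexity for arbitrary densities is what passes to the restriction.\<close>
    define g where "g = (\<lambda>\<gamma>. indicator \<Gamma> \<gamma> / p * f \<gamma>)"
    have g: "ennreal (g \<gamma>) = ennreal (indicator \<Gamma> \<gamma> / p) * ennreal (f \<gamma>)" for \<gamma>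
      unfolding g_def using nn p by (intro ennreal_mult) auto
    have "Ent_convex_along \<mm> K (distr (density \<pi> (\<lambda>\<gamma>. ennreal (g \<gamma>))) borel (restr t0 t1))"
    proof (rule convex[OF t])
      show "g \<in> borel_measurable borel" by (simp add: g_def)
      show "0 \<le> g \<gamma>" for \<gamma> using nn p by (simp add: g_def)
      show "(\<integral>\<^sup>+\<gamma>. ennreal (g \<gamma>) \<partial>\<pi>) = 1"
        using 1 unfolding \<pi>'_def g by (subst (asm) nn_integral_density) auto
    qed
    also have "density \<pi> (\<lambda>\<gamma>. ennreal (g \<gamma>)) = density \<pi>' (\<lambda>\<gamma>. ennreal (f \<gamma>))"
      unfolding \<pi>'_def g by (subst density_density_eq) auto
    finally show "Ent_convex_along \<mm> K (distr (density \<pi>' (\<lambda>\<gamma>. ennreal (f \<gamma>))) borel (restr t0 t1))" .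
  qed
  then show thesis
    using \<Gamma>m \<Gamma>s unfolding \<pi>'_def p_def by (intro that[of \<Gamma>]) auto
qed

theorem theorem1p1:
  fixes K :: real and \<mm> \<mu>0 \<mu>1 :: "'a::polish_space measure"
  assumes "locally_finite_borel_measure \<mm>"
    and "very_strict_CD K \<mm>"
    and "\<mu>0 \<in> borel_prob2" and "absolutely_continuous \<mm> \<mu>0"
    and "\<mu>1 \<in> borel_prob2" and "absolutely_continuous \<mm> \<mu>1"
  shows "\<exists>\<pi>\<in>OptGeo \<mu>0 \<mu>1. \<exists>T::'a \<Rightarrow> 'a geo. T \<in> borel_measurable borel \<and> \<pi> = distr \<mu>0 borel T"
proof -
  obtain \<pi> where opt: "\<pi> \<in> OptGeo \<mu>0 \<mu>1"
    and convex: "\<And>t0 t1 f. 0 \<le> t0 \<Longrightarrow> t0 < t1 \<Longrightarrow> t1 \<le> 1 \<Longrightarrow> f \<in> borel_measurable borel \<Longrightarrow>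
       (\<And>\<gamma>. 0 \<le> f \<gamma>) \<Longrightarrow> (\<integral>\<^sup>+\<gamma>. ennreal (f \<gamma>) \<partial>\<pi>) = 1 \<Longrightarrow>
       Ent_convex_along \<mm> K (distr (density \<pi> (\<lambda>\<gamma>. ennreal (f \<gamma>))) borel (restr t0 t1))"
    using assms unfolding very_strict_CD_def by meson
  have \<pi>: "prob_space \<pi>" "sets \<pi> = sets borel"
    using opt by (auto simp: OptGeo_def borel_prob_def)
  interpret \<pi>: prob_space \<pi> by fact
  note sets_plan[simp, measurable_cong] = \<pi>(2)
  have [simp]: "space \<pi> = UNIV" using sets_eq_imp_space_eq[of \<pi> borel] by simp
  have ev[measurable]: "eval t \<in> measurable \<pi> borel" if "t \<in> {0..1}" for t
    using eval_measurable[OF that] by (simp add: measurable_cong_sets[OF \<pi>(2) refl])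
  have ev0: "eval 0 \<in> measurable \<pi> borel" by (rule ev) simp
  have pair: "(\<lambda>\<gamma>. (eval 0 \<gamma>, eval 1 \<gamma>)) \<in> measurable \<pi> borel"
    by (rule borel_measurable_Pair) (auto intro: ev)
  have [measurable]: "fst \<in> borel_measurable (borel :: ('a \<times> 'a) measure)" "snd \<in> borel_measurable (borel :: ('a \<times> 'a) measure)"
    by (auto intro!: borel_measurable_continuous_onI continuous_intros)
  have marginals: "distr \<pi> borel (eval 0) = \<mu>0" "distr \<pi> borel (eval 1) = \<mu>1"
    using opt pair by (auto simp: OptGeo_def Opt_def couplings_def distr_distr comp_def)
  have agree: "\<exists>C'\<in>sets borel. AE \<gamma> in \<pi>. \<gamma> \<in> {\<gamma>. eval t \<gamma> \<in> C} \<longleftrightarrow> eval 0 \<gamma> \<in> C'"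
    if t: "0 < t" "t < 1" and C: "C \<in> sets borel" for t C
  proof (rule \<pi>.agreement_if_approximable[OF ev0])
    have "t \<in> {0..1}" using t by auto
    from measurable_sets[OF ev[OF this] C] show D: "{\<gamma>. eval t \<gamma> \<in> C} \<in> sets \<pi>"
      by (simp add: vimage_def)
    fix \<epsilon> :: real assume "0 < \<epsilon>"
    then obtain \<Gamma> U L d where \<Gamma>: "\<Gamma> \<in> sets \<pi>" "1 - \<epsilon> < measure \<pi> \<Gamma>" "0 < measure \<pi> \<Gamma>"
      and plan: "bounded_CD_plan \<mm> K (density \<pi> (\<lambda>\<gamma>. ennreal (indicator \<Gamma> \<gamma> / measure \<pi> \<Gamma>))) U L d"
      using exists_bounded_CD_plan[OF assms(1) \<pi>, of K \<epsilon>] convex assms(4,6) unfolding marginals by metis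
    interpret plan: bounded_CD_plan \<mm> K "density \<pi> (\<lambda>\<gamma>. ennreal (indicator \<Gamma> \<gamma> / measure \<pi> \<Gamma>))" U L d
      by (rule plan)
    obtain C' where C': "C' \<in> sets borel" and
      "AE \<gamma> in density \<pi> (\<lambda>\<gamma>. ennreal (indicator \<Gamma> \<gamma> / measure \<pi> \<Gamma>)). \<gamma> \<in> {\<gamma>. eval t \<gamma> \<in> C} \<longleftrightarrow> eval 0 \<gamma> \<in> C'"
      \<comment> \<open>Taking the event at time \<open>t\<close> as \<open>D\<close> and
        \<open>s0 = t\<close>, agreement between interior times is the hypothesis of the argument at
        time 0.\<close>
      using plan.initial_time_agreement[of "{\<gamma>. eval t \<gamma> \<in> C}" t] plan.interior_times_agreement[of _ t C] D t C by auto
    then have AE: "AE \<gamma> in \<pi>. \<gamma> \<in> \<Gamma> \<longrightarrow> (\<gamma> \<in> {\<gamma>. eval t \<gamma> \<in> C} \<longleftrightarrow> eval 0 \<gamma> \<in> C')"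
      using \<Gamma> by (subst (asm) AE_density) (auto elim!: eventually_mono)
    \<comment> \<open>On \<open>\<Gamma>\<close> the set \<open>C'\<close> is exact, so all
      disagreement lies in the complement, of mass less than \<open>\<epsilon>\<close>.\<close>
    have "measure \<pi> {\<gamma> \<in> space \<pi>. (\<gamma> \<in> {\<gamma>. eval t \<gamma> \<in> C}) \<noteq> (eval 0 \<gamma> \<in> C')} \<le> measure \<pi> (space \<pi> - \<Gamma>)"
      using AE \<Gamma> by (intro \<pi>.finite_measure_mono_AE) (auto elim!: eventually_mono)
    also have "\<dots> \<le> \<epsilon>" using \<Gamma> by (subst \<pi>.prob_compl) auto
    finally show "\<exists>C'\<in>sets borel. measure \<pi> {\<gamma> \<in> space \<pi>. (\<gamma> \<in> {\<gamma>. eval t \<gamma> \<in> C}) \<noteq> (eval 0 \<gamma> \<in> C')} \<le> \<epsilon>"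
      using C' by blast
  qed
  have ball: "\<exists>C\<in>sets borel. AE \<gamma> in \<pi>. \<gamma> \<in> cball \<eta> r \<longleftrightarrow> eval 0 \<gamma> \<in> C" for \<eta> :: "'a geo" and r
  proof -
    \<comment> \<open>Countably many times keep the union of exceptional sets null. The closed
      condition \<open>dist \<le> r\<close> extends by continuity from \<open>I\<close> to its
      closure \<open>[0, 1]\<close>, which is why closed balls are used.\<close>
    define I where "I = \<rat> \<inter> {0<..<1::real}"
    have I: "countable I" "I \<noteq> {}"
    proof -
      show "countable I" unfolding I_def by (intro countable_Int1 countable_rat)
      have "1 / 2 \<in> I" by (simp add: I_def)
      then show "I \<noteq> {}" by blast
    qed
    have cball: "cball \<eta> r = {\<gamma>. \<forall>t\<in>I. eval t \<gamma> \<in> cball (eval t \<eta>) r}"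
    proof (intro equalityI subsetI CollectI ballI)
      fix \<gamma> t assume "\<gamma> \<in> cball \<eta> r" "t \<in> I"
      then show "eval t \<gamma> \<in> cball (eval t \<eta>) r"
        using dist_eval_le_dist[of t \<eta> \<gamma>] by (auto simp: I_def)
    next
      fix \<gamma> assume "\<gamma> \<in> {\<gamma>. \<forall>t\<in>I. eval t \<gamma> \<in> cball (eval t \<eta>) r}"
      then have le: "dist (eval t \<eta>) (eval t \<gamma>) \<le> r" if "t \<in> I" for t using that by auto
      have cont: "continuous_on {0..1} (\<lambda>t. dist (eval t \<eta>) (eval t \<gamma>))"
        unfolding eval_def using is_geodesic_Rep_geo[of \<eta>] is_geodesic_Rep_geo[of \<gamma>]
        by (intro continuous_on_dist) (auto simp: is_geodesic_def)
      have cl: "closure I = {0..1}"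
      proof (intro equalityI)
        show "closure I \<subseteq> {0..1}" by (rule closure_minimal) (auto simp: I_def)
        have "\<exists>q\<in>I. dist q t < e" if t: "t \<in> {0..1}" and e: "e > 0" for t e :: real
        proof -
          have "max 0 (t - e) < min 1 (t + e)" using t e by auto
          then obtain q where "q \<in> \<rat>" "max 0 (t - e) < q" "q < min 1 (t + e)"
            using Rats_dense_in_real by blast
          then show ?thesis by (intro bexI[of _ q]) (auto simp: I_def dist_real_def)
        qed
        then show "{0..1} \<subseteq> closure I" by (auto simp: closure_approachable)
      qed
      have "dist (eval t \<eta>) (eval t \<gamma>) \<le> r" if "t \<in> {0..1}" for t
        by (rule continuous_le_on_closure[OF cont[folded cl], of t r]) (use cl le that in auto)
      then show "\<gamma> \<in> cball \<eta> r" by (auto intro!: dist_geo_le)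
    qed
    have "\<forall>t\<in>I. \<exists>C'\<in>sets borel. AE \<gamma> in \<pi>. \<gamma> \<in> {\<gamma>. eval t \<gamma> \<in> cball (eval t \<eta>) r} \<longleftrightarrow> eval 0 \<gamma> \<in> C'"
      by (intro ballI agree) (auto simp: I_def)
    from bchoice[OF this[unfolded mem_Collect_eq Bex_def]]
    obtain C where "\<forall>t\<in>I. C t \<in> sets borel \<and> (AE \<gamma> in \<pi>. eval t \<gamma> \<in> cball (eval t \<eta>) r \<longleftrightarrow> eval 0 \<gamma> \<in> C t)"
      by blast
    then have C: "\<And>t. t \<in> I \<Longrightarrow> C t \<in> sets borel"
      and AE: "\<And>t. t \<in> I \<Longrightarrow> AE \<gamma> in \<pi>. eval t \<gamma> \<in> cball (eval t \<eta>) r \<longleftrightarrow> eval 0 \<gamma> \<in> C t"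
      by blast+
    have "AE \<gamma> in \<pi>. \<forall>t\<in>I. eval t \<gamma> \<in> cball (eval t \<eta>) r \<longleftrightarrow> eval 0 \<gamma> \<in> C t"
      using I(1) AE by (subst AE_ball_countable) auto
    then have "AE \<gamma> in \<pi>. \<gamma> \<in> cball \<eta> r \<longleftrightarrow> eval 0 \<gamma> \<in> (\<Inter>t\<in>I. C t)"
      unfolding cball by eventually_elim auto
    moreover have "(\<Inter>t\<in>I. C t) \<in> sets borel"
      using I C by (intro sets.countable_INT'') auto
    ultimately show ?thesis by blast
  qed
  obtain T where T: "T \<in> borel_measurable borel" "AE \<gamma> in \<pi>. T (eval 0 \<gamma>) = \<gamma>"
    by (rule left_inverse_if_agreement[OF ev0 ball])
  \<comment> \<open>As \<open>\<mu>0\<close> is the image of \<open>\<pi>\<close> under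
    \<open>eval 0\<close>, pushing it forward by the almost sure left inverse \<open>T\<close>
    returns \<open>\<pi>\<close>.\<close>
  have "distr \<mu>0 borel T = distr \<pi> borel (\<lambda>\<gamma>. T (eval 0 \<gamma>))"
    unfolding marginals(1)[symmetric] using T(1) ev0 by (subst distr_distr) (auto simp: comp_def)
  also have "\<dots> = distr \<pi> borel (\<lambda>\<gamma>. \<gamma>)"
    using T ev0 by (intro distr_cong_AE) auto
  also have "\<dots> = \<pi>" using distr_id2[OF \<pi>(2)[symmetric]] by simp
  finally show ?thesis using opt T(1) by auto
qed

end
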